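(* Let $(A,\mu,E,\Delta,\epsilon)$ be a regular weak multiplier bialgebra over a field $k$ with a right full comultiplication, and let $R:=\{\sqcap^R(a)\mid a\in A\}\subseteq\mathbb M(A)$. Then $R$ is a (coassociative, counital) coalgebra with counit $\varepsilon:R\to k$, $\varepsilon(\sqcap^R(a))=\epsilon(a)$, and comultiplication $\delta:R\to R\otimes R$, $\delta(\sqcap^R(a))=(\sqcap^R(a)\otimes1)F=F(1\otimes\sqcap^R(a))$.
   Context: Let $k$ be a field; $\langle X\rangle$ is linear span; $\mathsf{tw}(x\otimes y)=y\otimes x$. A non-unital $k$-algebra $A$ is idempotent if its multiplication $\mu$ is surjective and has non-degenerate multiplication if ($ab=0\ \forall a$)$\Rightarrow b=0$ and ($ba=0\ \forall a$)$\Rightarrow b=0$. $\mathbb M(A)$ is its multiplier algebra (pairs $(\lambda,\rho)$ of linear maps $A\to A$ with $a\lambda(b)=\rho(a)b$), a unital algebra containing $A$ as a dense ideal; $A\otimes A\subseteq\mathbb M(A)\otimes\mathbb M(A)\subseteq\mathbb M(A\otimes A)$. Multiplicative $\gamma:A\to\mathbb M(B)$ with idempotent $e\in\mathbb M(B)$, $\langle\gamma(a)b\rangle=eB$, $\langle b\gamma(a)\rangle=Be$ extends uniquely to multiplicative $\overline\gamma:\mathbb M(A)\to\mathbb M(B)$ with $\overline\gamma(1)=e$. A weak multiplier bialgebra: idempotent $A$ with non-degenerate multiplication, idempotent $E\in\mathbb M(A\otimes A)$, multiplicative linear $\Delta:A\to\mathbb M(A\otimes A)$, linear $\epsilon:A\to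 k$ with: (i) $T_1(a\otimes b):=\Delta(a)(1\otimes b)$, $T_2(a\otimes b):=(a\otimes1)\Delta(b)$ lie in $A\otimes A$; (ii) $(T_2\otimes\mathrm{id})(\mathrm{id}\otimes T_1)=(\mathrm{id}\otimes T_1)(T_2\otimes\mathrm{id})$; (iii) $(\epsilon\otimes\mathrm{id})T_1=\mu=(\mathrm{id}\otimes\epsilon)T_2$; (iv) $\langle\Delta(a)(b\otimes b')\rangle=\langle E(b\otimes b')\rangle$, $\langle(b\otimes b')\Delta(a)\rangle=\langle(b\otimes b')E\rangle$; (v) $(E\otimes1)(1\otimes E)=E^{(3)}=(1\otimes E)(E\otimes1)$ with $E^{(3)}:=(\overline{\mathrm{id}\otimes\Delta})(E)=(\overline{\Delta\otimes\mathrm{id}})(E)$; (vi) $(\epsilon\otimes\mathrm{id})((1\otimes a)E(b\otimes c))=(\epsilon\otimes\mathrm{id})(\Delta(a)(b\otimes c))$ and $(\epsilon\otimes\mathrm{id})((a\otimes b)E(1\otimes c))=(\epsilon\otimes\mathrm{id})((a\otimes b)\Delta(c))$. Regular: also $T_3(a\otimes b):=(1\otimes b)\Delta(a)$ and $T_4(a\otimes b):=\Delta(b)(a\otimes1)$ lie in $A\otimes A$. Right full comultiplication: $\langle(\mathrm{id}\otimes\omega)(\Delta(a)(1\otimes b))\mid a,b\in A,\ \omega\in\mathrm{Lin}(A,k)\rangle=A$. Multipliers for $a\in A$: $\overline\sqcap^R(a)$ with $b\overline\sqcap^R(a)=(\mathrm{id}\otimes\epsilon)(\Delta(b)(1\otimes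 a))$, $\overline\sqcap^R(a)b=(\mathrm{id}\otimes\epsilon)(E(b\otimes a))$; $\sqcap^R(a)$ with $b\sqcap^R(a)=(\mathrm{id}\otimes\epsilon)((b\otimes a)E)$, $\sqcap^R(a)b=(\mathrm{id}\otimes\epsilon)((1\otimes a)\Delta(b))$. $F\in\mathbb M(A\otimes A)$ is the multiplier with $F(a\otimes bc)=((\overline\sqcap^R\otimes\mathrm{id})(\mathsf{tw}\,T_4(c\otimes b)))(a\otimes1)$ and $(ab\otimes c)F=(1\otimes c)((\mathrm{id}\otimes\sqcap^R)T_2(a\otimes b))$ (these are well defined). It is known that the linear map $\varepsilon$ is well defined and that $(\sqcap^R(a)\otimes1)F=F(1\otimes\sqcap^R(a))\in R\otimes R$ for all $a$; equivalently $\delta(\sqcap^R(ab))=(\sqcap^R\otimes\sqcap^R)T_2(a\otimes b)$. *)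

theory Defs
  imports Main HOL.Vector_Spaces "HOL-Library.Function_Algebras" "HOL-Library.Product_Plus"
begin

text \<open>
Conventions.  The field is a type 'k::field, the algebra A is the whole carrier of a type
'a::ab_group_add with a k-scalar multiplication sc (a vector space) and a multiplication mu.
Tensors in V (x) V are represented faithfully (over a field) by the bilinear form they induce on
pairs of linear functionals:  sum x_i (x) y_i  |->  (f,g) |-> sum f(x_i) g(y_i)
(value 0 if f or g is not linear).  Similarly for threefold tensors.
A multiplier is a pair (lambda, rho) of maps (left action, right action);
M(A) is modelled by pairs of maps 'a => 'a.
\<close>

type_synonym ('k,'b) form2 = "('b \<Rightarrow> 'k) \<Rightarrow> ('b \<Rightarrow> 'k) \<Rightarrow> 'k"
type_synonym ('k,'b) form3 = "('b \<Rightarrow> 'k) \<Rightarrow> ('b \<Rightarrow> 'k) \<Rightarrow> ('b \<Rightarrow> 'k) \<Rightarrow> 'k"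
type_synonym 't mltp = "('t \<Rightarrow> 't) \<times> ('t \<Rightarrow> 't)"

definition lf :: "('k::field \<Rightarrow> 'b::ab_group_add \<Rightarrow> 'b) \<Rightarrow> ('b \<Rightarrow> 'k) \<Rightarrow> bool" where
  "lf sc f \<longleftrightarrow> (\<forall>x y. f (x + y) = f x + f y) \<and> (\<forall>c x. f (sc c x) = c * f x)"

definition ten2 :: "('k::field \<Rightarrow> 'b::ab_group_add \<Rightarrow> 'b) \<Rightarrow> ('b \<times> 'b) list \<Rightarrow> ('k,'b) form2" where
  "ten2 sc xs = (\<lambda>f g. if lf sc f \<and> lf sc g then (\<Sum>(x,y)\<leftarrow>xs. f x * g y) else 0)"

definition ten3 :: "('k::field \<Rightarrow> 'b::ab_group_add \<Rightarrow> 'b) \<Rightarrow> ('b \<times> 'b \<times> 'b) list \<Rightarrow> ('k,'b) form3" where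
  "ten3 sc xs = (\<lambda>f g h. if lf sc f \<and> lf sc g \<and> lf sc h
                          then (\<Sum>(x,y,z)\<leftarrow>xs. f x * g y * h z) else 0)"

definition ten :: "('k::field \<Rightarrow> 'b::ab_group_add \<Rightarrow> 'b) \<Rightarrow> 'b \<Rightarrow> 'b \<Rightarrow> ('k,'b) form2" where
  "ten sc a b = ten2 sc [(a,b)]"

definition T2s :: "('k::field \<Rightarrow> 'b::ab_group_add \<Rightarrow> 'b) \<Rightarrow> ('k,'b) form2 set" where
  "T2s sc = range (ten2 sc)"

definition T3s :: "('k::field \<Rightarrow> 'b::ab_group_add \<Rightarrow> 'b) \<Rightarrow> ('k,'b) form3 set" where
  "T3s sc = range (ten3 sc)"

definition fsc2 :: "'k::field \<Rightarrow> ('k,'b) form2 \<Rightarrow> ('k,'b) form2" where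
  "fsc2 c t = (\<lambda>f g. c * t f g)"

definition fsc3 :: "'k::field \<Rightarrow> ('k,'b) form3 \<Rightarrow> ('k,'b) form3" where
  "fsc3 c t = (\<lambda>f g h. c * t f g h)"

definition tmap2 :: "('k::field \<Rightarrow> 'b::ab_group_add \<Rightarrow> 'b) \<Rightarrow> ('b \<Rightarrow> 'b) \<Rightarrow> ('b \<Rightarrow> 'b)
    \<Rightarrow> ('k,'b) form2 \<Rightarrow> ('k,'b) form2" where
  "tmap2 sc \<phi> \<psi> t = (\<lambda>f g. if lf sc f \<and> lf sc g then t (f \<circ> \<phi>) (g \<circ> \<psi>) else 0)"

definition tmap3 :: "('k::field \<Rightarrow> 'b::ab_group_add \<Rightarrow> 'b) \<Rightarrow> ('b \<Rightarrow> 'b) \<Rightarrow> ('b \<Rightarrow> 'b)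
    \<Rightarrow> ('b \<Rightarrow> 'b) \<Rightarrow> ('k,'b) form3 \<Rightarrow> ('k,'b) form3" where
  "tmap3 sc \<phi> \<psi> \<chi> t = (\<lambda>f g h. if lf sc f \<and> lf sc g \<and> lf sc h
                                 then t (f \<circ> \<phi>) (g \<circ> \<psi>) (h \<circ> \<chi>) else 0)"

definition tw :: "('k,'b) form2 \<Rightarrow> ('k,'b) form2" where
  "tw t = (\<lambda>f g. t g f)"

definition rep2 :: "('k::field \<Rightarrow> 'b::ab_group_add \<Rightarrow> 'b) \<Rightarrow> ('k,'b) form2 \<Rightarrow> ('b \<times> 'b) list" where
  "rep2 sc t = (SOME xs. ten2 sc xs = t)"

definition rep3 :: "('k::field \<Rightarrow> 'b::ab_group_add \<Rightarrow> 'b) \<Rightarrow> ('k,'b) form3 \<Rightarrow> ('b \<times> 'b \<times> 'b) list" where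
  "rep3 sc t = (SOME xs. ten3 sc xs = t)"

definition tmul2 :: "('k::field \<Rightarrow> 'b::ab_group_add \<Rightarrow> 'b) \<Rightarrow> ('b \<Rightarrow> 'b \<Rightarrow> 'b)
    \<Rightarrow> ('k,'b) form2 \<Rightarrow> ('k,'b) form2 \<Rightarrow> ('k,'b) form2" where
  "tmul2 sc mu s t = (\<Sum>(x,y)\<leftarrow>rep2 sc s. tmap2 sc (mu x) (mu y) t)"

definition tmul3 :: "('k::field \<Rightarrow> 'b::ab_group_add \<Rightarrow> 'b) \<Rightarrow> ('b \<Rightarrow> 'b \<Rightarrow> 'b)
    \<Rightarrow> ('k,'b) form3 \<Rightarrow> ('k,'b) form3 \<Rightarrow> ('k,'b) form3" where
  "tmul3 sc mu s t = (\<Sum>(x,y,z)\<leftarrow>rep3 sc s. tmap3 sc (mu x) (mu y) (mu z) t)"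

definition slice_r :: "('k::field \<Rightarrow> 'b::ab_group_add \<Rightarrow> 'b) \<Rightarrow> ('k,'b) form2 \<Rightarrow> ('b \<Rightarrow> 'k) \<Rightarrow> 'b" where
  "slice_r sc t \<omega> = (SOME x. \<forall>f. lf sc f \<longrightarrow> f x = t f \<omega>)"

definition slice_l :: "('k::field \<Rightarrow> 'b::ab_group_add \<Rightarrow> 'b) \<Rightarrow> ('b \<Rightarrow> 'k) \<Rightarrow> ('k,'b) form2 \<Rightarrow> 'b" where
  "slice_l sc \<omega> t = (SOME x. \<forall>g. lf sc g \<longrightarrow> g x = t \<omega> g)"

definition is_mult_on :: "'t::plus set \<Rightarrow> ('t \<Rightarrow> 't \<Rightarrow> 't) \<Rightarrow> ('k \<Rightarrow> 't \<Rightarrow> 't) \<Rightarrow> 't mltp \<Rightarrow> bool" where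
  "is_mult_on S mul sm m \<longleftrightarrow>
     (\<forall>t\<in>S. fst m t \<in> S \<and> snd m t \<in> S) \<and>
     (\<forall>s\<in>S. \<forall>t\<in>S. fst m (s + t) = fst m s + fst m t \<and> snd m (s + t) = snd m s + snd m t) \<and>
     (\<forall>c. \<forall>t\<in>S. fst m (sm c t) = sm c (fst m t) \<and> snd m (sm c t) = sm c (snd m t)) \<and>
     (\<forall>s\<in>S. \<forall>t\<in>S. mul s (fst m t) = mul (snd m s) t)"

definition meq :: "'t set \<Rightarrow> 't mltp \<Rightarrow> 't mltp \<Rightarrow> bool" where
  "meq S m n \<longleftrightarrow> (\<forall>t\<in>S. fst m t = fst n t \<and> snd m t = snd n t)"

definition mprod :: "'t mltp \<Rightarrow> 't mltp \<Rightarrow> 't mltp" where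
  "mprod m n = (fst m \<circ> fst n, snd n \<circ> snd m)"

definition mscale :: "('k \<Rightarrow> 't \<Rightarrow> 't) \<Rightarrow> 'k \<Rightarrow> 't mltp \<Rightarrow> 't mltp" where
  "mscale sm c m = (\<lambda>t. sm c (fst m t), \<lambda>t. sm c (snd m t))"

definition asM :: "('t \<Rightarrow> 't \<Rightarrow> 't) \<Rightarrow> 't \<Rightarrow> 't mltp" where
  "asM mul t = (\<lambda>s. mul t s, \<lambda>s. mul s t)"

definition l1 :: "('k::field \<Rightarrow> 'a::ab_group_add \<Rightarrow> 'a) \<Rightarrow> ('a \<Rightarrow> 'a \<Rightarrow> 'a) \<Rightarrow> 'a \<Rightarrow> ('k,'a) form2 mltp" where
  "l1 sc mu a = (tmap2 sc (mu a) id, tmap2 sc (\<lambda>y. mu y a) id)"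

definition r1 :: "('k::field \<Rightarrow> 'a::ab_group_add \<Rightarrow> 'a) \<Rightarrow> ('a \<Rightarrow> 'a \<Rightarrow> 'a) \<Rightarrow> 'a \<Rightarrow> ('k,'a) form2 mltp" where
  "r1 sc mu b = (tmap2 sc id (mu b), tmap2 sc id (\<lambda>y. mu y b))"

definition mten :: "('k::field \<Rightarrow> 'a::ab_group_add \<Rightarrow> 'a) \<Rightarrow> 'a mltp \<Rightarrow> 'a mltp \<Rightarrow> ('k,'a) form2 mltp" where
  "mten sc m n = (tmap2 sc (fst m) (fst n), tmap2 sc (snd m) (snd n))"

definition embedM :: "('k::field \<Rightarrow> 'a::ab_group_add \<Rightarrow> 'a) \<Rightarrow> ('a mltp \<times> 'a mltp) list \<Rightarrow> ('k,'a) form2 mltp" where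
  "embedM sc xs = (\<Sum>(m,n)\<leftarrow>xs. mten sc m n)"

definition l11 :: "('k::field \<Rightarrow> 'a::ab_group_add \<Rightarrow> 'a) \<Rightarrow> ('a \<Rightarrow> 'a \<Rightarrow> 'a) \<Rightarrow> 'a \<Rightarrow> ('k,'a) form3 mltp" where
  "l11 sc mu a = (tmap3 sc (mu a) id id, tmap3 sc (\<lambda>y. mu y a) id id)"

definition r11 :: "('k::field \<Rightarrow> 'a::ab_group_add \<Rightarrow> 'a) \<Rightarrow> ('a \<Rightarrow> 'a \<Rightarrow> 'a) \<Rightarrow> 'a \<Rightarrow> ('k,'a) form3 mltp" where
  "r11 sc mu c = (tmap3 sc id id (mu c), tmap3 sc id id (\<lambda>y. mu y c))"

definition one_ot :: "('k::field \<Rightarrow> 'a::ab_group_add \<Rightarrow> 'a) \<Rightarrow> ('k,'a) form2 mltp \<Rightarrow> ('k,'a) form3 mltp" where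
  "one_ot sc M =
    (\<lambda>t f g h. if lf sc f \<and> lf sc g \<and> lf sc h then fst M (\<lambda>g' h'. t f g' h') g h else 0,
     \<lambda>t f g h. if lf sc f \<and> lf sc g \<and> lf sc h then snd M (\<lambda>g' h'. t f g' h') g h else 0)"

definition ot_one :: "('k::field \<Rightarrow> 'a::ab_group_add \<Rightarrow> 'a) \<Rightarrow> ('k,'a) form2 mltp \<Rightarrow> ('k,'a) form3 mltp" where
  "ot_one sc M =
    (\<lambda>t f g h. if lf sc f \<and> lf sc g \<and> lf sc h then fst M (\<lambda>f' g'. t f' g' h) f g else 0,
     \<lambda>t f g h. if lf sc f \<and> lf sc g \<and> lf sc h then snd M (\<lambda>f' g'. t f' g' h) f g else 0)"

definition T1 where
  "T1 sc mu D a b = (SOME t. t \<in> T2s sc \<and>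
      meq (T2s sc) (mprod (D a) (r1 sc mu b)) (asM (tmul2 sc mu) t))"
definition T2 where
  "T2 sc mu D a b = (SOME t. t \<in> T2s sc \<and>
      meq (T2s sc) (mprod (l1 sc mu a) (D b)) (asM (tmul2 sc mu) t))"
definition T3 where
  "T3 sc mu D a b = (SOME t. t \<in> T2s sc \<and>
      meq (T2s sc) (mprod (r1 sc mu b) (D a)) (asM (tmul2 sc mu) t))"
definition T4 where
  "T4 sc mu D a b = (SOME t. t \<in> T2s sc \<and>
      meq (T2s sc) (mprod (D b) (l1 sc mu a)) (asM (tmul2 sc mu) t))"

definition gam1 where
  "gam1 sc mu D x = (\<Sum>(a,b)\<leftarrow>rep2 sc x. mprod (l11 sc mu a) (one_ot sc (D b)))"
definition gam2 where
  "gam2 sc mu D x = (\<Sum>(a,b)\<leftarrow>rep2 sc x. mprod (ot_one sc (D a)) (r11 sc mu b))"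

text \<open>G is the (unique) extension  gamma-bar(m)  of gamma : A (x) A \<rightarrow> M(A (x) A (x) A)
  with gamma-bar(1) = e, evaluated at m: it is characterised by e G = G = G e,
  G gamma(x) = gamma(m x) and gamma(x) G = gamma(x m).\<close>
definition is_ext where
  "is_ext sc mu \<gamma> e m G \<longleftrightarrow>
     is_mult_on (T3s sc) (tmul3 sc mu) fsc3 G \<and>
     meq (T3s sc) (mprod e G) G \<and> meq (T3s sc) (mprod G e) G \<and>
     (\<forall>x\<in>T2s sc. meq (T3s sc) (mprod G (\<gamma> x)) (\<gamma> (fst m x)) \<and>
                 meq (T3s sc) (mprod (\<gamma> x) G) (\<gamma> (snd m x)))"

definition wmb ::
  "('k::field \<Rightarrow> 'a::ab_group_add \<Rightarrow> 'a) \<Rightarrow> ('a \<Rightarrow> 'a \<Rightarrow> 'a) \<Rightarrow> ('k,'a) form2 mltp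
   \<Rightarrow> ('a \<Rightarrow> ('k,'a) form2 mltp) \<Rightarrow> ('a \<Rightarrow> 'k) \<Rightarrow> bool" where
  "wmb sc mu E D eps \<longleftrightarrow>
    \<comment> \<open>non-unital k-algebra\<close>
    vector_space sc \<and>
    (\<forall>a b c. mu (mu a b) c = mu a (mu b c)) \<and>
    (\<forall>a b c. mu (a + b) c = mu a c + mu b c \<and> mu a (b + c) = mu a b + mu a c) \<and>
    (\<forall>r a b. mu (sc r a) b = sc r (mu a b) \<and> mu a (sc r b) = sc r (mu a b)) \<and>
    \<comment> \<open>idempotent, non-degenerate multiplication\<close>
    (\<forall>c. \<exists>xs. c = (\<Sum>(a,b)\<leftarrow>xs. mu a b)) \<and>
    (\<forall>b. (\<forall>a. mu a b = 0) \<longrightarrow> b = 0) \<and> (\<forall>b. (\<forall>a. mu b a = 0) \<longrightarrow> b = 0) \<and>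
    \<comment> \<open>E idempotent in M(A (x) A)\<close>
    is_mult_on (T2s sc) (tmul2 sc mu) fsc2 E \<and> meq (T2s sc) (mprod E E) E \<and>
    \<comment> \<open>Delta : A \<rightarrow> M(A (x) A) linear, multiplicative; epsilon linear\<close>
    (\<forall>a. is_mult_on (T2s sc) (tmul2 sc mu) fsc2 (D a)) \<and>
    (\<forall>a b. meq (T2s sc) (D (a + b)) (D a + D b)) \<and>
    (\<forall>r a. meq (T2s sc) (D (sc r a)) (mscale fsc2 r (D a))) \<and>
    (\<forall>a b. meq (T2s sc) (D (mu a b)) (mprod (D a) (D b))) \<and>
    lf sc eps \<and>
    \<comment> \<open>(i)\<close>
    (\<forall>a b. \<exists>t\<in>T2s sc. meq (T2s sc) (mprod (D a) (r1 sc mu b)) (asM (tmul2 sc mu) t)) \<and>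
    (\<forall>a b. \<exists>t\<in>T2s sc. meq (T2s sc) (mprod (l1 sc mu a) (D b)) (asM (tmul2 sc mu) t)) \<and>
    \<comment> \<open>(ii), evaluated on simple tensors a (x) b (x) c\<close>
    (\<forall>a b c.
       (\<lambda>f g h. if lf sc f \<and> lf sc g \<and> lf sc h
                then T1 sc mu D b c (\<lambda>u. T2 sc mu D a u f g) h else 0) =
       (\<lambda>f g h. if lf sc f \<and> lf sc g \<and> lf sc h
                then T2 sc mu D a b f (\<lambda>q. T1 sc mu D q c g h) else 0)) \<and>
    \<comment> \<open>(iii)\<close>
    (\<forall>a b. slice_l sc eps (T1 sc mu D a b) = mu a b \<and> slice_r sc (T2 sc mu D a b) eps = mu a b) \<and>
    \<comment> \<open>(iv)\<close>
    module.span fsc2 {fst (D a) (ten sc b b') | a b b'. True} =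
      module.span fsc2 {fst E (ten sc b b') | b b'. True} \<and>
    module.span fsc2 {snd (D a) (ten sc b b') | a b b'. True} =
      module.span fsc2 {snd E (ten sc b b') | b b'. True} \<and>
    \<comment> \<open>(v)\<close>
    meq (T3s sc) (mprod (ot_one sc E) (one_ot sc E)) (mprod (one_ot sc E) (ot_one sc E)) \<and>
    is_ext sc mu (gam1 sc mu D) (one_ot sc E) E (mprod (ot_one sc E) (one_ot sc E)) \<and>
    is_ext sc mu (gam2 sc mu D) (ot_one sc E) E (mprod (ot_one sc E) (one_ot sc E)) \<and>
    \<comment> \<open>(vi)\<close>
    (\<forall>a b c. slice_l sc eps (tmap2 sc id (mu a) (fst E (ten sc b c))) =
             slice_l sc eps (fst (D a) (ten sc b c))) \<and>
    (\<forall>a b c. slice_l sc eps (tmap2 sc id (\<lambda>y. mu y c) (snd E (ten sc a b))) =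
             slice_l sc eps (snd (D c) (ten sc a b)))"

definition regular_wmb where
  "regular_wmb sc mu E D eps \<longleftrightarrow> wmb sc mu E D eps \<and>
    (\<forall>a b. \<exists>t\<in>T2s sc. meq (T2s sc) (mprod (r1 sc mu b) (D a)) (asM (tmul2 sc mu) t)) \<and>
    (\<forall>a b. \<exists>t\<in>T2s sc. meq (T2s sc) (mprod (D b) (l1 sc mu a)) (asM (tmul2 sc mu) t))"

definition right_full_comult where
  "right_full_comult sc mu D \<longleftrightarrow>
     module.span sc {slice_r sc (T1 sc mu D a b) \<omega> | a b \<omega>. lf sc \<omega>} = UNIV"

definition PiR :: "('k::field \<Rightarrow> 'a::ab_group_add \<Rightarrow> 'a) \<Rightarrow> ('a \<Rightarrow> 'a \<Rightarrow> 'a) \<Rightarrow> ('k,'a) form2 mltp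
   \<Rightarrow> ('a \<Rightarrow> ('k,'a) form2 mltp) \<Rightarrow> ('a \<Rightarrow> 'k) \<Rightarrow> 'a \<Rightarrow> 'a mltp" where
  "PiR sc mu E D eps a =
     (\<lambda>b. slice_r sc (T3 sc mu D b a) eps, \<lambda>b. slice_r sc (snd E (ten sc b a)) eps)"

definition PibarR :: "('k::field \<Rightarrow> 'a::ab_group_add \<Rightarrow> 'a) \<Rightarrow> ('a \<Rightarrow> 'a \<Rightarrow> 'a) \<Rightarrow> ('k,'a) form2 mltp
   \<Rightarrow> ('a \<Rightarrow> ('k,'a) form2 mltp) \<Rightarrow> ('a \<Rightarrow> 'k) \<Rightarrow> 'a \<Rightarrow> 'a mltp" where
  "PibarR sc mu E D eps a =
     (\<lambda>b. slice_r sc (fst E (ten sc b a)) eps, \<lambda>b. slice_r sc (T1 sc mu D b a) eps)"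

definition is_F where
  "is_F sc mu E D eps F \<longleftrightarrow>
     is_mult_on (T2s sc) (tmul2 sc mu) fsc2 F \<and>
     (\<forall>a b c. fst F (ten sc a (mu b c)) =
        tmap2 sc (\<lambda>y. fst (PibarR sc mu E D eps y) a) id (tw (T4 sc mu D c b))) \<and>
     (\<forall>a b c. snd F (ten sc (mu a b) c) =
        tmap2 sc id (\<lambda>y. snd (PiR sc mu E D eps y) c) (T2 sc mu D a b))"

definition scM :: "('k::field \<Rightarrow> 'a::ab_group_add \<Rightarrow> 'a) \<Rightarrow> 'k \<Rightarrow> 'a mltp \<Rightarrow> 'a mltp" where
  "scM sc c m = (\<lambda>x. sc c (fst m x), \<lambda>x. sc c (snd m x))"

definition coalg_R ::
  "('k::field \<Rightarrow> 'a::ab_group_add \<Rightarrow> 'a) \<Rightarrow> ('a \<Rightarrow> 'a \<Rightarrow> 'a) \<Rightarrow> ('k,'a) form2 mltp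
   \<Rightarrow> ('a \<Rightarrow> ('k,'a) form2 mltp) \<Rightarrow> ('a \<Rightarrow> 'k) \<Rightarrow> ('k,'a) form2 mltp \<Rightarrow> bool" where
  "coalg_R sc mu E D eps F \<longleftrightarrow>
   (let P = PiR sc mu E D eps; R = range P in
    \<comment> \<open>R is a linear subspace of M(A)\<close>
    0 \<in> R \<and> (\<forall>r\<in>R. \<forall>s\<in>R. r + s \<in> R) \<and> (\<forall>c. \<forall>r\<in>R. scM sc c r \<in> R) \<and>
    (\<exists>(epsR :: 'a mltp \<Rightarrow> 'k) (\<delta> :: 'a mltp \<Rightarrow> ('k, 'a mltp) form2).
      \<comment> \<open>the defining formulas (this includes well-definedness)\<close>
      (\<forall>a. epsR (P a) = eps a) \<and>
      (\<forall>a. \<exists>xs. set xs \<subseteq> R \<times> R \<and> \<delta> (P a) = ten2 (scM sc) xs \<and>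
           meq (T2s sc) (embedM sc xs) (mprod (mten sc (P a) (id, id)) F) \<and>
           meq (T2s sc) (embedM sc xs) (mprod F (mten sc (id, id) (P a)))) \<and>
      \<comment> \<open>linearity on R\<close>
      (\<forall>r\<in>R. \<forall>s\<in>R. epsR (r + s) = epsR r + epsR s \<and> \<delta> (r + s) = \<delta> r + \<delta> s) \<and>
      (\<forall>c. \<forall>r\<in>R. epsR (scM sc c r) = c * epsR r \<and> \<delta> (scM sc c r) = fsc2 c (\<delta> r)) \<and>
      \<comment> \<open>coassociativity  (delta (x) id) delta = (id (x) delta) delta\<close>
      (\<forall>r\<in>R. \<forall>xs. set xs \<subseteq> R \<times> R \<and> ten2 (scM sc) xs = \<delta> r \<longrightarrow>
         (\<lambda>f g h. if lf (scM sc) f \<and> lf (scM sc) g \<and> lf (scM sc) h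
                  then (\<Sum>(p,q)\<leftarrow>xs. \<delta> p f g * h q) else 0) =
         (\<lambda>f g h. if lf (scM sc) f \<and> lf (scM sc) g \<and> lf (scM sc) h
                  then (\<Sum>(p,q)\<leftarrow>xs. f p * \<delta> q g h) else 0)) \<and>
      \<comment> \<open>counitality  (epsR (x) id) delta = id = (id (x) epsR) delta\<close>
      (\<forall>r\<in>R. \<forall>xs. set xs \<subseteq> R \<times> R \<and> ten2 (scM sc) xs = \<delta> r \<longrightarrow>
         (\<Sum>(p,q)\<leftarrow>xs. scM sc (epsR p) q) = r \<and> (\<Sum>(p,q)\<leftarrow>xs. scM sc (epsR q) p) = r)))"

end

theory Submission
  imports Defs
begin

text \<open>
Write \<open>P\<close> for \<open>\<sqinter>\<^sup>R\<close> and \<open>Q\<close> for its barred variant.  Applying \<open>\<epsilon>\<close> to a leg of the identities for \<open>E\<^sup>(\<^sup>3\<^sup>)\<close>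
yields \<open>\<Delta>(Q(z)b) = (1 \<otimes> Q(z))\<Delta>(b)\<close>, \<open>\<Delta>(aP(z)) = \<Delta>(a)(1 \<otimes> P(z))\<close> and
\<open>(P \<otimes> id)T\<^sub>1(p \<otimes> q) = (1 \<otimes> p)E(1 \<otimes> q) = (Q \<otimes> id)T\<^sub>3(q \<otimes> p)\<close>; the last one and fullness give \<open>R \<subseteq> Q(A)\<close>.
Hence \<open>P(wr) = P(w)r\<close> for \<open>r \<in> R\<close>, and therefore \<open>(r \<otimes> 1)F = F(1 \<otimes> r)\<close>.
Since \<open>P(x) = 0\<close> exactly when \<open>\<epsilon>(xz) = 0\<close> for all \<open>z\<close>, testing the second leg with \<open>\<epsilon>(-z)\<close> shows
\<open>(P(ab) \<otimes> 1)F = (P \<otimes> P)T\<^sub>2(a \<otimes> b)\<close>, which lies in \<open>R \<otimes> R\<close>.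
The counit is well defined because \<open>\<epsilon>(ab) = \<Sum> \<epsilon>(x P(y))\<close> for \<open>T\<^sub>2(a \<otimes> b) = \<Sum> x \<otimes> y\<close> (as \<open>\<Delta>(b)E = \<Delta>(b)\<close>), and
by \<open>R \<subseteq> Q(A)\<close> the summand depends only on \<open>P(x)\<close> and \<open>P(y)\<close>.
For coassociativity, expand the outer \<open>\<delta>\<close> as \<open>F(1 \<otimes> p)\<close> on one side and as \<open>(q \<otimes> 1)F\<close> on the other:
both sides become \<open>(F \<otimes> 1)(1 \<otimes> (r \<otimes> 1)F)\<close>.
\<close>

section \<open>Linear functionals and tensors as bilinear forms\<close>

text \<open>\<open>A\<close> has no unit, so identities such as \<Delta>(Q(z)b) = (1 \<otimes>
  Q(z))\<Delta>(b) cannot be obtained by putting 1 into a leg of the axioms. Each axiom is used with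
  auxiliary factors, which non-degeneracy removes one leg at a time. Modelling tensors as forms fits
  this: multiplying a leg means precomposing its functional, and freezing the functional on one leg
  of a 2-tensor leaves an element of \<open>A\<close>, a slice. An equation of slices can first be
  cancelled and then evaluated at any functional, in particular at \<open>eps\<close>; the order
  matters, since non-degeneracy cancels factors in \<open>A\<close> but not under
  \<open>eps\<close>. The same device serves R. Functionals of the form r \<mapsto> \<phi>(r a)
  suffice to compare tensors over R, so R \<otimes> R embeds into the multipliers of A \<otimes> A
  and \<delta>(r) is determined by the multiplier (r \<otimes> 1)F. Only the existence of such a
  tensor needs work; it comes from a preimage in A \<otimes> A, where the axioms speak.\<close>

definition lop :: "('k::field \<Rightarrow> 'b::ab_group_add \<Rightarrow> 'b) \<Rightarrow> ('b \<Rightarrow> 'b) \<Rightarrow> bool" where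
  "lop sc \<phi> \<longleftrightarrow> (\<forall>x y. \<phi> (x + y) = \<phi> x + \<phi> y) \<and> (\<forall>c x. \<phi> (sc c x) = sc c (\<phi> x))"

lemma lop_id: "lop sc id" "lop sc (\<lambda>x. x)"
  by (auto simp: lop_def)

lemma lf_lop: "lf sc f \<Longrightarrow> lop sc \<phi> \<Longrightarrow> lf sc (\<lambda>x. f (\<phi> x))"
  by (auto simp: lf_def lop_def)

lemma lf_add: "lf sc f \<Longrightarrow> f (x + y) = f x + f y"
  by (simp add: lf_def)

lemma lf_scale: "lf sc f \<Longrightarrow> f (sc c x) = c * f x"
  by (simp add: lf_def)

lemma lf_zero: "lf sc f \<Longrightarrow> f 0 = 0"
  using lf_add[of sc f 0 0] by (metis add_0 add_cancel_right_right)

lemma lf_sum_list: "lf sc f \<Longrightarrow> f (\<Sum>x\<leftarrow>xs. h x) = (\<Sum>x\<leftarrow>xs. f (h x))"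
  by (induction xs) (simp_all add: lf_add lf_zero)

lemma lop_diff: "lop sc \<phi> \<Longrightarrow> \<phi> (x - y) = \<phi> x - \<phi> y"
  unfolding lop_def by (metis add_diff_cancel_right' diff_add_cancel)

lemma lf_combination: "lf sc f \<Longrightarrow> lf sc g \<Longrightarrow> lf sc (\<lambda>x. f x + g x)"
  by (simp add: lf_def algebra_simps)

lemma sum_list_fun1: "(\<Sum>x\<leftarrow>xs. h x) a = (\<Sum>x\<leftarrow>xs. h x a)"
  for h :: "'x \<Rightarrow> 'y \<Rightarrow> 'z::comm_monoid_add"
  by (induction xs) simp_all

text \<open>Simplifying an eta-expanded zero form produces the abstraction on the left.\<close>

lemma zero_form [simp]: "(\<lambda>a b. 0) = 0"
  by (simp add: fun_eq_iff)

lemma ten2_apply: "lf sc f \<Longrightarrow> lf sc g \<Longrightarrow> ten2 sc xs f g = (\<Sum>(x,y)\<leftarrow>xs. f x * g y)"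
  by (simp add: ten2_def)

lemma ten_apply: "lf sc f \<Longrightarrow> lf sc g \<Longrightarrow> ten sc a b f g = f a * g b"
  by (simp add: ten_def ten2_def)

lemma ten2_in_T2s [simp]: "ten2 sc xs \<in> T2s sc"
  by (simp add: T2s_def)

lemma ten_in_T2s [simp]: "ten sc a b \<in> T2s sc"
  by (simp add: ten_def)

lemma T2s_E: "t \<in> T2s sc \<Longrightarrow> (\<And>xs. t = ten2 sc xs \<Longrightarrow> P) \<Longrightarrow> P"
  by (auto simp: T2s_def)

lemma T2s_not_lf: "t \<in> T2s sc \<Longrightarrow> \<not> (lf sc f \<and> lf sc g) \<Longrightarrow> t f g = 0"
  by (elim T2s_E) (auto simp: ten2_def)

lemma T2s_eqI:
  assumes "s \<in> T2s sc" "t \<in> T2s sc" "\<And>f g. lf sc f \<Longrightarrow> lf sc g \<Longrightarrow> s f g = t f g"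
  shows "s = t"
proof (intro ext)
  fix f g show "s f g = t f g"
    using assms T2s_not_lf[of s sc f g] T2s_not_lf[of t sc f g] by (cases "lf sc f \<and> lf sc g") auto
qed

lemma ten2_Nil: "ten2 sc [] = 0"
  by (auto simp: ten2_def fun_eq_iff)

lemma ten2_Cons: "ten2 sc ((x,y) # xs) = ten sc x y + ten2 sc xs"
  by (auto simp: ten2_def ten_def fun_eq_iff)

lemma ten2_append: "ten2 sc (xs @ ys) = ten2 sc xs + ten2 sc ys"
  by (auto simp: ten2_def fun_eq_iff)

lemma T2s_zero [simp]: "0 \<in> T2s sc"
  unfolding ten2_Nil[of sc, symmetric] by (rule ten2_in_T2s)

lemma T2s_add [simp]: "s \<in> T2s sc \<Longrightarrow> t \<in> T2s sc \<Longrightarrow> s + t \<in> T2s sc"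
  by (metis T2s_E ten2_append ten2_in_T2s)

lemma T2s_sum_list: "(\<And>x. x \<in> set xs \<Longrightarrow> h x \<in> T2s sc) \<Longrightarrow> (\<Sum>x\<leftarrow>xs. h x) \<in> T2s sc"
  by (induction xs) simp_all

lemma T2s_induct [consumes 1, case_names zero add]:
  assumes "t \<in> T2s sc" "P 0" "\<And>x y t. t \<in> T2s sc \<Longrightarrow> P t \<Longrightarrow> P (ten sc x y + t)"
  shows "P t"
proof -
  have "P (ten2 sc xs)" for xs
    by (induction xs) (auto simp: ten2_Nil ten2_Cons assms)
  then show ?thesis using assms(1) by (auto elim: T2s_E)
qed

lemma tmap2_apply: "lf sc f \<Longrightarrow> lf sc g \<Longrightarrow> tmap2 sc \<phi> \<psi> t f g = t (\<lambda>x. f (\<phi> x)) (\<lambda>y. g (\<psi> y))"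
  by (simp add: tmap2_def comp_def)

lemma tmap2_add: "tmap2 sc \<phi> \<psi> (s + t) = tmap2 sc \<phi> \<psi> s + tmap2 sc \<phi> \<psi> t"
  by (auto simp: tmap2_def fun_eq_iff)

lemma tmap2_zero: "tmap2 sc \<phi> \<psi> 0 = 0"
  by (auto simp: tmap2_def fun_eq_iff)

lemma tmap2_scale: "tmap2 sc \<phi> \<psi> (fsc2 c t) = fsc2 c (tmap2 sc \<phi> \<psi> t)"
  by (auto simp: tmap2_def fsc2_def fun_eq_iff)

lemma tmap2_ten:
  "lop sc \<phi> \<Longrightarrow> lop sc \<psi> \<Longrightarrow> tmap2 sc \<phi> \<psi> (ten sc x y) = ten sc (\<phi> x) (\<psi> y)"
  by (auto simp: tmap2_def ten_def ten2_def fun_eq_iff comp_def lf_lop)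

lemma tmap2_in_T2s:
  assumes "lop sc \<phi>" "lop sc \<psi>" "t \<in> T2s sc"
  shows "tmap2 sc \<phi> \<psi> t \<in> T2s sc"
  using assms(3)
proof (induction rule: T2s_induct)
  case zero
  then show ?case by (simp add: tmap2_zero)
next
  case (add x y t)
  then have "tmap2 sc \<phi> \<psi> (ten sc x y) + tmap2 sc \<phi> \<psi> t \<in> T2s sc"
    using assms(1,2) by (simp add: tmap2_ten)
  then show ?case unfolding tmap2_add .
qed

lemma lf_fst: "lf sc f \<Longrightarrow> lf (scM sc) (\<lambda>m. f (fst m a))"
  by (auto simp: lf_def scM_def)

lemma vector_space_scM: "vector_space sc \<Longrightarrow> vector_space (scM sc)"
  unfolding vector_space_def scM_def by (auto simp: fun_eq_iff prod_eq_iff)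

lemma module_fsc2: "module (fsc2 :: 'k::field \<Rightarrow> ('k,'b) form2 \<Rightarrow> ('k,'b) form2)"
  by unfold_locales (auto simp: fsc2_def fun_eq_iff algebra_simps)

context vector_space
begin

text \<open>The coordinates with respect to a basis are linear functionals, and a vector is
  recovered from its coordinates.\<close>

lemma lf_separates:
  assumes "\<And>f. lf scale f \<Longrightarrow> f x = f y"
  shows "x = y"
proof -
  let ?B = "extend_basis {}"
  have B: "independent ?B" and sp: "span ?B = UNIV"
    using independent_extend_basis[OF independent_empty] span_extend_basis[OF independent_empty] by auto
  have lfr: "lf scale (\<lambda>v. representation ?B v b)" for b
    unfolding lf_def using representation_add[OF B] representation_scale[OF B] sp by auto
  have "representation ?B x = representation ?B y"
    using assms[OF lfr] by (simp add: fun_eq_iff)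
  then show ?thesis
    using sum_nonzero_representation_eq[OF B, of x] sum_nonzero_representation_eq[OF B, of y]
    unfolding sp by (metis UNIV_I)
qed

text \<open>Bilinear maps factor through tensors given as forms. Expanding the second entries in a
  basis turns each side into a sum of B(c_b, b), where c_b sums the first entries weighted by the
  b-th coordinates of the second ones; the form alone determines the value of every functional on
  c_b.\<close>

lemma ten2_universal:
  fixes B :: "'b \<Rightarrow> 'b \<Rightarrow> 'a"
  assumes xs: "ten2 scale xs = ten2 scale ys"
    and B1: "\<And>y. lf scale (\<lambda>x. B x y)" and B2: "\<And>x. lf scale (B x)"
  shows "(\<Sum>(x,y)\<leftarrow>xs. B x y) = (\<Sum>(x,y)\<leftarrow>ys. B x y)"
proof -
  let ?B = "extend_basis {}"
  have I: "independent ?B" and sp: "span ?B = UNIV"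
    using independent_extend_basis[OF independent_empty] span_extend_basis[OF independent_empty] by auto
  let ?r = "representation ?B"
  have lfr: "lf scale (\<lambda>v. ?r v b)" for b
    unfolding lf_def using representation_add[OF I] representation_scale[OF I] sp by auto
  \<comment> \<open>One finite index set for all coordinates occurring in either list, so that both
    expansions run over the same basis vectors.\<close>
  define S where "S = (\<Union>(x,y)\<in>set (xs @ ys). {b. ?r y b \<noteq> 0})"
  have fin: "finite S" unfolding S_def by (auto intro: finite_representation)
  have *: "(\<Sum>(x,y)\<leftarrow>zs. B x y) = (\<Sum>b\<in>S. B (\<Sum>(x,y)\<leftarrow>zs. ?r y b *s x) b)"
    if "set zs \<subseteq> set (xs @ ys)" for zs
    using that
  proof (induction zs)
    case Nil
    then show ?case using lf_zero[OF B1] by simp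
  next
    case (Cons z zs)
    obtain x y where z: "z = (x,y)" by (cases z)
    have sub: "{b. ?r y b \<noteq> 0} \<subseteq> S" using Cons.prems z unfolding S_def by auto
    have "y = (\<Sum>b | ?r y b \<noteq> 0. ?r y b *s b)"
      using sum_nonzero_representation_eq[OF I, of y] sp by simp
    also have "\<dots> = (\<Sum>b\<in>S. ?r y b *s b)"
      by (rule sum.mono_neutral_left) (use fin sub in auto)
    finally have "B x y = B x (\<Sum>b\<in>S. ?r y b *s b)" by simp
    also have "\<dots> = (\<Sum>b\<in>S. B x (?r y b *s b))"
      using fin by (induction S rule: finite_induct) (auto simp: lf_zero[OF B2] lf_add[OF B2])
    finally have "B x y = (\<Sum>b\<in>S. B (?r y b *s x) b)"
      by (simp add: lf_scale[OF B1] lf_scale[OF B2])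
    then show ?case using Cons z by (simp add: lf_add[OF B1] sum.distrib)
  qed
  have "(\<Sum>(x,y)\<leftarrow>xs. ?r y b *s x) = (\<Sum>(x,y)\<leftarrow>ys. ?r y b *s x)" for b
  proof (rule lf_separates)
    fix f assume f: "lf scale f"
    have "f (\<Sum>(x,y)\<leftarrow>zs. ?r y b *s x) = ten2 scale zs f (\<lambda>v. ?r v b)" for zs
      by (simp add: ten2_apply[OF f lfr] lf_sum_list[OF f] lf_scale[OF f] case_prod_unfold mult.commute)
    then show "f (\<Sum>(x,y)\<leftarrow>xs. ?r y b *s x) = f (\<Sum>(x,y)\<leftarrow>ys. ?r y b *s x)"
      by (simp add: xs)
  qed
  then show ?thesis using *[of xs] *[of ys] by simp
qed

lemma ten_add_left: "ten scale (x + y) z = ten scale x z + ten scale y z"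
  and ten_add_right: "ten scale z (x + y) = ten scale z x + ten scale z y"
  and ten_scale_left: "ten scale (c *s x) z = fsc2 c (ten scale x z)"
  and ten_scale_right: "ten scale z (c *s x) = fsc2 c (ten scale z x)"
  by (auto simp: ten_def ten2_def fsc2_def fun_eq_iff lf_add lf_scale algebra_simps)

lemma fsc2_T2s [simp]: "t \<in> T2s scale \<Longrightarrow> fsc2 c t \<in> T2s scale"
proof (induction rule: T2s_induct)
  case zero
  have "fsc2 c 0 = (0 :: ('a, 'b) form2)" by (auto simp: fsc2_def fun_eq_iff)
  then show ?case by simp
next
  case (add x y t)
  have "fsc2 c (ten scale x y + t) = ten scale (c *s x) y + fsc2 c t"
    by (auto simp: fsc2_def ten_scale_left fun_eq_iff algebra_simps)
  moreover have "ten scale (c *s x) y + fsc2 c t \<in> T2s scale" using add by simp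
  ultimately have "fsc2 c (ten scale x y + t) \<in> T2s scale" by metis
  then show ?case .
qed

text \<open>The choice in the definition is met by the sum of \<open>\<omega> y *s x\<close> over a
  list representing \<open>t\<close>, so a slice obeys its specification whenever
  \<open>\<omega>\<close> is linear.\<close>

lemma slice_r_apply:
  assumes "t \<in> T2s scale" "lf scale \<omega>" "lf scale f"
  shows "f (slice_r scale t \<omega>) = t f \<omega>"
proof -
  obtain xs where t: "t = ten2 scale xs" using assms(1) by (auto elim: T2s_E)
  have "f (\<Sum>(x,y)\<leftarrow>xs. \<omega> y *s x) = t f \<omega>" if f: "lf scale f" for f
    using f assms(2)
    by (simp add: t ten2_apply lf_sum_list[OF f] lf_scale[OF f] case_prod_unfold mult.commute)
  then have "\<exists>x. \<forall>f. lf scale f \<longrightarrow> f x = t f \<omega>" by blast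
  from someI_ex[OF this] show ?thesis using assms(3) unfolding slice_r_def by blast
qed

lemma slice_l_apply:
  assumes "t \<in> T2s scale" "lf scale \<omega>" "lf scale f"
  shows "f (slice_l scale \<omega> t) = t \<omega> f"
proof -
  obtain xs where t: "t = ten2 scale xs" using assms(1) by (auto elim: T2s_E)
  have "f (\<Sum>(x,y)\<leftarrow>xs. \<omega> x *s y) = t \<omega> f" if f: "lf scale f" for f
    using f assms(2)
    by (simp add: t ten2_apply lf_sum_list[OF f] lf_scale[OF f] case_prod_unfold mult.commute)
  then have "\<exists>x. \<forall>f. lf scale f \<longrightarrow> f x = t \<omega> f" by blast
  from someI_ex[OF this] show ?thesis using assms(3) unfolding slice_l_def by blast
qed

lemma slice_r_eqI:
  assumes "t \<in> T2s scale" "lf scale \<omega>" "\<And>f. lf scale f \<Longrightarrow> t f \<omega> = f x"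
  shows "slice_r scale t \<omega> = x"
  by (rule lf_separates) (simp add: slice_r_apply assms)

lemma slice_l_eqI:
  assumes "t \<in> T2s scale" "lf scale \<omega>" "\<And>f. lf scale f \<Longrightarrow> t \<omega> f = f x"
  shows "slice_l scale \<omega> t = x"
  by (rule lf_separates) (simp add: slice_l_apply assms)

end

section \<open>Multipliers of the tensor square\<close>

locale nd_algebra = vector_space sc
  for sc :: "'k::field \<Rightarrow> 'a::ab_group_add \<Rightarrow> 'a" +
  fixes mu :: "'a \<Rightarrow> 'a \<Rightarrow> 'a"
  assumes assoc: "mu (mu a b) c = mu a (mu b c)"
    and mu_add_left: "mu (a + b) c = mu a c + mu b c"
    and mu_add_right: "mu a (b + c) = mu a b + mu a c"
    and mu_scale_left: "mu (sc r a) b = sc r (mu a b)"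
    and mu_scale_right: "mu a (sc r b) = sc r (mu a b)"
    and idem: "\<exists>xs. c = (\<Sum>(a,b)\<leftarrow>xs. mu a b)"
    and nondeg_left: "(\<And>a. mu a b = 0) \<Longrightarrow> b = 0"
    and nondeg_right: "(\<And>a. mu b a = 0) \<Longrightarrow> b = 0"
begin

lemma lop_mu: "lop sc (mu a)" "lop sc (\<lambda>x. mu x a)"
  by (simp_all add: lop_def mu_add_left mu_add_right mu_scale_left mu_scale_right)

lemma lf_mu [simp]: "lf sc f \<Longrightarrow> lf sc (\<lambda>x. f (mu a x))" "lf sc f \<Longrightarrow> lf sc (\<lambda>x. f (mu x a))"
  using lf_lop lop_mu by blast+

lemma mu_diff_left: "mu (a - b) c = mu a c - mu b c"
  and mu_diff_right: "mu c (a - b) = mu c a - mu c b"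
  using lop_diff lop_mu by blast+

text \<open>Non-degeneracy in the shape needed to cancel a factor: the hypothesis is tested by
  functionals, which separate points.\<close>

lemma cancel_left:
  assumes "\<And>a f. lf sc f \<Longrightarrow> f (mu a x) = f (mu a y)"
  shows "x = y"
proof -
  have "mu a (x - y) = 0" for a
    using lf_separates[of "mu a x" "mu a y"] assms by (simp add: mu_diff_right)
  then show ?thesis using nondeg_left[of "x - y"] by simp
qed

lemma cancel_right:
  assumes "\<And>a f. lf sc f \<Longrightarrow> f (mu x a) = f (mu y a)"
  shows "x = y"
proof -
  have "mu (x - y) a = 0" for a
    using lf_separates[of "mu x a" "mu y a"] assms by (simp add: mu_diff_left)
  then show ?thesis using nondeg_right[of "x - y"] by simp
qed

text \<open>Freezing the functional on the other leg replaces both tensors by slices, so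
  non-degeneracy of \<open>A\<close> itself suffices.\<close>

lemma cancel_mu_left1:
  assumes "s \<in> T2s sc" "t \<in> T2s sc" "lf sc g"
    and "\<And>a f. lf sc f \<Longrightarrow> s (\<lambda>x. f (mu a x)) g = t (\<lambda>x. f (mu a x)) g"
  shows "lf sc f \<Longrightarrow> s f g = t f g"
proof -
  have "slice_r sc s g = slice_r sc t g"
  proof (rule cancel_left)
    fix a f assume "lf sc f"
    then show "f (mu a (slice_r sc s g)) = f (mu a (slice_r sc t g))"
      using slice_r_apply[OF assms(1,3), of "\<lambda>x. f (mu a x)"]
        slice_r_apply[OF assms(2,3), of "\<lambda>x. f (mu a x)"] assms(4) by simp
  qed
  then show "lf sc f \<Longrightarrow> s f g = t f g"
    using slice_r_apply[of s g f] slice_r_apply[of t g f] assms by simp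
qed

lemma cancel_mu_right1:
  assumes "s \<in> T2s sc" "t \<in> T2s sc" "lf sc g"
    and "\<And>a f. lf sc f \<Longrightarrow> s (\<lambda>x. f (mu x a)) g = t (\<lambda>x. f (mu x a)) g"
  shows "lf sc f \<Longrightarrow> s f g = t f g"
proof -
  have "slice_r sc s g = slice_r sc t g"
  proof (rule cancel_right)
    fix a f assume "lf sc f"
    then show "f (mu (slice_r sc s g) a) = f (mu (slice_r sc t g) a)"
      using slice_r_apply[OF assms(1,3), of "\<lambda>x. f (mu x a)"]
        slice_r_apply[OF assms(2,3), of "\<lambda>x. f (mu x a)"] assms(4) by simp
  qed
  then show "lf sc f \<Longrightarrow> s f g = t f g"
    using slice_r_apply[of s g f] slice_r_apply[of t g f] assms by simp
qed

lemma cancel_mu_left2: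
  assumes "s \<in> T2s sc" "t \<in> T2s sc" "lf sc f"
    and "\<And>a g. lf sc g \<Longrightarrow> s f (\<lambda>x. g (mu a x)) = t f (\<lambda>x. g (mu a x))"
  shows "lf sc g \<Longrightarrow> s f g = t f g"
proof -
  have "slice_l sc f s = slice_l sc f t"
  proof (rule cancel_left)
    fix a g assume "lf sc g"
    then show "g (mu a (slice_l sc f s)) = g (mu a (slice_l sc f t))"
      using slice_l_apply[OF assms(1,3), of "\<lambda>x. g (mu a x)"]
        slice_l_apply[OF assms(2,3), of "\<lambda>x. g (mu a x)"] assms(4) by simp
  qed
  then show "lf sc g \<Longrightarrow> s f g = t f g"
    using slice_l_apply[of s f g] slice_l_apply[of t f g] assms by simp
qed

lemma cancel_mu_right2:
  assumes "s \<in> T2s sc" "t \<in> T2s sc" "lf sc f"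
    and "\<And>a g. lf sc g \<Longrightarrow> s f (\<lambda>x. g (mu x a)) = t f (\<lambda>x. g (mu x a))"
  shows "lf sc g \<Longrightarrow> s f g = t f g"
proof -
  have "slice_l sc f s = slice_l sc f t"
  proof (rule cancel_right)
    fix a g assume "lf sc g"
    then show "g (mu (slice_l sc f s) a) = g (mu (slice_l sc f t) a)"
      using slice_l_apply[OF assms(1,3), of "\<lambda>x. g (mu x a)"]
        slice_l_apply[OF assms(2,3), of "\<lambda>x. g (mu x a)"] assms(4) by simp
  qed
  then show "lf sc g \<Longrightarrow> s f g = t f g"
    using slice_l_apply[of s f g] slice_l_apply[of t f g] assms by simp
qed

section \<open>The multiplication of the tensor square\<close>

abbreviation mul2 where "mul2 \<equiv> tmul2 sc mu"

text \<open>The definition uses an arbitrary representative of the left factor. Independence follows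
  by induction on \<open>t\<close>: for a simple tensor the sum is the form of the left factor
  evaluated at two functionals.\<close>

lemma tmul2_ten2:
  assumes "t \<in> T2s sc" "lf sc f" "lf sc g"
  shows "mul2 (ten2 sc xs) t f g = (\<Sum>(x,y)\<leftarrow>xs. t (\<lambda>u. f (mu x u)) (\<lambda>v. g (mu y v)))"
proof -
  have rep: "ten2 sc (rep2 sc (ten2 sc xs)) = ten2 sc xs"
    unfolding rep2_def by (rule someI_ex) blast
  have *: "(\<Sum>(x,y)\<leftarrow>xs. t (\<lambda>u. f (mu x u)) (\<lambda>v. g (mu y v))) =
      (\<Sum>(x,y)\<leftarrow>ys. t (\<lambda>u. f (mu x u)) (\<lambda>v. g (mu y v)))" if "ten2 sc xs = ten2 sc ys" for xs ys
    using assms(1)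
  proof (induction rule: T2s_induct)
    case zero
    then show ?case by (simp add: case_prod_unfold)
  next
    case (add u v t)
    have "(\<Sum>(x,y)\<leftarrow>zs. ten sc u v (\<lambda>u. f (mu x u)) (\<lambda>v. g (mu y v))) =
        ten2 sc zs (\<lambda>x. f (mu x u)) (\<lambda>y. g (mu y v))" for zs
      using assms by (simp add: ten2_apply ten_apply)
    then show ?case using add that by (simp add: case_prod_unfold sum_list_addf)
  qed
  have "mul2 (ten2 sc xs) t f g =
      (\<Sum>(x,y)\<leftarrow>rep2 sc (ten2 sc xs). t (\<lambda>u. f (mu x u)) (\<lambda>v. g (mu y v)))"
    unfolding tmul2_def using assms by (simp add: sum_list_fun1 case_prod_unfold tmap2_apply)
  then show ?thesis using *[OF rep] by simp
qed

lemma tmul2_ten_left: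
  "t \<in> T2s sc \<Longrightarrow> lf sc f \<Longrightarrow> lf sc g \<Longrightarrow>
    mul2 (ten sc x y) t f g = t (\<lambda>u. f (mu x u)) (\<lambda>v. g (mu y v))"
  by (simp add: ten_def tmul2_ten2)

lemma tmul2_ten_right:
  assumes "s \<in> T2s sc" "lf sc f" "lf sc g"
  shows "mul2 s (ten sc u v) f g = s (\<lambda>x. f (mu x u)) (\<lambda>y. g (mu y v))"
proof -
  obtain xs where "s = ten2 sc xs" using assms(1) by (auto elim: T2s_E)
  then show ?thesis using assms by (simp add: tmul2_ten2 ten_apply ten2_apply)
qed

lemma tmul2_in_T2s: "t \<in> T2s sc \<Longrightarrow> mul2 s t \<in> T2s sc"
  unfolding tmul2_def by (rule T2s_sum_list) (auto intro: tmap2_in_T2s lop_mu)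

lemma tmul2_add_left:
  assumes "s \<in> T2s sc" "s' \<in> T2s sc" "t \<in> T2s sc"
  shows "mul2 (s + s') t = mul2 s t + mul2 s' t"
proof (rule T2s_eqI[of _ sc])
  obtain xs ys where "s = ten2 sc xs" "s' = ten2 sc ys" using assms by (auto elim!: T2s_E)
  then show "mul2 (s + s') t f g = (mul2 s t + mul2 s' t) f g" if "lf sc f" "lf sc g" for f g
    using assms that by (simp add: ten2_append[symmetric] tmul2_ten2)
qed (use assms in \<open>simp_all add: tmul2_in_T2s\<close>)

lemma tmul2_add_right: "mul2 s (t + t') = mul2 s t + mul2 s t'"
  by (auto simp: tmul2_def tmap2_add fun_eq_iff sum_list_fun1 case_prod_unfold sum_list_addf)

lemma tmul2_zero: "mul2 s 0 = 0" "t \<in> T2s sc \<Longrightarrow> mul2 0 t = 0"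
proof -
  show "mul2 s 0 = 0"
    by (simp add: tmul2_def tmap2_zero case_prod_unfold)
  show "t \<in> T2s sc \<Longrightarrow> mul2 0 t = 0" using tmul2_add_left[of 0 0 t] by simp
qed

lemma tmul2_ten_ten: "mul2 (ten sc x y) (ten sc u v) = ten sc (mu x u) (mu y v)"
  by (rule T2s_eqI[of _ sc]) (simp_all add: tmul2_in_T2s tmul2_ten_right ten_apply)

text \<open>The factors \<open>x\<close> and \<open>y\<close> are cancelled one leg at a time, so
  the product on A \<otimes> A is again non-degenerate.\<close>

lemma T2s_eq_leftI:
  assumes "s \<in> T2s sc" "t \<in> T2s sc"
    and "\<And>x y f g. lf sc f \<Longrightarrow> lf sc g \<Longrightarrow>
      s (\<lambda>u. f (mu x u)) (\<lambda>v. g (mu y v)) = t (\<lambda>u. f (mu x u)) (\<lambda>v. g (mu y v))"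
  shows "s = t"
proof (rule T2s_eqI[OF assms(1,2)])
  fix f g assume fg: "lf sc f" "lf sc g"
  have "s (\<lambda>x. f (mu a x)) g = t (\<lambda>x. f (mu a x)) g" if "lf sc f" for a f
    by (rule cancel_mu_left2[OF assms(1,2) _ _ fg(2)]) (simp_all add: that assms(3))
  then show "s f g = t f g"
    by (rule cancel_mu_left1[OF assms(1,2) fg(2) _ fg(1)])
qed

lemma T2s_eq_rightI:
  assumes "s \<in> T2s sc" "t \<in> T2s sc"
    and "\<And>x y f g. lf sc f \<Longrightarrow> lf sc g \<Longrightarrow>
      s (\<lambda>u. f (mu u x)) (\<lambda>v. g (mu v y)) = t (\<lambda>u. f (mu u x)) (\<lambda>v. g (mu v y))"
  shows "s = t"
proof (rule T2s_eqI[OF assms(1,2)])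
  fix f g assume fg: "lf sc f" "lf sc g"
  have "s (\<lambda>x. f (mu x a)) g = t (\<lambda>x. f (mu x a)) g" if "lf sc f" for a f
    by (rule cancel_mu_right2[OF assms(1,2) _ _ fg(2)]) (simp_all add: that assms(3))
  then show "s f g = t f g"
    by (rule cancel_mu_right1[OF assms(1,2) fg(2) _ fg(1)])
qed

abbreviation mlt where "mlt \<equiv> is_mult_on (T2s sc) mul2 fsc2"

lemma mlt_closed: "mlt M \<Longrightarrow> t \<in> T2s sc \<Longrightarrow> fst M t \<in> T2s sc" "mlt M \<Longrightarrow> t \<in> T2s sc \<Longrightarrow> snd M t \<in> T2s sc"
  by (simp_all add: is_mult_on_def)

lemma mlt_add:
  "mlt M \<Longrightarrow> s \<in> T2s sc \<Longrightarrow> t \<in> T2s sc \<Longrightarrow> fst M (s + t) = fst M s + fst M t"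
  "mlt M \<Longrightarrow> s \<in> T2s sc \<Longrightarrow> t \<in> T2s sc \<Longrightarrow> snd M (s + t) = snd M s + snd M t"
  by (simp_all add: is_mult_on_def)

lemma mlt_scale:
  "mlt M \<Longrightarrow> t \<in> T2s sc \<Longrightarrow> fst M (fsc2 c t) = fsc2 c (fst M t)"
  "mlt M \<Longrightarrow> t \<in> T2s sc \<Longrightarrow> snd M (fsc2 c t) = fsc2 c (snd M t)"
  by (simp_all add: is_mult_on_def)

lemma mlt_zero: "mlt M \<Longrightarrow> fst M 0 = 0" "mlt M \<Longrightarrow> snd M 0 = 0"
  using mlt_add[of M 0 0] by simp_all

lemma mlt_adjoint: "mlt M \<Longrightarrow> s \<in> T2s sc \<Longrightarrow> t \<in> T2s sc \<Longrightarrow> mul2 s (fst M t) = mul2 (snd M s) t"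
  by (simp add: is_mult_on_def)

lemma mlt_adjoint_ten:
  assumes "mlt M" "lf sc f" "lf sc g"
  shows "fst M (ten sc u v) (\<lambda>p. f (mu x p)) (\<lambda>q. g (mu y q)) =
    snd M (ten sc x y) (\<lambda>p. f (mu p u)) (\<lambda>q. g (mu q v))"
  using mlt_adjoint[OF assms(1), of "ten sc x y" "ten sc u v"] assms
  by (metis mlt_closed ten_in_T2s tmul2_ten_left tmul2_ten_right)

lemma lf_mlt_left:
  assumes "mlt M" shows "lf sc (\<lambda>x. fst M (ten sc x b) f g)" "lf sc (\<lambda>x. snd M (ten sc x b) f g)"
  unfolding lf_def by (simp_all add: ten_add_left ten_scale_left mlt_add mlt_scale assms, simp_all add: fsc2_def)

lemma lf_mlt_right:
  assumes "mlt M" shows "lf sc (\<lambda>x. fst M (ten sc b x) f g)" "lf sc (\<lambda>x. snd M (ten sc b x) f g)"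
  unfolding lf_def by (simp_all add: ten_add_right ten_scale_right mlt_add mlt_scale assms, simp_all add: fsc2_def)

text \<open>Multiplying by x \<otimes> y from the left moves \<open>M\<close> onto x \<otimes> y;
  the maps \<phi> and \<psi>, commuting with left multiplications, then leave the product. Right
  multiplications are the main instance.\<close>

lemma mlt_fst_tmap2:
  assumes M: "mlt M" and lin: "lop sc \<phi>" "lop sc \<psi>"
    and comm: "\<And>x y. \<phi> (mu x y) = mu x (\<phi> y)" "\<And>x y. \<psi> (mu x y) = mu x (\<psi> y)"
  shows "fst M (ten sc (\<phi> u) (\<psi> v)) = tmap2 sc \<phi> \<psi> (fst M (ten sc u v))"
proof (rule T2s_eq_leftI)
  fix x y f g assume fg: "lf sc f" "lf sc g"
  have l: "lf sc (\<lambda>x. f (\<phi> x))" "lf sc (\<lambda>x. g (\<psi> x))" using fg lin lf_lop by blast+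
  show "fst M (ten sc (\<phi> u) (\<psi> v)) (\<lambda>p. f (mu x p)) (\<lambda>q. g (mu y q)) =
      tmap2 sc \<phi> \<psi> (fst M (ten sc u v)) (\<lambda>p. f (mu x p)) (\<lambda>q. g (mu y q))"
    using mlt_adjoint_ten[OF M fg, of "\<phi> u" "\<psi> v" x y] mlt_adjoint_ten[OF M l, of u v x y] fg
    by (simp add: tmap2_apply comm)
qed (use M lin in \<open>simp_all add: mlt_closed tmap2_in_T2s\<close>)

lemma mlt_snd_tmap2:
  assumes M: "mlt M" and lin: "lop sc \<phi>" "lop sc \<psi>"
    and comm: "\<And>x y. \<phi> (mu x y) = mu (\<phi> x) y" "\<And>x y. \<psi> (mu x y) = mu (\<psi> x) y"
  shows "snd M (ten sc (\<phi> u) (\<psi> v)) = tmap2 sc \<phi> \<psi> (snd M (ten sc u v))"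
proof (rule T2s_eq_rightI)
  fix x y f g assume fg: "lf sc f" "lf sc g"
  have l: "lf sc (\<lambda>x. f (\<phi> x))" "lf sc (\<lambda>x. g (\<psi> x))" using fg lin lf_lop by blast+
  show "snd M (ten sc (\<phi> u) (\<psi> v)) (\<lambda>p. f (mu p x)) (\<lambda>q. g (mu q y)) =
      tmap2 sc \<phi> \<psi> (snd M (ten sc u v)) (\<lambda>p. f (mu p x)) (\<lambda>q. g (mu q y))"
    using mlt_adjoint_ten[OF M fg, of x y "\<phi> u" "\<psi> v"] mlt_adjoint_ten[OF M l, of x y u v] fg
    by (simp add: tmap2_apply comm)
qed (use M lin in \<open>simp_all add: mlt_closed tmap2_in_T2s\<close>)

lemma mlt_mu:
  assumes "mlt M" "lf sc f" "lf sc g"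
  shows mlt_mu_fst1: "fst M (ten sc (mu u c) v) f g = fst M (ten sc u v) (\<lambda>x. f (mu x c)) g"
    and mlt_mu_fst2: "fst M (ten sc u (mu v c)) f g = fst M (ten sc u v) f (\<lambda>x. g (mu x c))"
    and mlt_mu_snd1: "snd M (ten sc (mu c u) v) f g = snd M (ten sc u v) (\<lambda>x. f (mu c x)) g"
    and mlt_mu_snd2: "snd M (ten sc u (mu c v)) f g = snd M (ten sc u v) f (\<lambda>x. g (mu c x))"
  using mlt_fst_tmap2[OF assms(1) lop_mu(2)[of c] lop_id(2), of u v]
    mlt_fst_tmap2[OF assms(1) lop_id(2) lop_mu(2)[of c], of u v]
    mlt_snd_tmap2[OF assms(1) lop_mu(1)[of c] lop_id(2), of u v]
    mlt_snd_tmap2[OF assms(1) lop_id(2) lop_mu(1)[of c], of u v] assms(2,3)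
  by (simp_all add: assoc tmap2_apply)

lemma mlt_prod: "mlt M \<Longrightarrow> mlt N \<Longrightarrow> mlt (mprod M N)"
  by (simp add: is_mult_on_def mprod_def)

lemma mlt_plus: "mlt M \<Longrightarrow> mlt N \<Longrightarrow> mlt (M + N)"
  by (auto simp: is_mult_on_def tmul2_add_left tmul2_add_right)
     (auto simp: fsc2_def fun_eq_iff algebra_simps)

lemma mlt_null: "mlt 0"
  by (auto simp: is_mult_on_def tmul2_zero) (auto simp: fsc2_def fun_eq_iff)

text \<open>The multiplier law expresses all left multiples of \<open>fst M t\<close> through
  \<open>snd M\<close>, and non-degeneracy does the rest. Hence equality of multipliers may be
  checked on right actions only.\<close>

lemma mlt_determined_by_snd:
  assumes "mlt M" "mlt N" "\<And>t. t \<in> T2s sc \<Longrightarrow> snd M t = snd N t" "t \<in> T2s sc"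
  shows "fst M t = fst N t"
proof (rule T2s_eq_leftI)
  show "fst M t \<in> T2s sc" "fst N t \<in> T2s sc" using assms mlt_closed by blast+
  then show "fst M t (\<lambda>u. f (mu x u)) (\<lambda>v. g (mu y v)) = fst N t (\<lambda>u. f (mu x u)) (\<lambda>v. g (mu y v))"
    if "lf sc f" "lf sc g" for x y f g
    using mlt_adjoint[OF assms(1) ten_in_T2s assms(4), of x y]
      mlt_adjoint[OF assms(2) ten_in_T2s assms(4), of x y] assms(3)[of "ten sc x y"] that
    by (metis ten_in_T2s tmul2_ten_left)
qed

lemma mlt_mten:
  assumes lin: "lop sc (fst m)" "lop sc (snd m)" "lop sc (fst n)" "lop sc (snd n)"
    and m: "\<And>x y. mu x (fst m y) = mu (snd m x) y" and n: "\<And>x y. mu x (fst n y) = mu (snd n x) y"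
  shows "mlt (mten sc m n)"
proof -
  have adj: "mul2 s (tmap2 sc (fst m) (fst n) t) = mul2 (tmap2 sc (snd m) (snd n) s) t"
    if "s \<in> T2s sc" "t \<in> T2s sc" for s t
    using that(2,1)
  proof (induction t rule: T2s_induct)
    case zero
    then show ?case by (simp add: tmap2_zero tmul2_zero)
  next
    case (add u v t)
    have "mul2 s (tmap2 sc (fst m) (fst n) (ten sc u v)) = mul2 (tmap2 sc (snd m) (snd n) s) (ten sc u v)"
      using add.prems
    proof (induction s rule: T2s_induct)
      case zero
      then show ?case by (simp add: tmap2_zero tmul2_zero tmul2_in_T2s tmap2_in_T2s lin)
    next
      case (add x y t)
      then have "mul2 (ten sc x y + t) (tmap2 sc (fst m) (fst n) (ten sc u v)) =
          mul2 (tmap2 sc (snd m) (snd n) (ten sc x y + t)) (ten sc u v)"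
        by (simp add: tmap2_add tmap2_ten lin tmul2_add_left tmul2_ten_ten m n tmap2_in_T2s)
      then show ?case .
    qed
    then have "mul2 s (tmap2 sc (fst m) (fst n) (ten sc u v + t)) =
        mul2 (tmap2 sc (snd m) (snd n) s) (ten sc u v + t)"
      using add by (simp add: tmap2_add tmul2_add_right)
    then show ?case .
  qed
  show ?thesis
    unfolding is_mult_on_def mten_def
    by (simp add: tmap2_in_T2s lin tmap2_add tmap2_scale adj)
qed

text \<open>Products span \<open>A\<close> by idempotence. This extends identities for
  \<open>F\<close>, which is described only on tensors with a product in one leg.\<close>

lemma lf_eq_on_products:
  assumes "lf sc f" "lf sc g" "\<And>x y. f (mu x y) = g (mu x y)"
  shows "f a = g a"
proof -
  obtain xs where xs: "a = (\<Sum>(x,y)\<leftarrow>xs. mu x y)" using idem by blast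
  show ?thesis
    unfolding xs case_prod_unfold lf_sum_list[OF assms(1)] lf_sum_list[OF assms(2)] assms(3) ..
qed

lemma mlt_eqI:
  assumes M: "mlt M" and N: "mlt N"
    and eq: "\<And>x y f g. lf sc f \<Longrightarrow> lf sc g \<Longrightarrow> snd M (ten sc x y) f g = snd N (ten sc x y) f g"
  shows "meq (T2s sc) M N"
proof -
  have ten: "snd M (ten sc x y) = snd N (ten sc x y)" for x y
    by (rule T2s_eqI[of _ sc]) (simp_all add: mlt_closed M N eq)
  have "snd M (ten2 sc xs) = snd N (ten2 sc xs)" for xs
  proof (induction xs)
    case Nil
    show ?case unfolding ten2_Nil by (simp only: mlt_zero[OF M] mlt_zero[OF N])
  next
    case (Cons z xs)
    obtain x y where z: "z = (x,y)" by (cases z)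
    show ?case unfolding z ten2_Cons
      by (simp only: mlt_add[OF M ten_in_T2s ten2_in_T2s] mlt_add[OF N ten_in_T2s ten2_in_T2s] ten Cons.IH)
  qed
  then have snd: "snd M t = snd N t" if "t \<in> T2s sc" for t using that by (auto elim: T2s_E)
  then show ?thesis using mlt_determined_by_snd[OF M N] by (auto simp: meq_def)
qed

end

section \<open>Multipliers of the tensor cube\<close>

text \<open>\<open>pt\<close> and \<open>tp\<close> are the tensors \<open>p \<otimes> u\<close> and \<open>u \<otimes> p\<close> of an element \<open>p\<close> and a 2-tensor \<open>u\<close>.\<close>

definition pt :: "('k::field \<Rightarrow> 'b::ab_group_add \<Rightarrow> 'b) \<Rightarrow> 'b \<Rightarrow> ('k,'b) form2 \<Rightarrow> ('k,'b) form3" where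
  "pt sc p u = (\<lambda>f g h. if lf sc f \<and> lf sc g \<and> lf sc h then f p * u g h else 0)"

definition tp :: "('k::field \<Rightarrow> 'b::ab_group_add \<Rightarrow> 'b) \<Rightarrow> ('k,'b) form2 \<Rightarrow> 'b \<Rightarrow> ('k,'b) form3" where
  "tp sc u p = (\<lambda>f g h. if lf sc f \<and> lf sc g \<and> lf sc h then u f g * h p else 0)"

lemma pt_apply: "lf sc f \<Longrightarrow> lf sc g \<Longrightarrow> lf sc h \<Longrightarrow> pt sc p u f g h = f p * u g h"
  and tp_apply: "lf sc f \<Longrightarrow> lf sc g \<Longrightarrow> lf sc h \<Longrightarrow> tp sc u p f g h = u f g * h p"
  and pt_not_lf: "\<not> (lf sc f \<and> lf sc g \<and> lf sc h) \<Longrightarrow> pt sc p u f g h = 0"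
  and tp_not_lf: "\<not> (lf sc f \<and> lf sc g \<and> lf sc h) \<Longrightarrow> tp sc u p f g h = 0"
  by (auto simp: pt_def tp_def)

lemma pt_in_T3s: "u \<in> T2s sc \<Longrightarrow> pt sc p u \<in> T3s sc"
proof (erule T2s_E)
  fix xs assume u: "u = ten2 sc xs"
  have "pt sc p u = ten3 sc (map (\<lambda>(x,y). (p,x,y)) xs)"
    by (auto simp: u pt_def ten3_def ten2_apply fun_eq_iff comp_def case_prod_unfold
        sum_list_const_mult mult.assoc)
  then show ?thesis by (simp add: T3s_def)
qed

lemma tp_in_T3s: "u \<in> T2s sc \<Longrightarrow> tp sc u p \<in> T3s sc"
proof (erule T2s_E)
  fix xs assume u: "u = ten2 sc xs"
  have "tp sc u p = ten3 sc (map (\<lambda>(x,y). (x,y,p)) xs)"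
    by (auto simp: u tp_def ten3_def ten2_apply fun_eq_iff comp_def case_prod_unfold
        sum_list_mult_const)
  then show ?thesis by (simp add: T3s_def)
qed

lemma fst_sum_list: "fst (\<Sum>x\<leftarrow>xs. h x) = (\<Sum>x\<leftarrow>xs. fst (h x))"
  and snd_sum_list: "snd (\<Sum>x\<leftarrow>xs. h x) = (\<Sum>x\<leftarrow>xs. snd (h x))"
  by (induction xs) simp_all

context nd_algebra
begin

lemma rep2: "x \<in> T2s sc \<Longrightarrow> ten2 sc (rep2 sc x) = x"
  unfolding rep2_def by (rule someI_ex) (auto elim: T2s_E)

lemma one_ot_pt:
  assumes "mlt M" "u \<in> T2s sc"
  shows "fst (one_ot sc M) (pt sc p u) = pt sc p (fst M u)"
    and "snd (one_ot sc M) (pt sc p u) = pt sc p (snd M u)"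
proof -
  have *: "(\<lambda>g' h'. pt sc p u f g' h') = fsc2 (f p) u" if "lf sc f" for f
    using that T2s_not_lf[OF assms(2)] by (auto simp: pt_def fsc2_def fun_eq_iff)
  show "fst (one_ot sc M) (pt sc p u) = pt sc p (fst M u)"
    by (intro ext) (auto simp: one_ot_def * mlt_scale assms, auto simp: pt_def fsc2_def)
  show "snd (one_ot sc M) (pt sc p u) = pt sc p (snd M u)"
    by (intro ext) (auto simp: one_ot_def * mlt_scale assms, auto simp: pt_def fsc2_def)
qed

lemma ot_one_tp:
  assumes "mlt M" "u \<in> T2s sc"
  shows "fst (ot_one sc M) (tp sc u p) = tp sc (fst M u) p"
    and "snd (ot_one sc M) (tp sc u p) = tp sc (snd M u) p"
proof -
  have *: "(\<lambda>f' g'. tp sc u p f' g' h) = fsc2 (h p) u" if "lf sc h" for h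
    using that T2s_not_lf[OF assms(2)] by (auto simp: tp_def fsc2_def fun_eq_iff)
  show "fst (ot_one sc M) (tp sc u p) = tp sc (fst M u) p"
    by (intro ext) (auto simp: ot_one_def * mlt_scale assms, auto simp: tp_def fsc2_def)
  show "snd (ot_one sc M) (tp sc u p) = tp sc (snd M u) p"
    by (intro ext) (auto simp: ot_one_def * mlt_scale assms, auto simp: tp_def fsc2_def)
qed

text \<open>The legs on which \<open>M\<close> acts cut across the decomposition p \<otimes> u. Once
  the functional on the third leg is fixed, \<open>u\<close> collapses to an element and
  \<open>M\<close> meets a simple tensor.\<close>

lemma ot_one_pt:
  assumes "u \<in> T2s sc" "lf sc f" "lf sc g" "lf sc h"
  shows "fst (ot_one sc M) (pt sc p u) f g h = fst M (ten sc p (slice_r sc u h)) f g"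
    and "snd (ot_one sc M) (pt sc p u) f g h = snd M (ten sc p (slice_r sc u h)) f g"
proof -
  have "(\<lambda>f' g'. pt sc p u f' g' h) = ten sc p (slice_r sc u h)"
    using assms by (auto simp: pt_def ten_def ten2_def fun_eq_iff slice_r_apply)
  then show "fst (ot_one sc M) (pt sc p u) f g h = fst M (ten sc p (slice_r sc u h)) f g"
    and "snd (ot_one sc M) (pt sc p u) f g h = snd M (ten sc p (slice_r sc u h)) f g"
    using assms by (simp_all add: ot_one_def)
qed

lemma one_ot_tp:
  assumes "u \<in> T2s sc" "lf sc f" "lf sc g" "lf sc h"
  shows "fst (one_ot sc M) (tp sc u p) f g h = fst M (ten sc (slice_l sc f u) p) g h"
    and "snd (one_ot sc M) (tp sc u p) f g h = snd M (ten sc (slice_l sc f u) p) g h"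
proof -
  have "(\<lambda>g' h'. tp sc u p f g' h') = ten sc (slice_l sc f u) p"
    using assms by (auto simp: tp_def ten_def ten2_def fun_eq_iff slice_l_apply)
  then show "fst (one_ot sc M) (tp sc u p) f g h = fst M (ten sc (slice_l sc f u) p) g h"
    and "snd (one_ot sc M) (tp sc u p) f g h = snd M (ten sc (slice_l sc f u) p) g h"
    using assms by (simp_all add: one_ot_def)
qed

lemma tmap3_pt:
  assumes "lop sc \<phi>" shows "tmap3 sc \<phi> id id (pt sc p u) = pt sc (\<phi> p) u"
  using lf_lop[OF _ assms] by (auto simp: tmap3_def pt_def fun_eq_iff comp_def)

lemma tmap3_tp:
  assumes "lop sc \<phi>" shows "tmap3 sc id id \<phi> (tp sc u p) = tp sc u (\<phi> p)"
  using lf_lop[OF _ assms] by (auto simp: tmap3_def tp_def fun_eq_iff comp_def)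

end

section \<open>Regular weak multiplier bialgebras\<close>

locale rwmb =
  fixes sc :: "'k::field \<Rightarrow> 'a::ab_group_add \<Rightarrow> 'a"
    and mu :: "'a \<Rightarrow> 'a \<Rightarrow> 'a"
    and E :: "('k,'a) form2 mltp"
    and D :: "'a \<Rightarrow> ('k,'a) form2 mltp"
    and eps :: "'a \<Rightarrow> 'k"
  assumes regular: "regular_wmb sc mu E D eps"

sublocale rwmb \<subseteq> nd_algebra sc mu
proof -
  have "vector_space sc"
    and "\<forall>a b c. mu (mu a b) c = mu a (mu b c)"
    and "\<forall>a b c. mu (a + b) c = mu a c + mu b c \<and> mu a (b + c) = mu a b + mu a c"
    and "\<forall>r a b. mu (sc r a) b = sc r (mu a b) \<and> mu a (sc r b) = sc r (mu a b)"
    and "\<forall>c. \<exists>xs. c = (\<Sum>(a,b)\<leftarrow>xs. mu a b)"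
    and "\<forall>b. (\<forall>a. mu a b = 0) \<longrightarrow> b = 0" "\<forall>b. (\<forall>a. mu b a = 0) \<longrightarrow> b = 0"
    by (insert regular, unfold regular_wmb_def wmb_def, elim conjE, assumption)+
  then show "nd_algebra sc mu"
    unfolding nd_algebra_def nd_algebra_axioms_def by blast
qed

context rwmb
begin

abbreviation "t1 \<equiv> T1 sc mu D"
abbreviation "t2 \<equiv> T2 sc mu D"
abbreviation "t3 \<equiv> T3 sc mu D"
abbreviation "t4 \<equiv> T4 sc mu D"
abbreviation "EL a b \<equiv> fst E (ten sc a b)"
abbreviation "ER a b \<equiv> snd E (ten sc a b)"
abbreviation "P \<equiv> PiR sc mu E D eps"
abbreviation "Q \<equiv> PibarR sc mu E D eps"

lemma E_mlt: "mlt E" and E_idem: "meq (T2s sc) (mprod E E) E" and eps_lf [simp]: "lf sc eps"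
  by (insert regular, unfold regular_wmb_def wmb_def, elim conjE, assumption)+

lemma E_idem_fst: "t \<in> T2s sc \<Longrightarrow> fst E (fst E t) = fst E t"
  and E_idem_snd: "t \<in> T2s sc \<Longrightarrow> snd E (snd E t) = snd E t"
  using E_idem by (simp_all add: meq_def mprod_def)

lemma D_mlt: "mlt (D a)"
proof -
  have "\<forall>a. mlt (D a)"
    by (insert regular, unfold regular_wmb_def wmb_def, elim conjE, assumption)
  then show ?thesis by blast
qed

lemma EL_in [simp]: "EL a b \<in> T2s sc" and ER_in [simp]: "ER a b \<in> T2s sc"
  and DL_in [simp]: "fst (D a) (ten sc b c) \<in> T2s sc" and DR_in [simp]: "snd (D a) (ten sc b c) \<in> T2s sc"
  using mlt_closed E_mlt D_mlt by auto

lemma EL_lf: "lf sc (\<lambda>x. EL x b f g)" "lf sc (\<lambda>x. EL b x f g)"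
  and ER_lf: "lf sc (\<lambda>x. ER x b f g)" "lf sc (\<lambda>x. ER b x f g)"
  by (rule lf_mlt_left[OF E_mlt] lf_mlt_right[OF E_mlt])+

text \<open>Linearity of \<Delta> is assumed only up to equality on A \<otimes> A, so it is
  available only after evaluation at a tensor.\<close>

lemma D_lf:
  assumes "t \<in> T2s sc"
  shows "lf sc (\<lambda>a. fst (D a) t f g)" "lf sc (\<lambda>a. snd (D a) t f g)"
proof -
  have add: "\<forall>a b. meq (T2s sc) (D (a + b)) (D a + D b)"
    and scl: "\<forall>r a. meq (T2s sc) (D (sc r a)) (mscale fsc2 r (D a))"
    by (insert regular, unfold regular_wmb_def wmb_def, elim conjE, assumption)+
  show "lf sc (\<lambda>a. fst (D a) t f g)" "lf sc (\<lambda>a. snd (D a) t f g)"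
    using add scl assms by (simp_all add: lf_def meq_def mscale_def fsc2_def)
qed

section \<open>The elements T1 to T4 of A \<otimes> A and their relations\<close>

lemma T1_spec: "t1 a b \<in> T2s sc \<and> meq (T2s sc) (mprod (D a) (r1 sc mu b)) (asM mul2 (t1 a b))"
proof -
  have "\<forall>a b. \<exists>t\<in>T2s sc. meq (T2s sc) (mprod (D a) (r1 sc mu b)) (asM mul2 t)"
    by (insert regular, unfold regular_wmb_def wmb_def, elim conjE, assumption)
  then have "\<exists>t. t \<in> T2s sc \<and> meq (T2s sc) (mprod (D a) (r1 sc mu b)) (asM mul2 t)" by blast
  from someI_ex[OF this] show ?thesis unfolding T1_def .
qed

lemma T2_spec: "t2 a b \<in> T2s sc \<and> meq (T2s sc) (mprod (l1 sc mu a) (D b)) (asM mul2 (t2 a b))"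
proof -
  have "\<forall>a b. \<exists>t\<in>T2s sc. meq (T2s sc) (mprod (l1 sc mu a) (D b)) (asM mul2 t)"
    by (insert regular, unfold regular_wmb_def wmb_def, elim conjE, assumption)
  then have "\<exists>t. t \<in> T2s sc \<and> meq (T2s sc) (mprod (l1 sc mu a) (D b)) (asM mul2 t)" by blast
  from someI_ex[OF this] show ?thesis unfolding T2_def .
qed

lemma T3_spec: "t3 a b \<in> T2s sc \<and> meq (T2s sc) (mprod (r1 sc mu b) (D a)) (asM mul2 (t3 a b))"
proof -
  have "\<forall>a b. \<exists>t\<in>T2s sc. meq (T2s sc) (mprod (r1 sc mu b) (D a)) (asM mul2 t)"
    by (insert regular, unfold regular_wmb_def, elim conjE, assumption)
  then have "\<exists>t. t \<in> T2s sc \<and> meq (T2s sc) (mprod (r1 sc mu b) (D a)) (asM mul2 t)" by blast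
  from someI_ex[OF this] show ?thesis unfolding T3_def .
qed

lemma T4_spec: "t4 a b \<in> T2s sc \<and> meq (T2s sc) (mprod (D b) (l1 sc mu a)) (asM mul2 (t4 a b))"
proof -
  have "\<forall>a b. \<exists>t\<in>T2s sc. meq (T2s sc) (mprod (D b) (l1 sc mu a)) (asM mul2 t)"
    by (insert regular, unfold regular_wmb_def, elim conjE, assumption)
  then have "\<exists>t. t \<in> T2s sc \<and> meq (T2s sc) (mprod (D b) (l1 sc mu a)) (asM mul2 t)" by blast
  from someI_ex[OF this] show ?thesis unfolding T4_def .
qed

lemma T_in [simp]: "t1 a b \<in> T2s sc" "t2 a b \<in> T2s sc" "t3 a b \<in> T2s sc" "t4 a b \<in> T2s sc"
  using T1_spec T2_spec T3_spec T4_spec by auto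

lemma T1_mul:
  "s \<in> T2s sc \<Longrightarrow> fst (D a) (tmap2 sc id (mu b) s) = mul2 (t1 a b) s"
  "s \<in> T2s sc \<Longrightarrow> tmap2 sc id (\<lambda>y. mu y b) (snd (D a) s) = mul2 s (t1 a b)"
  using T1_spec[of a b] by (auto simp: meq_def mprod_def asM_def r1_def)

lemma T2_mul:
  "s \<in> T2s sc \<Longrightarrow> tmap2 sc (mu a) id (fst (D b) s) = mul2 (t2 a b) s"
  "s \<in> T2s sc \<Longrightarrow> snd (D b) (tmap2 sc (\<lambda>y. mu y a) id s) = mul2 s (t2 a b)"
  using T2_spec[of a b] by (auto simp: meq_def mprod_def asM_def l1_def)

lemma T3_mul:
  "s \<in> T2s sc \<Longrightarrow> tmap2 sc id (mu b) (fst (D a) s) = mul2 (t3 a b) s"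
  "s \<in> T2s sc \<Longrightarrow> snd (D a) (tmap2 sc id (\<lambda>y. mu y b) s) = mul2 s (t3 a b)"
  using T3_spec[of a b] by (auto simp: meq_def mprod_def asM_def r1_def)

lemma T4_mul:
  "s \<in> T2s sc \<Longrightarrow> fst (D b) (tmap2 sc (mu a) id s) = mul2 (t4 a b) s"
  "s \<in> T2s sc \<Longrightarrow> tmap2 sc (\<lambda>y. mu y a) id (snd (D b) s) = mul2 s (t4 a b)"
  using T4_spec[of a b] by (auto simp: meq_def mprod_def asM_def l1_def)

text \<open>\<Delta>(a)(c \<otimes> b) = T1(a \<otimes> b)(c \<otimes> 1). As T1 is specified
  through products with tensors, this is first known after right multiplication of the second leg by
  \<open>d\<close>, which then cancels. The analogues for T2, T3 and T4 are proved the same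
  way.\<close>

lemma DL_T1:
  assumes "lf sc f" "lf sc g"
  shows "fst (D a) (ten sc c b) f g = t1 a b (\<lambda>x. f (mu x c)) g"
proof -
  have "fst (D a) (ten sc c b) f (\<lambda>y. g (mu y d)) = tmap2 sc (\<lambda>x. mu x c) id (t1 a b) f (\<lambda>y. g (mu y d))"
    if "lf sc g" for d g
    using T1_mul(1)[of "ten sc c d" a b] assms that
    by (simp add: mlt_mu_fst2[OF D_mlt, symmetric] tmap2_ten lop_mu lop_id tmul2_ten_right tmap2_apply)
  note * = this
  have "fst (D a) (ten sc c b) f g = tmap2 sc (\<lambda>x. mu x c) id (t1 a b) f g"
    by (rule cancel_mu_right2[of "fst (D a) (ten sc c b)" "tmap2 sc (\<lambda>x. mu x c) id (t1 a b)" f, OF _ _ _ *]) (simp_all add: assms tmap2_in_T2s lop_mu lop_id)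
  then show ?thesis using assms by (simp add: tmap2_apply)
qed

lemma DR_T2:
  assumes "lf sc f" "lf sc g"
  shows "snd (D b) (ten sc a c) f g = t2 a b f (\<lambda>y. g (mu c y))"
proof -
  have "snd (D b) (ten sc a c) (\<lambda>x. f (mu d x)) g = tmap2 sc id (mu c) (t2 a b) (\<lambda>x. f (mu d x)) g"
    if "lf sc f" for d f
    using T2_mul(2)[of "ten sc d c" b a] assms that
    by (simp add: mlt_mu_snd1[OF D_mlt, symmetric] tmap2_ten lop_mu lop_id tmul2_ten_left tmap2_apply)
  note * = this
  have "snd (D b) (ten sc a c) f g = tmap2 sc id (mu c) (t2 a b) f g"
    by (rule cancel_mu_left1[of "snd (D b) (ten sc a c)" "tmap2 sc id (mu c) (t2 a b)" g, OF _ _ _ *]) (simp_all add: assms tmap2_in_T2s lop_mu lop_id)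
  then show ?thesis using assms by (simp add: tmap2_apply)
qed

text \<open>Both sides are (c \<otimes> 1)\<Delta>(a)(1 \<otimes> b).\<close>

lemma T1_T2:
  assumes "lf sc f" "lf sc g"
  shows "t1 a b (\<lambda>x. f (mu c x)) g = t2 c a f (\<lambda>y. g (mu y b))"
proof -
  have "tmap2 sc (mu c) id (t1 a b) f (\<lambda>y. g (mu d y)) = tmap2 sc id (\<lambda>y. mu y b) (t2 c a) f (\<lambda>y. g (mu d y))"
    if g: "lf sc g" for d g
  proof -
    have "mul2 (ten sc c d) (t1 a b) f g = tmap2 sc id (\<lambda>y. mu y b) (snd (D a) (ten sc c d)) f g"
      using T1_mul(2)[of "ten sc c d" b a] by simp
    then show ?thesis
      using assms g by (simp add: tmap2_apply tmul2_ten_left DR_T2 assoc)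
  qed
  note * = this
  have "tmap2 sc (mu c) id (t1 a b) f g = tmap2 sc id (\<lambda>y. mu y b) (t2 c a) f g"
    by (rule cancel_mu_left2[of "tmap2 sc (mu c) id (t1 a b)" "tmap2 sc id (\<lambda>y. mu y b) (t2 c a)" f, OF _ _ _ *]) (simp_all add: assms tmap2_in_T2s lop_mu lop_id)
  then show ?thesis using assms by (simp add: tmap2_apply)
qed

text \<open>Both sides are (1 \<otimes> b)\<Delta>(a)(1 \<otimes> c).\<close>

lemma T3_T1:
  assumes "lf sc f" "lf sc g"
  shows "t3 a b f (\<lambda>y. g (mu y c)) = t1 a c f (\<lambda>y. g (mu b y))"
proof -
  have "tmap2 sc id (\<lambda>y. mu y c) (t3 a b) (\<lambda>x. f (mu x d)) g = tmap2 sc id (mu b) (t1 a c) (\<lambda>x. f (mu x d)) g"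
    if f: "lf sc f" for d f
  proof -
    have "mul2 (t3 a b) (ten sc d c) f g = tmap2 sc id (mu b) (fst (D a) (ten sc d c)) f g"
      using T3_mul(1)[of "ten sc d c" b a] by simp
    then show ?thesis
      using assms f by (simp add: tmap2_apply tmul2_ten_right DL_T1)
  qed
  note * = this
  have "tmap2 sc id (\<lambda>y. mu y c) (t3 a b) f g = tmap2 sc id (mu b) (t1 a c) f g"
    by (rule cancel_mu_right1[of "tmap2 sc id (\<lambda>y. mu y c) (t3 a b)" "tmap2 sc id (mu b) (t1 a c)" g, OF _ _ _ *]) (simp_all add: assms tmap2_in_T2s lop_mu lop_id)
  then show ?thesis using assms by (simp add: tmap2_apply)
qed

text \<open>Both sides are (c \<otimes> 1)\<Delta>(b)(a \<otimes> 1).\<close>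

lemma T4_T2:
  assumes "lf sc f" "lf sc g"
  shows "t4 a b (\<lambda>x. f (mu c x)) g = t2 c b (\<lambda>x. f (mu x a)) g"
proof -
  have "tmap2 sc (mu c) id (t4 a b) f (\<lambda>y. g (mu d y)) = tmap2 sc (\<lambda>x. mu x a) id (t2 c b) f (\<lambda>y. g (mu d y))"
    if g: "lf sc g" for d g
  proof -
    have "mul2 (ten sc c d) (t4 a b) f g = tmap2 sc (\<lambda>x. mu x a) id (snd (D b) (ten sc c d)) f g"
      using T4_mul(2)[of "ten sc c d" a b] by simp
    then show ?thesis
      using assms g by (simp add: tmap2_apply tmul2_ten_left DR_T2)
  qed
  note * = this
  have "tmap2 sc (mu c) id (t4 a b) f g = tmap2 sc (\<lambda>x. mu x a) id (t2 c b) f g"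
    by (rule cancel_mu_left2[of "tmap2 sc (mu c) id (t4 a b)" "tmap2 sc (\<lambda>x. mu x a) id (t2 c b)" f, OF _ _ _ *]) (simp_all add: assms tmap2_in_T2s lop_mu lop_id)
  then show ?thesis using assms by (simp add: tmap2_apply)
qed

lemma DR_T3:
  assumes "lf sc f" "lf sc g"
  shows "snd (D a) (ten sc c b) f g = t3 a b (\<lambda>x. f (mu c x)) g"
proof -
  have "snd (D a) (ten sc c b) f (\<lambda>y. g (mu d y)) = tmap2 sc (mu c) id (t3 a b) f (\<lambda>y. g (mu d y))"
    if "lf sc g" for d g
    using T3_mul(2)[of "ten sc c d" a b] assms that
    by (simp add: mlt_mu_snd2[OF D_mlt, symmetric] tmap2_ten lop_mu lop_id tmul2_ten_left tmap2_apply)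
  note * = this
  have "snd (D a) (ten sc c b) f g = tmap2 sc (mu c) id (t3 a b) f g"
    by (rule cancel_mu_left2[of "snd (D a) (ten sc c b)" "tmap2 sc (mu c) id (t3 a b)" f, OF _ _ _ *]) (simp_all add: assms tmap2_in_T2s lop_mu lop_id)
  then show ?thesis using assms by (simp add: tmap2_apply)
qed

lemma DL_T4:
  assumes "lf sc f" "lf sc g"
  shows "fst (D b) (ten sc a c) f g = t4 a b f (\<lambda>y. g (mu y c))"
proof -
  have "fst (D b) (ten sc a c) (\<lambda>x. f (mu x d)) g = tmap2 sc id (\<lambda>y. mu y c) (t4 a b) (\<lambda>x. f (mu x d)) g"
    if "lf sc f" for d f
    using T4_mul(1)[of "ten sc d c" b a] assms that
    by (simp add: mlt_mu_fst1[OF D_mlt, symmetric] tmap2_ten lop_mu lop_id tmul2_ten_right tmap2_apply)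
  note * = this
  have "fst (D b) (ten sc a c) f g = tmap2 sc id (\<lambda>y. mu y c) (t4 a b) f g"
    by (rule cancel_mu_right1[of "fst (D b) (ten sc a c)" "tmap2 sc id (\<lambda>y. mu y c) (t4 a b)" g, OF _ _ _ *]) (simp_all add: assms tmap2_in_T2s lop_mu lop_id)
  then show ?thesis using assms by (simp add: tmap2_apply)
qed

lemma counit_axiom: "slice_l sc eps (t1 a b) = mu a b" "slice_r sc (t2 a b) eps = mu a b"
proof -
  have "\<forall>a b. slice_l sc eps (t1 a b) = mu a b \<and> slice_r sc (t2 a b) eps = mu a b"
    by (insert regular, unfold regular_wmb_def wmb_def, elim conjE, assumption)
  then show "slice_l sc eps (t1 a b) = mu a b" "slice_r sc (t2 a b) eps = mu a b" by auto
qed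

lemma counit1: "lf sc g \<Longrightarrow> t1 a b eps g = g (mu a b)"
  using slice_l_apply[of "t1 a b" eps g] by (simp add: counit_axiom)

lemma counit2: "lf sc f \<Longrightarrow> t2 a b f eps = f (mu a b)"
  using slice_r_apply[of "t2 a b" eps f] by (simp add: counit_axiom)

text \<open>The counit axiom covers only T1 and T2. Right multiplication by \<open>c\<close> turns
  T3 into T1, where the axiom applies, and \<open>c\<close> cancels; T4 is reduced to T2 in the same
  way.\<close>

lemma counit3: assumes "lf sc g" shows "t3 a b eps g = g (mu b a)"
proof -
  have "slice_l sc eps (t3 a b) = mu b a"
  proof (rule cancel_right)
    fix c f assume f: "lf sc f"
    have "f (mu (slice_l sc eps (t3 a b)) c) = t3 a b eps (\<lambda>y. f (mu y c))"
      using slice_l_apply[of "t3 a b" eps "\<lambda>y. f (mu y c)"] f by simp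
    then show "f (mu (slice_l sc eps (t3 a b)) c) = f (mu (mu b a) c)"
      using f by (simp add: T3_T1 counit1 assoc)
  qed
  then show ?thesis using slice_l_apply[of "t3 a b" eps g] assms by simp
qed

lemma counit4: assumes "lf sc f" shows "t4 a b f eps = f (mu b a)"
proof -
  have "slice_r sc (t4 a b) eps = mu b a"
  proof (rule cancel_left)
    fix c f assume f: "lf sc f"
    have "f (mu c (slice_r sc (t4 a b) eps)) = t4 a b (\<lambda>y. f (mu c y)) eps"
      using slice_r_apply[of "t4 a b" eps "\<lambda>y. f (mu c y)"] f by simp
    then show "f (mu c (slice_r sc (t4 a b) eps)) = f (mu c (mu b a))"
      using f by (simp add: T4_T2 counit2 assoc)
  qed
  then show ?thesis using slice_r_apply[of "t4 a b" eps f] assms by simp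
qed

text \<open>By (iv) the images of \<Delta>(a) lie in those of the idempotent \<open>E\<close>, where
  \<open>E\<close> acts as the identity.\<close>

lemma E_D:
  shows E_DL: "fst E (fst (D a) (ten sc b c)) = fst (D a) (ten sc b c)"
    and E_DR: "snd E (snd (D a) (ten sc b c)) = snd (D a) (ten sc b c)"
proof -
  interpret m: module "fsc2 :: 'k \<Rightarrow> ('k,'a) form2 \<Rightarrow> ('k,'a) form2" by (rule module_fsc2)
  have span: "m.span {fst (D a) (ten sc b b') | a b b'. True} = m.span {fst E (ten sc b b') | b b'. True}"
    "m.span {snd (D a) (ten sc b b') | a b b'. True} = m.span {snd E (ten sc b b') | b b'. True}"
    by (insert regular, unfold regular_wmb_def wmb_def, elim conjE, assumption)+
  have "m.subspace {t \<in> T2s sc. fst E t = t}" "m.subspace {t \<in> T2s sc. snd E t = t}"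
    using mlt_add[OF E_mlt] mlt_scale[OF E_mlt] mlt_zero[OF E_mlt] by (auto simp: m.subspace_def)
  then have "m.span {fst E (ten sc b b') | b b'. True} \<subseteq> {t \<in> T2s sc. fst E t = t}"
    "m.span {snd E (ten sc b b') | b b'. True} \<subseteq> {t \<in> T2s sc. snd E t = t}"
    by (intro m.span_minimal; auto simp: E_idem_fst E_idem_snd)+
  moreover have "fst (D a) (ten sc b c) \<in> m.span {fst (D a) (ten sc b b') | a b b'. True}"
    "snd (D a) (ten sc b c) \<in> m.span {snd (D a) (ten sc b b') | a b b'. True}"
    by (auto intro: m.span_base)
  ultimately show "fst E (fst (D a) (ten sc b c)) = fst (D a) (ten sc b c)"
    "snd E (snd (D a) (ten sc b c)) = snd (D a) (ten sc b c)"
    unfolding span by auto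
qed

section \<open>The extensions of id \<otimes> \<Delta> and \<Delta> \<otimes> id, and the threefold
  idempotent\<close>

lemma gam1_pt:
  assumes u: "u \<in> T2s sc" and x: "x \<in> T2s sc" and lf: "lf sc f" "lf sc g" "lf sc h"
  shows "fst (gam1 sc mu D x) (pt sc p u) f g h = x (\<lambda>a. f (mu a p)) (\<lambda>b. fst (D b) u g h)"
    and "snd (gam1 sc mu D x) (pt sc p u) f g h = x (\<lambda>a. f (mu p a)) (\<lambda>b. snd (D b) u g h)"
proof -
  have "x F G = (\<Sum>(a,b)\<leftarrow>rep2 sc x. F a * G b)" if "lf sc F" "lf sc G" for F G
    using ten2_apply[OF that] rep2[OF x] by metis
  then show "fst (gam1 sc mu D x) (pt sc p u) f g h = x (\<lambda>a. f (mu a p)) (\<lambda>b. fst (D b) u g h)"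
    "snd (gam1 sc mu D x) (pt sc p u) f g h = x (\<lambda>a. f (mu p a)) (\<lambda>b. snd (D b) u g h)"
    using u lf D_lf[OF u]
    by (simp_all add: gam1_def fst_sum_list snd_sum_list case_prod_unfold sum_list_fun1 mprod_def
        l11_def tmap3_pt lop_mu one_ot_pt D_mlt pt_apply)
qed

lemma gam2_tp:
  assumes u: "u \<in> T2s sc" and x: "x \<in> T2s sc" and lf: "lf sc f" "lf sc g" "lf sc h"
  shows "fst (gam2 sc mu D x) (tp sc u p) f g h = x (\<lambda>a. fst (D a) u f g) (\<lambda>b. h (mu b p))"
    and "snd (gam2 sc mu D x) (tp sc u p) f g h = x (\<lambda>a. snd (D a) u f g) (\<lambda>b. h (mu p b))"
proof -
  have "x F G = (\<Sum>(a,b)\<leftarrow>rep2 sc x. F a * G b)" if "lf sc F" "lf sc G" for F G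
    using ten2_apply[OF that] rep2[OF x] by metis
  then show "fst (gam2 sc mu D x) (tp sc u p) f g h = x (\<lambda>a. fst (D a) u f g) (\<lambda>b. h (mu b p))"
    "snd (gam2 sc mu D x) (tp sc u p) f g h = x (\<lambda>a. snd (D a) u f g) (\<lambda>b. h (mu p b))"
    using u lf D_lf[OF u]
    by (simp_all add: gam2_def fst_sum_list snd_sum_list case_prod_unfold sum_list_fun1 mprod_def
        r11_def tmap3_tp lop_mu ot_one_tp D_mlt tp_apply)
qed

text \<open>An equation of forms is needed, including the values at non-linear functionals, because
  a multiplier is applied to the result next.\<close>

lemma gam1_ten:
  assumes u: "u \<in> T2s sc"
  shows "fst (gam1 sc mu D (ten sc a b)) (pt sc p u) = pt sc (mu a p) (fst (D b) u)"
    and "snd (gam1 sc mu D (ten sc a b)) (pt sc p u) = pt sc (mu p a) (snd (D b) u)"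
proof -
  have z: "fst (gam1 sc mu D (ten sc a b)) (pt sc p u) f g h = 0"
    "snd (gam1 sc mu D (ten sc a b)) (pt sc p u) f g h = 0"
    if "\<not> (lf sc f \<and> lf sc g \<and> lf sc h)" for f g h
    using u
    by (simp_all add: gam1_def fst_sum_list snd_sum_list case_prod_unfold sum_list_fun1 mprod_def
        l11_def tmap3_pt lop_mu one_ot_pt D_mlt pt_not_lf[OF that])
  have "lf sc f \<Longrightarrow> lf sc g \<Longrightarrow> lf sc h \<Longrightarrow>
      fst (gam1 sc mu D (ten sc a b)) (pt sc p u) f g h = pt sc (mu a p) (fst (D b) u) f g h"
    "lf sc f \<Longrightarrow> lf sc g \<Longrightarrow> lf sc h \<Longrightarrow>
      snd (gam1 sc mu D (ten sc a b)) (pt sc p u) f g h = pt sc (mu p a) (snd (D b) u) f g h" for f g h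
    using D_lf[OF u] by (simp_all add: gam1_pt[OF u] ten_apply pt_apply)
  with z show "fst (gam1 sc mu D (ten sc a b)) (pt sc p u) = pt sc (mu a p) (fst (D b) u)"
    and "snd (gam1 sc mu D (ten sc a b)) (pt sc p u) = pt sc (mu p a) (snd (D b) u)"
    by (intro ext; force simp: pt_def)+
qed

lemma gam2_ten:
  assumes u: "u \<in> T2s sc"
  shows "fst (gam2 sc mu D (ten sc a b)) (tp sc u p) = tp sc (fst (D a) u) (mu b p)"
    and "snd (gam2 sc mu D (ten sc a b)) (tp sc u p) = tp sc (snd (D a) u) (mu p b)"
proof -
  have z: "fst (gam2 sc mu D (ten sc a b)) (tp sc u p) f g h = 0"
    "snd (gam2 sc mu D (ten sc a b)) (tp sc u p) f g h = 0"
    if "\<not> (lf sc f \<and> lf sc g \<and> lf sc h)" for f g h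
    using u
    by (simp_all add: gam2_def fst_sum_list snd_sum_list case_prod_unfold sum_list_fun1 mprod_def
        r11_def tmap3_tp lop_mu ot_one_tp D_mlt tp_not_lf[OF that])
  have "lf sc f \<Longrightarrow> lf sc g \<Longrightarrow> lf sc h \<Longrightarrow>
      fst (gam2 sc mu D (ten sc a b)) (tp sc u p) f g h = tp sc (fst (D a) u) (mu b p) f g h"
    "lf sc f \<Longrightarrow> lf sc g \<Longrightarrow> lf sc h \<Longrightarrow>
      snd (gam2 sc mu D (ten sc a b)) (tp sc u p) f g h = tp sc (snd (D a) u) (mu p b) f g h" for f g h
    using D_lf[OF u] by (simp_all add: gam2_tp[OF u] ten_apply tp_apply)
  with z show "fst (gam2 sc mu D (ten sc a b)) (tp sc u p) = tp sc (fst (D a) u) (mu b p)"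
    and "snd (gam2 sc mu D (ten sc a b)) (tp sc u p) = tp sc (snd (D a) u) (mu p b)"
    by (intro ext; force simp: tp_def)+
qed

lemma E3_comm: "meq (T3s sc) (mprod (ot_one sc E) (one_ot sc E)) (mprod (one_ot sc E) (ot_one sc E))"
  and E3_ext1: "is_ext sc mu (gam1 sc mu D) (one_ot sc E) E (mprod (ot_one sc E) (one_ot sc E))"
  and E3_ext2: "is_ext sc mu (gam2 sc mu D) (ot_one sc E) E (mprod (ot_one sc E) (one_ot sc E))"
  by (insert regular, unfold regular_wmb_def wmb_def, elim conjE, assumption)+

text \<open>These are \<open>(E \<otimes> 1)(a \<otimes> \<Delta>(b)) = (id \<otimes> \<Delta>)(E(a \<otimes> b))\<close> and its three mirror images, applied to
  \<open>p \<otimes> d \<otimes> e\<close> resp. \<open>d \<otimes> e \<otimes> p\<close> and to the functional \<open>f \<otimes> g \<otimes> h\<close>.\<close>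

lemma E_id_D:
  assumes lf: "lf sc f" "lf sc g" "lf sc h"
  shows E_id_DL: "EL (mu a p) (slice_r sc (fst (D b) (ten sc d e)) h) f g =
      EL a b (\<lambda>a. f (mu a p)) (\<lambda>b. fst (D b) (ten sc d e) g h)"
    and E_id_DR: "ER (mu p a) (slice_r sc (snd (D b) (ten sc d e)) h) f g =
      ER a b (\<lambda>a. f (mu p a)) (\<lambda>b. snd (D b) (ten sc d e) g h)"
proof -
  let ?\<tau> = "pt sc p (ten sc d e)" and ?G = "mprod (ot_one sc E) (one_ot sc E)"
  have \<tau>: "?\<tau> \<in> T3s sc" by (simp add: pt_in_T3s)
  have "fst ?G (fst (gam1 sc mu D (ten sc a b)) ?\<tau>) = fst (gam1 sc mu D (EL a b)) ?\<tau>"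
    "snd ?G (snd (gam1 sc mu D (ten sc a b)) ?\<tau>) = snd (gam1 sc mu D (ER a b)) ?\<tau>"
    using E3_ext1 \<tau> unfolding is_ext_def by (auto simp: meq_def mprod_def)
  \<comment> \<open>Since E\<Delta>(b) = \<Delta>(b), the factor 1 \<otimes> E disappears and only E
    \<otimes> 1 remains.\<close>
  moreover have "fst ?G (pt sc (mu a p) (fst (D b) (ten sc d e))) =
      fst (ot_one sc E) (pt sc (mu a p) (fst (D b) (ten sc d e)))"
    by (simp add: mprod_def one_ot_pt E_mlt E_DL)
  \<comment> \<open>Right actions compose in the opposite order, so \<open>snd ?G\<close> applies E
    \<otimes> 1 first. Commuting the two factors brings 1 \<otimes> E next to \<Delta>(b), which
    absorbs it.\<close>
  moreover have "snd ?G (pt sc (mu p a) (snd (D b) (ten sc d e))) =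
      snd (ot_one sc E) (pt sc (mu p a) (snd (D b) (ten sc d e)))"
    using E3_comm by (simp add: meq_def pt_in_T3s) (simp add: mprod_def one_ot_pt E_mlt E_DR)
  ultimately have "fst (ot_one sc E) (pt sc (mu a p) (fst (D b) (ten sc d e))) = fst (gam1 sc mu D (EL a b)) ?\<tau>"
    "snd (ot_one sc E) (pt sc (mu p a) (snd (D b) (ten sc d e))) = snd (gam1 sc mu D (ER a b)) ?\<tau>"
    by (simp_all add: gam1_ten)
  from this[THEN fun_cong, THEN fun_cong, THEN fun_cong, of f g h]
  show "EL (mu a p) (slice_r sc (fst (D b) (ten sc d e)) h) f g =
      EL a b (\<lambda>a. f (mu a p)) (\<lambda>b. fst (D b) (ten sc d e) g h)"
    "ER (mu p a) (slice_r sc (snd (D b) (ten sc d e)) h) f g =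
      ER a b (\<lambda>a. f (mu p a)) (\<lambda>b. snd (D b) (ten sc d e) g h)"
    using lf by (simp_all add: ot_one_pt gam1_pt)
qed

lemma E_D_id:
  assumes lf: "lf sc f" "lf sc g" "lf sc h"
  shows E_DL_id: "EL (slice_l sc f (fst (D a) (ten sc d e))) (mu b p) g h =
      EL a b (\<lambda>a. fst (D a) (ten sc d e) f g) (\<lambda>b. h (mu b p))"
    and E_DR_id: "ER (slice_l sc f (snd (D a) (ten sc d e))) (mu p b) g h =
      ER a b (\<lambda>a. snd (D a) (ten sc d e) f g) (\<lambda>b. h (mu p b))"
proof -
  let ?\<tau> = "tp sc (ten sc d e) p" and ?G = "mprod (ot_one sc E) (one_ot sc E)"
  have \<tau>: "?\<tau> \<in> T3s sc" by (simp add: tp_in_T3s)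
  have "fst ?G (fst (gam2 sc mu D (ten sc a b)) ?\<tau>) = fst (gam2 sc mu D (EL a b)) ?\<tau>"
    "snd ?G (snd (gam2 sc mu D (ten sc a b)) ?\<tau>) = snd (gam2 sc mu D (ER a b)) ?\<tau>"
    using E3_ext2 \<tau> unfolding is_ext_def by (auto simp: meq_def mprod_def)
  moreover have "fst ?G (tp sc (fst (D a) (ten sc d e)) (mu b p)) =
      fst (one_ot sc E) (tp sc (fst (D a) (ten sc d e)) (mu b p))"
    using E3_comm by (simp add: meq_def tp_in_T3s) (simp add: mprod_def ot_one_tp E_mlt E_DL)
  moreover have "snd ?G (tp sc (snd (D a) (ten sc d e)) (mu p b)) =
      snd (one_ot sc E) (tp sc (snd (D a) (ten sc d e)) (mu p b))"
    by (simp add: mprod_def ot_one_tp E_mlt E_DR)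
  ultimately have "fst (one_ot sc E) (tp sc (fst (D a) (ten sc d e)) (mu b p)) = fst (gam2 sc mu D (EL a b)) ?\<tau>"
    "snd (one_ot sc E) (tp sc (snd (D a) (ten sc d e)) (mu p b)) = snd (gam2 sc mu D (ER a b)) ?\<tau>"
    by (simp_all add: gam2_ten)
  from this[THEN fun_cong, THEN fun_cong, THEN fun_cong, of f g h]
  show "EL (slice_l sc f (fst (D a) (ten sc d e))) (mu b p) g h =
      EL a b (\<lambda>a. fst (D a) (ten sc d e) f g) (\<lambda>b. h (mu b p))"
    "ER (slice_l sc f (snd (D a) (ten sc d e))) (mu p b) g h =
      ER a b (\<lambda>a. snd (D a) (ten sc d e) f g) (\<lambda>b. h (mu p b))"
    using lf by (simp_all add: one_ot_tp gam2_tp)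
qed

text \<open>\<open>(id \<otimes> \<epsilon> \<otimes> id)((E \<otimes> 1)(a \<otimes> T\<^sub>3(b \<otimes> p))) = (1 \<otimes> p)E(a \<otimes> b)\<close>; since the extra factors in the
  previous identities cannot be set to 1, they have to be cancelled by non-degeneracy one at a time.\<close>

lemma E_T3:
  assumes f: "lf sc f" and h: "lf sc h"
  shows "t3 b p (\<lambda>x. EL a x f eps) h = EL a b f (\<lambda>y. h (mu p y))"
proof -
  have step: "t3 b p (\<lambda>x. EL a x (\<lambda>z. f (mu z q)) eps) h = EL a b (\<lambda>z. f (mu z q)) (\<lambda>y. h (mu p y))"
    if f: "lf sc f" for q f
  proof -
    \<comment> \<open>\<open>E_id_DL\<close> multiplies the first leg from the right;
      \<open>q\<close> is that factor, hidden in \<open>f'\<close> and cancelled at the very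
      end.\<close>
    define f' where "f' = (\<lambda>z. f (mu z q))"
    define v where "v = slice_l sc f' (EL a b)"
    have f': "lf sc f'" using f by (simp add: f'_def)
    have "slice_l sc (\<lambda>x. EL a x f' eps) (t3 b p) = mu p v"
    proof (rule cancel_right)
      fix e h assume h: "lf sc h"
      define w where "w = slice_r sc (t3 b p) (\<lambda>y. h (mu y e))"
      have s0: "fst (D u) (ten sc d e) g (\<lambda>y. h (mu p y)) = t3 u p (\<lambda>x. g (mu x d)) (\<lambda>y. h (mu y e))"
        if "lf sc g" for u d g
        using that h by (simp add: DL_T1 T3_T1)
      have s1: "slice_r sc (fst (D b) (ten sc d e)) (\<lambda>y. h (mu p y)) = mu w d" for d
      proof (rule slice_r_eqI)
        fix g assume "lf sc g"
        then show "fst (D b) (ten sc d e) g (\<lambda>y. h (mu p y)) = g (mu w d)"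
          using s0 h slice_r_apply[of "t3 b p" "\<lambda>y. h (mu y e)" "\<lambda>x. g (mu x d)"] by (simp add: w_def)
      qed (use h in simp_all)
      \<comment> \<open>The middle leg stays open: this is an equation of elements, so
        \<open>d\<close> can be cancelled before \<open>eps\<close> is applied to that leg.\<close>
      have "slice_l sc f' (EL a w) = slice_r sc (t3 v p) (\<lambda>y. h (mu y e))"
      proof (rule cancel_right)
        fix d g assume g: "lf sc g"
        have "g (mu (slice_l sc f' (EL a w)) d) = EL a w f' (\<lambda>x. g (mu x d))"
          using slice_l_apply[of "EL a w" f' "\<lambda>x. g (mu x d)"] f' g by simp
        also have "\<dots> = EL (mu a q) (mu w d) f g"
          using mlt_mu_fst1[OF E_mlt f g, of a q "mu w d"]
            mlt_mu_fst2[OF E_mlt _ g, of f' a w d] f' by (simp add: f'_def)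
        also have "\<dots> = EL a b f' (\<lambda>b. fst (D b) (ten sc d e) g (\<lambda>y. h (mu p y)))"
          using E_id_DL[of f g "\<lambda>y. h (mu p y)" a q b d e] f g h s1 by (simp add: f'_def)
        also have "\<dots> = fst (D v) (ten sc d e) g (\<lambda>y. h (mu p y))"
          unfolding v_def by (rule slice_l_apply[symmetric]) (simp_all add: f' D_lf)
        also have "\<dots> = g (mu (slice_r sc (t3 v p) (\<lambda>y. h (mu y e))) d)"
          using s0 g h slice_r_apply[of "t3 v p" "\<lambda>y. h (mu y e)" "\<lambda>x. g (mu x d)"] by simp
        finally show "g (mu (slice_l sc f' (EL a w)) d) = \<dots>" .
      qed
      then have "EL a w f' eps = t3 v p eps (\<lambda>y. h (mu y e))"
        using slice_l_apply[of "EL a w" f' eps] slice_r_apply[of "t3 v p" "\<lambda>y. h (mu y e)" eps] f' h by simp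
      moreover have "EL a w f' eps = t3 b p (\<lambda>x. EL a x f' eps) (\<lambda>y. h (mu y e))"
        unfolding w_def by (rule slice_r_apply) (simp_all add: h EL_lf)
      ultimately show "h (mu (slice_l sc (\<lambda>x. EL a x f' eps) (t3 b p)) e) = h (mu (mu p v) e)"
        using slice_l_apply[of "t3 b p" "\<lambda>x. EL a x f' eps" "\<lambda>y. h (mu y e)"] h
        by (simp add: EL_lf counit3)
    qed
    then show ?thesis
      using slice_l_apply[of "t3 b p" "\<lambda>x. EL a x f' eps" h]
        slice_l_apply[of "EL a b" f' "\<lambda>y. h (mu p y)"] f' h
      by (simp add: EL_lf v_def f'_def)
  qed
  define w where "w = slice_r sc (t3 b p) h"
  have w: "EL a w f eps = t3 b p (\<lambda>x. EL a x f eps) h" for f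
    unfolding w_def by (rule slice_r_apply) (simp_all add: h EL_lf)
  have "slice_r sc (EL a w) eps = slice_r sc (EL a b) (\<lambda>y. h (mu p y))"
  proof (rule cancel_right)
    fix q f assume f: "lf sc f"
    show "f (mu (slice_r sc (EL a w) eps) q) = f (mu (slice_r sc (EL a b) (\<lambda>y. h (mu p y))) q)"
      using slice_r_apply[of "EL a w" eps "\<lambda>x. f (mu x q)"] step[OF f, of q] w f h
        slice_r_apply[of "EL a b" "\<lambda>y. h (mu p y)" "\<lambda>x. f (mu x q)"] by simp
  qed
  then show ?thesis
    using slice_r_apply[of "EL a w" eps f] w[of f] f h
      slice_r_apply[of "EL a b" "\<lambda>y. h (mu p y)" f] by simp
qed

text \<open>The counterpart of \<open>E_T3\<close> for right actions: it computes (a \<otimes> b)E(1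
  \<otimes> p) instead of (1 \<otimes> p)E(a \<otimes> b).\<close>

lemma E_T1:
  assumes f: "lf sc f" and h: "lf sc h"
  shows "t1 b p (\<lambda>x. ER a x f eps) h = ER a b f (\<lambda>y. h (mu y p))"
proof -
  have step: "t1 b p (\<lambda>x. ER a x (\<lambda>z. f (mu q z)) eps) h = ER a b (\<lambda>z. f (mu q z)) (\<lambda>y. h (mu y p))"
    if f: "lf sc f" for q f
  proof -
    define f' where "f' = (\<lambda>z. f (mu q z))"
    define v where "v = slice_l sc f' (ER a b)"
    have f': "lf sc f'" using f by (simp add: f'_def)
    have "slice_l sc (\<lambda>x. ER a x f' eps) (t1 b p) = mu v p"
    proof (rule cancel_left)
      fix e h assume h: "lf sc h"
      define w where "w = slice_r sc (t1 b p) (\<lambda>y. h (mu e y))"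
      have s0: "snd (D u) (ten sc d e) g (\<lambda>y. h (mu y p)) = t1 u p (\<lambda>x. g (mu d x)) (\<lambda>y. h (mu e y))"
        if "lf sc g" for u d g
        using that h T1_T2[of g "\<lambda>y. h (mu e y)" u p d] by (simp add: DR_T2 assoc)
      have s1: "slice_r sc (snd (D b) (ten sc d e)) (\<lambda>y. h (mu y p)) = mu d w" for d
      proof (rule slice_r_eqI)
        fix g assume "lf sc g"
        then show "snd (D b) (ten sc d e) g (\<lambda>y. h (mu y p)) = g (mu d w)"
          using s0 h slice_r_apply[of "t1 b p" "\<lambda>y. h (mu e y)" "\<lambda>x. g (mu d x)"] by (simp add: w_def)
      qed (use h in simp_all)
      have "slice_l sc f' (ER a w) = slice_r sc (t1 v p) (\<lambda>y. h (mu e y))"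
      proof (rule cancel_left)
        fix d g assume g: "lf sc g"
        have "g (mu d (slice_l sc f' (ER a w))) = ER a w f' (\<lambda>x. g (mu d x))"
          using slice_l_apply[of "ER a w" f' "\<lambda>x. g (mu d x)"] f' g by simp
        also have "\<dots> = ER (mu q a) (mu d w) f g"
          using mlt_mu_snd1[OF E_mlt f g, of q a "mu d w"]
            mlt_mu_snd2[OF E_mlt _ g, of f' a d w] f' by (simp add: f'_def)
        also have "\<dots> = ER a b f' (\<lambda>b. snd (D b) (ten sc d e) g (\<lambda>y. h (mu y p)))"
          using E_id_DR[of f g "\<lambda>y. h (mu y p)" q a b d e] f g h s1 by (simp add: f'_def)
        also have "\<dots> = snd (D v) (ten sc d e) g (\<lambda>y. h (mu y p))"
          unfolding v_def by (rule slice_l_apply[symmetric]) (simp_all add: f' D_lf)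
        also have "\<dots> = g (mu d (slice_r sc (t1 v p) (\<lambda>y. h (mu e y))))"
          using s0 g h slice_r_apply[of "t1 v p" "\<lambda>y. h (mu e y)" "\<lambda>x. g (mu d x)"] by simp
        finally show "g (mu d (slice_l sc f' (ER a w))) = \<dots>" .
      qed
      then have "ER a w f' eps = t1 v p eps (\<lambda>y. h (mu e y))"
        using slice_l_apply[of "ER a w" f' eps] slice_r_apply[of "t1 v p" "\<lambda>y. h (mu e y)" eps] f' h by simp
      moreover have "ER a w f' eps = t1 b p (\<lambda>x. ER a x f' eps) (\<lambda>y. h (mu e y))"
        unfolding w_def by (rule slice_r_apply) (simp_all add: h ER_lf)
      ultimately show "h (mu e (slice_l sc (\<lambda>x. ER a x f' eps) (t1 b p))) = h (mu e (mu v p))"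
        using slice_l_apply[of "t1 b p" "\<lambda>x. ER a x f' eps" "\<lambda>y. h (mu e y)"] h
        by (simp add: ER_lf counit1)
    qed
    then show ?thesis
      using slice_l_apply[of "t1 b p" "\<lambda>x. ER a x f' eps" h]
        slice_l_apply[of "ER a b" f' "\<lambda>y. h (mu y p)"] f' h
      by (simp add: ER_lf v_def f'_def)
  qed
  define w where "w = slice_r sc (t1 b p) h"
  have w: "ER a w f eps = t1 b p (\<lambda>x. ER a x f eps) h" for f
    unfolding w_def by (rule slice_r_apply) (simp_all add: h ER_lf)
  have "slice_r sc (ER a w) eps = slice_r sc (ER a b) (\<lambda>y. h (mu y p))"
  proof (rule cancel_left)
    fix q f assume f: "lf sc f"
    show "f (mu q (slice_r sc (ER a w) eps)) = f (mu q (slice_r sc (ER a b) (\<lambda>y. h (mu y p))))"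
      using slice_r_apply[of "ER a w" eps "\<lambda>x. f (mu q x)"] step[OF f, of q] w f h
        slice_r_apply[of "ER a b" "\<lambda>y. h (mu y p)" "\<lambda>x. f (mu q x)"] by simp
  qed
  then show ?thesis
    using slice_r_apply[of "ER a w" eps f] w[of f] f h
      slice_r_apply[of "ER a b" "\<lambda>y. h (mu y p)" f] by simp
qed

text \<open>\<open>(1 \<otimes> E)(T\<^sub>2(c \<otimes> b) \<otimes> z) = (T\<^sub>2(c \<otimes> -) \<otimes> id)(E(b \<otimes> z))\<close>.\<close>

lemma E_T2_left:
  assumes f: "lf sc f" and g: "lf sc g" and h: "lf sc h"
  shows "t2 c b f (\<lambda>y. EL y z g h) = t2 c (slice_r sc (EL b z) h) f g"
proof -
  define m where "m = slice_r sc (EL b z) h"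
  have "slice_r sc (t2 c b) (\<lambda>y. EL y z g h) = slice_r sc (t2 c m) g"
  proof (rule cancel_right)
    \<comment> \<open>There are three auxiliary factors, \<open>d\<close>, \<open>e\<close> and
      \<open>p\<close>, one for each leg; they are cancelled from the inside out.\<close>
    fix d f assume f: "lf sc f"
    define w where "w = slice_l sc (\<lambda>x. f (mu x d)) (t2 c b)"
    \<comment> \<open>Both sides are (c \<otimes> 1)\<Delta>(a)(d \<otimes> e).\<close>
    have s0: "fst (D a) (ten sc d e) (\<lambda>x. f (mu c x)) g = t2 c a (\<lambda>x. f (mu x d)) (\<lambda>y. g (mu y e))"
      if "lf sc g" for a e g
      using that f T1_T2[of "\<lambda>x. f (mu x d)" g a e c] by (simp add: DL_T1 assoc)
    have "slice_r sc (EL w z) h = slice_l sc (\<lambda>x. f (mu x d)) (t2 c m)"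
    proof (rule cancel_right)
      fix e g assume g: "lf sc g"
      define \<phi> where "\<phi> = (\<lambda>a. fst (D a) (ten sc d e) (\<lambda>x. f (mu c x)) g)"
      have \<phi>: "lf sc \<phi>" by (simp add: \<phi>_def D_lf)
      have s1: "slice_l sc (\<lambda>x. f (mu c x)) (fst (D b) (ten sc d e)) = mu w e"
      proof (rule slice_l_eqI)
        fix g assume "lf sc g"
        then show "fst (D b) (ten sc d e) (\<lambda>x. f (mu c x)) g = g (mu w e)"
          using s0 f slice_l_apply[of "t2 c b" "\<lambda>x. f (mu x d)" "\<lambda>y. g (mu y e)"] by (simp add: w_def)
      qed (use f in simp_all)
      have "slice_l sc (\<lambda>y. g (mu y e)) (EL w z) = slice_l sc \<phi> (EL b z)"
      proof (rule cancel_right)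
        fix p h assume h: "lf sc h"
        have "EL w z (\<lambda>y. g (mu y e)) (\<lambda>y. h (mu y p)) = EL (mu w e) (mu z p) g h"
          using mlt_mu_fst1[OF E_mlt g h, of w e "mu z p"]
            mlt_mu_fst2[OF E_mlt _ h, of "\<lambda>y. g (mu y e)" w z p] g by simp
        also have "\<dots> = EL b z \<phi> (\<lambda>y. h (mu y p))"
          using E_DL_id[of "\<lambda>x. f (mu c x)" g h b d e z p] f g h s1 by (simp add: \<phi>_def)
        finally show "h (mu (slice_l sc (\<lambda>y. g (mu y e)) (EL w z)) p) = h (mu (slice_l sc \<phi> (EL b z)) p)"
          using slice_l_apply[of "EL w z" "\<lambda>y. g (mu y e)" "\<lambda>y. h (mu y p)"]
            slice_l_apply[of "EL b z" \<phi> "\<lambda>y. h (mu y p)"] g h \<phi> by simp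
      qed
      then have "EL w z (\<lambda>y. g (mu y e)) h = EL b z \<phi> h"
        using slice_l_apply[of "EL w z" "\<lambda>y. g (mu y e)" h] slice_l_apply[of "EL b z" \<phi> h] g h \<phi> by simp
      also have "\<dots> = \<phi> m" unfolding m_def using slice_r_apply[of "EL b z" h \<phi>] h \<phi> by simp
      also have "\<dots> = t2 c m (\<lambda>x. f (mu x d)) (\<lambda>y. g (mu y e))" using s0 g by (simp add: \<phi>_def)
      finally show "g (mu (slice_r sc (EL w z) h) e) = g (mu (slice_l sc (\<lambda>x. f (mu x d)) (t2 c m)) e)"
        using slice_r_apply[of "EL w z" h "\<lambda>y. g (mu y e)"]
          slice_l_apply[of "t2 c m" "\<lambda>x. f (mu x d)" "\<lambda>y. g (mu y e)"] f g h by simp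
    qed
    then have "EL w z g h = t2 c m (\<lambda>x. f (mu x d)) g"
      using slice_r_apply[of "EL w z" h g] slice_l_apply[of "t2 c m" "\<lambda>x. f (mu x d)" g] f g h by simp
    moreover have "EL w z g h = t2 c b (\<lambda>x. f (mu x d)) (\<lambda>y. EL y z g h)"
      unfolding w_def by (rule slice_l_apply) (simp_all add: f EL_lf)
    ultimately show "f (mu (slice_r sc (t2 c b) (\<lambda>y. EL y z g h)) d) = f (mu (slice_r sc (t2 c m) g) d)"
      using slice_r_apply[of "t2 c b" "\<lambda>y. EL y z g h" "\<lambda>x. f (mu x d)"]
        slice_r_apply[of "t2 c m" g "\<lambda>x. f (mu x d)"] f g by (simp add: EL_lf)
  qed
  then show ?thesis
    using slice_r_apply[of "t2 c b" "\<lambda>y. EL y z g h" f] slice_r_apply[of "t2 c m" g f] f g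
    by (simp add: EL_lf m_def)
qed

text \<open>The mirror image of \<open>E_T2_left\<close> needs no auxiliary factor in the first leg:
  the \<open>d\<close> of \<open>t2 d a\<close> already serves as the argument of the right action
  of \<open>D a\<close>.\<close>

lemma E_T2_right:
  assumes f: "lf sc f" and g: "lf sc g" and h: "lf sc h"
  shows "t2 d a f (\<lambda>y. ER y b g h) = t2 d (slice_r sc (ER a b) h) f g"
proof -
  define m where "m = slice_r sc (ER a b) h"
  define w where "w = slice_l sc f (t2 d a)"
  have "slice_r sc (ER w b) h = slice_l sc f (t2 d m)"
  proof (rule cancel_left)
    fix e g assume g: "lf sc g"
    define \<phi> where "\<phi> = (\<lambda>a. snd (D a) (ten sc d e) f g)"
    have \<phi>: "lf sc \<phi>" by (simp add: \<phi>_def D_lf)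
    have s1: "slice_l sc f (snd (D a) (ten sc d e)) = mu e w"
    proof (rule slice_l_eqI)
      fix g assume "lf sc g"
      then show "snd (D a) (ten sc d e) f g = g (mu e w)"
        using f slice_l_apply[of "t2 d a" f "\<lambda>y. g (mu e y)"] by (simp add: w_def DR_T2)
    qed (use f in simp_all)
    have "slice_l sc (\<lambda>y. g (mu e y)) (ER w b) = slice_l sc \<phi> (ER a b)"
    proof (rule cancel_left)
      fix p h assume h: "lf sc h"
      have "ER w b (\<lambda>y. g (mu e y)) (\<lambda>y. h (mu p y)) = ER (mu e w) (mu p b) g h"
        using mlt_mu_snd1[OF E_mlt g h, of e w "mu p b"]
          mlt_mu_snd2[OF E_mlt _ h, of "\<lambda>y. g (mu e y)" w p b] g by simp
      also have "\<dots> = ER a b \<phi> (\<lambda>y. h (mu p y))"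
        using E_DR_id[of f g h a d e p b] f g h s1 by (simp add: \<phi>_def)
      finally show "h (mu p (slice_l sc (\<lambda>y. g (mu e y)) (ER w b))) = h (mu p (slice_l sc \<phi> (ER a b)))"
        using slice_l_apply[of "ER w b" "\<lambda>y. g (mu e y)" "\<lambda>y. h (mu p y)"]
          slice_l_apply[of "ER a b" \<phi> "\<lambda>y. h (mu p y)"] g h \<phi> by simp
    qed
    then have "ER w b (\<lambda>y. g (mu e y)) h = ER a b \<phi> h"
      using slice_l_apply[of "ER w b" "\<lambda>y. g (mu e y)" h] slice_l_apply[of "ER a b" \<phi> h] g h \<phi> by simp
    also have "\<dots> = \<phi> m" unfolding m_def using slice_r_apply[of "ER a b" h \<phi>] h \<phi> by simp
    also have "\<dots> = t2 d m f (\<lambda>y. g (mu e y))" using f g by (simp add: \<phi>_def DR_T2)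
    finally show "g (mu e (slice_r sc (ER w b) h)) = g (mu e (slice_l sc f (t2 d m)))"
      using slice_r_apply[of "ER w b" h "\<lambda>y. g (mu e y)"]
        slice_l_apply[of "t2 d m" f "\<lambda>y. g (mu e y)"] f g h by simp
  qed
  then have "ER w b g h = t2 d m f g"
    using slice_r_apply[of "ER w b" h g] slice_l_apply[of "t2 d m" f g] f g h by simp
  moreover have "ER w b g h = t2 d a f (\<lambda>y. ER y b g h)"
    unfolding w_def by (rule slice_l_apply) (simp_all add: f ER_lf)
  ultimately show ?thesis by (simp add: m_def)
qed

text \<open>Left multiplication of the first leg by \<open>d\<close> turns T4(c \<otimes> b) into
  T2(d \<otimes> b)(c \<otimes> 1), which reduces the claim to \<open>E_T2_right\<close>.\<close>

lemma E_T4_right: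
  assumes f: "lf sc f" and g: "lf sc g" and h: "lf sc h"
  shows "t4 c b f (\<lambda>y. ER y z g h) = t4 c (slice_r sc (ER b z) h) f g"
proof -
  define m where "m = slice_r sc (ER b z) h"
  have "slice_r sc (t4 c b) (\<lambda>y. ER y z g h) = slice_r sc (t4 c m) g"
  proof (rule cancel_left)
    fix d f assume f: "lf sc f"
    have "t4 c b (\<lambda>x. f (mu d x)) (\<lambda>y. ER y z g h) = t4 c m (\<lambda>x. f (mu d x)) g"
      using E_T2_right[of "\<lambda>x. f (mu x c)" g h d b z] f g h
      by (simp add: T4_T2 ER_lf m_def)
    then show "f (mu d (slice_r sc (t4 c b) (\<lambda>y. ER y z g h))) = f (mu d (slice_r sc (t4 c m) g))"
      using slice_r_apply[of "t4 c b" "\<lambda>y. ER y z g h" "\<lambda>x. f (mu d x)"]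
        slice_r_apply[of "t4 c m" g "\<lambda>x. f (mu d x)"] f g by (simp add: ER_lf)
  qed
  then show ?thesis
    using slice_r_apply[of "t4 c b" "\<lambda>y. ER y z g h" f] slice_r_apply[of "t4 c m" g f] f g
    by (simp add: ER_lf m_def)
qed

end

section \<open>The base algebra maps\<close>

context rwmb
begin

text \<open>Axiom (vi) with \<open>c\<close> split off, using \<Delta>(a)(b \<otimes> c) = T4(b
  \<otimes> a)(1 \<otimes> c), so that \<open>c\<close> can be cancelled later.\<close>

lemma counit_E_left:
  assumes "lf sc g"
  shows "EL b c eps (\<lambda>y. g (mu a y)) = t4 b a eps (\<lambda>y. g (mu y c))"
proof -
  have "\<forall>a b c. slice_l sc eps (tmap2 sc id (mu a) (fst E (ten sc b c))) =
      slice_l sc eps (fst (D a) (ten sc b c))"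
    by (insert regular, unfold regular_wmb_def wmb_def, elim conjE, assumption)
  then have "g (slice_l sc eps (tmap2 sc id (mu a) (EL b c))) = g (slice_l sc eps (fst (D a) (ten sc b c)))"
    by simp
  then show ?thesis
    using assms slice_l_apply[of "tmap2 sc id (mu a) (EL b c)" eps g]
      slice_l_apply[of "fst (D a) (ten sc b c)" eps g]
    by (simp add: tmap2_in_T2s lop_id lop_mu tmap2_apply DL_T4)
qed

lemma counit_E_right:
  assumes "lf sc g"
  shows "ER a b eps (\<lambda>y. g (mu y c)) = t2 a c eps (\<lambda>y. g (mu b y))"
proof -
  have "\<forall>a b c. slice_l sc eps (tmap2 sc id (\<lambda>y. mu y c) (snd E (ten sc a b))) =
      slice_l sc eps (snd (D c) (ten sc a b))"
    by (insert regular, unfold regular_wmb_def wmb_def, elim conjE, assumption)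
  then have "g (slice_l sc eps (tmap2 sc id (\<lambda>y. mu y c) (ER a b))) = g (slice_l sc eps (snd (D c) (ten sc a b)))"
    by simp
  then show ?thesis
    using assms slice_l_apply[of "tmap2 sc id (\<lambda>y. mu y c) (ER a b)" eps g]
      slice_l_apply[of "snd (D c) (ten sc a b)" eps g]
    by (simp add: tmap2_in_T2s lop_id lop_mu tmap2_apply DR_T2)
qed

lemma P_fst: "lf sc f \<Longrightarrow> f (fst (P a) b) = t3 b a f eps"
  and P_snd: "lf sc f \<Longrightarrow> f (snd (P a) b) = ER b a f eps"
  and Q_fst: "lf sc f \<Longrightarrow> f (fst (Q a) b) = EL b a f eps"
  and Q_snd: "lf sc f \<Longrightarrow> f (snd (Q a) b) = t1 b a f eps"
  by (simp_all add: PiR_def PibarR_def slice_r_apply)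

text \<open>On the right, \<open>a\<close> enters only through the functional eps(a y); this is why
  such functionals determine \<open>P a\<close>.\<close>

lemma P_T2:
  assumes f: "lf sc f"
  shows "f (mu c (fst (P a) b)) = t2 c b f (\<lambda>y. eps (mu a y))"
  using P_fst[of "\<lambda>x. f (mu c x)" a b] DR_T3[of f eps b c a] DR_T2[of f eps b c a] f by simp

text \<open>The two actions are defined by different data, \<Delta> and \<open>E\<close>. Writing
  eps(a w) as (eps \<otimes> eps)(\<Delta>(a)(w \<otimes> 1)) lets axiom (vi) trade \<Delta>(a) for
  \<open>E\<close>; \<open>E_T2_left\<close> then carries \<open>E\<close> past T2, and the counit
  axiom removes T2.\<close>

lemma P_multiplier: "mu c (fst (P a) b) = mu (snd (P a) c) b"
proof (rule lf_separates)
  fix f assume f: "lf sc f"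
  define w where "w = slice_l sc f (t2 c b)"
  have w: "g w = t2 c b f g" if "lf sc g" for g
    unfolding w_def using slice_l_apply f that by simp
  have "slice_l sc eps (t4 w a) = slice_l sc (\<lambda>x. f (mu x b)) (ER c a)"
  proof (rule cancel_right)
    fix z h assume h: "lf sc h"
    let ?h = "\<lambda>y. h (mu a y)"
    have "h (mu (slice_l sc eps (t4 w a)) z) = t4 w a eps (\<lambda>y. h (mu y z))"
      using slice_l_apply[of "t4 w a" eps "\<lambda>y. h (mu y z)"] h by simp
    also have "\<dots> = EL w z eps ?h" using counit_E_left[OF h, of w z a] by simp
    also have "\<dots> = t2 c b f (\<lambda>y. EL y z eps ?h)" by (rule w) (rule EL_lf)
    also have "\<dots> = t2 c (slice_r sc (EL b z) ?h) f eps" using E_T2_left[OF f eps_lf, of ?h] h by simp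
    also have "\<dots> = f (mu c (slice_r sc (EL b z) ?h))" using f by (rule counit2)
    also have "\<dots> = EL b z (\<lambda>x. f (mu c x)) ?h"
      using slice_r_apply[of "EL b z" ?h "\<lambda>x. f (mu c x)"] f h by simp
    also have "\<dots> = ER c a (\<lambda>x. f (mu x b)) (\<lambda>y. h (mu y z))"
      using mlt_adjoint_ten[OF E_mlt f h] by simp
    also have "\<dots> = h (mu (slice_l sc (\<lambda>x. f (mu x b)) (ER c a)) z)"
      using slice_l_apply[of "ER c a" "\<lambda>x. f (mu x b)" "\<lambda>y. h (mu y z)"] f h by simp
    finally show "h (mu (slice_l sc eps (t4 w a)) z) = h (mu (slice_l sc (\<lambda>x. f (mu x b)) (ER c a)) z)" .
  qed
  \<comment> \<open>Only now, with \<open>z\<close> cancelled, is \<open>eps\<close> applied to the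
    second leg; \<open>counit4\<close> then identifies the left side with
    \<open>eps (mu a w)\<close>.\<close>
  then have "t4 w a eps eps = ER c a (\<lambda>x. f (mu x b)) eps"
    using slice_l_apply[of "t4 w a" eps eps] slice_l_apply[of "ER c a" "\<lambda>x. f (mu x b)" eps] f by simp
  then have "t2 c b f (\<lambda>y. eps (mu a y)) = ER c a (\<lambda>x. f (mu x b)) eps"
    using w[of "\<lambda>y. eps (mu a y)"] by (simp add: counit4)
  then show "f (mu c (fst (P a) b)) = f (mu (snd (P a) c) b)"
    using P_T2[OF f] P_snd[of "\<lambda>x. f (mu x b)" a c] f by simp
qed

lemma Q_multiplier: "mu c (fst (Q a) b) = mu (snd (Q a) c) b"
proof (rule lf_separates)
  fix f assume f: "lf sc f"
  define w where "w = slice_l sc f (t4 b c)"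
  have w: "g w = t4 b c f g" if "lf sc g" for g
    unfolding w_def using slice_l_apply f that by simp
  have "slice_l sc eps (t2 w a) = slice_l sc (\<lambda>x. f (mu c x)) (EL b a)"
  proof (rule cancel_left)
    fix z h assume h: "lf sc h"
    let ?h = "\<lambda>y. h (mu y a)"
    have "h (mu z (slice_l sc eps (t2 w a))) = t2 w a eps (\<lambda>y. h (mu z y))"
      using slice_l_apply[of "t2 w a" eps "\<lambda>y. h (mu z y)"] h by simp
    also have "\<dots> = ER w z eps ?h" using counit_E_right[OF h, of w z a] by simp
    also have "\<dots> = t4 b c f (\<lambda>y. ER y z eps ?h)" by (rule w) (rule ER_lf)
    also have "\<dots> = t4 b (slice_r sc (ER c z) ?h) f eps" using E_T4_right[OF f eps_lf, of ?h] h by simp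
    also have "\<dots> = f (mu (slice_r sc (ER c z) ?h) b)" using f by (rule counit4)
    also have "\<dots> = ER c z (\<lambda>x. f (mu x b)) ?h"
      using slice_r_apply[of "ER c z" ?h "\<lambda>x. f (mu x b)"] f h by simp
    also have "\<dots> = EL b a (\<lambda>x. f (mu c x)) (\<lambda>y. h (mu z y))"
      using mlt_adjoint_ten[OF E_mlt f h] by simp
    also have "\<dots> = h (mu z (slice_l sc (\<lambda>x. f (mu c x)) (EL b a)))"
      using slice_l_apply[of "EL b a" "\<lambda>x. f (mu c x)" "\<lambda>y. h (mu z y)"] f h by simp
    finally show "h (mu z (slice_l sc eps (t2 w a))) = h (mu z (slice_l sc (\<lambda>x. f (mu c x)) (EL b a)))" .
  qed
  then have "t2 w a eps eps = EL b a (\<lambda>x. f (mu c x)) eps"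
    using slice_l_apply[of "t2 w a" eps eps] slice_l_apply[of "EL b a" "\<lambda>x. f (mu c x)" eps] f by simp
  then have "t4 b c f (\<lambda>y. eps (mu y a)) = EL b a (\<lambda>x. f (mu c x)) eps"
    using w[of "\<lambda>y. eps (mu y a)"] by (simp add: counit2)
  moreover have "t4 b c f (\<lambda>y. eps (mu y a)) = t1 c a (\<lambda>x. f (mu x b)) eps"
    using DL_T4[of f eps c b a] DL_T1[of f eps c b a] f by simp
  ultimately show "f (mu c (fst (Q a) b)) = f (mu (snd (Q a) c) b)"
    using Q_fst[of "\<lambda>x. f (mu c x)" a b] Q_snd[of "\<lambda>x. f (mu x b)" a c] f by simp
qed

lemma eps_P: "eps (fst (P a) b) = eps (mu a b)"
  using P_fst[of eps a b] counit3[of eps b a] by simp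

lemma eps_Q: "eps (snd (Q c) x) = eps (mu x c)"
  using Q_snd[of eps c x] counit1[of eps x c] by simp

text \<open>Multipliers of \<open>A\<close> are compared as pairs of functions; by non-degeneracy
  the left action fixes the right one.\<close>

lemma multiplier_eqI:
  assumes "\<And>c b. mu c (fst m b) = mu (snd m c) b" "\<And>c b. mu c (fst n b) = mu (snd n c) b"
    and "\<And>b. fst m b = fst n b"
  shows "m = n"
proof -
  have "snd m c = snd n c" for c
    by (rule cancel_right) (metis assms)
  then show ?thesis using assms(3) by (auto simp: prod_eq_iff fun_eq_iff)
qed

lemma P_eqI:
  assumes "\<And>b. eps (mu a b) = eps (mu a' b)"
  shows "P a = P a'"
proof (rule multiplier_eqI)
  show "fst (P a) b = fst (P a') b" for b
    by (rule cancel_left) (simp add: P_T2 assms)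
qed (rule P_multiplier)+

lemma P_eqD: "P a = P a' \<Longrightarrow> eps (mu a b) = eps (mu a' b)"
  by (metis eps_P)

text \<open>Made for \<open>fst (P a)\<close>: after multiplication by \<open>c\<close> its values
  become \<open>mu (snd (P a) c) x\<close>, which are visibly linear in \<open>x\<close>.\<close>

lemma lop_mu_determined:
  assumes "\<And>c f. lf sc f \<Longrightarrow> lf sc (\<lambda>x. f (mu c (\<phi> x)))"
  shows "lop sc \<phi>"
proof -
  have "\<phi> (x + y) = \<phi> x + \<phi> y" for x y
    by (rule cancel_left) (use lf_add[OF assms] in \<open>simp add: lf_add mu_add_right\<close>)
  moreover have "\<phi> (sc r x) = sc r (\<phi> x)" for r x
    by (rule cancel_left) (use lf_scale[OF assms] in \<open>simp add: lf_scale mu_scale_right\<close>)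
  ultimately show ?thesis by (simp add: lop_def)
qed

lemma P_lop: "lop sc (fst (P a))" "lop sc (snd (P a))"
proof -
  show "lop sc (fst (P a))"
    by (rule lop_mu_determined) (simp add: P_multiplier)
  show "lop sc (snd (P a))"
    unfolding lop_def
    by (intro conjI allI; rule lf_separates)
       (simp_all add: P_snd lf_add lf_scale lf_add[OF ER_lf(1)] lf_scale[OF ER_lf(1)])
qed

lemma P_mod: "snd (P a) (mu x y) = mu x (snd (P a) y)"
  by (rule cancel_right) (simp add: P_multiplier[symmetric] assoc)

lemma Q_mod: "snd (Q a) (mu x y) = mu x (snd (Q a) y)"
  by (rule cancel_right) (simp add: Q_multiplier[symmetric] assoc)

lemma P_add: "P (a + a') = P a + P a'"
proof (rule multiplier_eqI)
  have s: "snd (P (a + a')) c = snd (P a) c + snd (P a') c" for c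
    by (rule lf_separates) (simp add: P_snd lf_add lf_add[OF ER_lf(2)])
  show m: "mu c (fst (P (a + a')) b) = mu (snd (P (a + a')) c) b" for c b by (rule P_multiplier)
  show "mu c (fst (P a + P a') b) = mu (snd (P a + P a') c) b" for c b
    by (simp add: P_multiplier mu_add_left mu_add_right)
  show "fst (P (a + a')) b = fst (P a + P a') b" for b
    by (rule cancel_left) (simp add: m s mu_add_left mu_add_right P_multiplier)
qed

lemma P_scale: "P (sc r a) = scM sc r (P a)"
proof (rule multiplier_eqI)
  have s: "snd (P (sc r a)) c = sc r (snd (P a) c)" for c
    by (rule lf_separates) (simp add: P_snd lf_scale lf_scale[OF ER_lf(2)])
  show m: "mu c (fst (P (sc r a)) b) = mu (snd (P (sc r a)) c) b" for c b by (rule P_multiplier)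
  show "mu c (fst (scM sc r (P a)) b) = mu (snd (scM sc r (P a)) c) b" for c b
    by (simp add: scM_def P_multiplier mu_scale_left mu_scale_right)
  show "fst (P (sc r a)) b = fst (scM sc r (P a)) b" for b
    by (rule cancel_left) (simp add: scM_def m s mu_scale_left mu_scale_right P_multiplier)
qed

lemma Q_add: "Q (a + a') = Q a + Q a'"
proof (rule multiplier_eqI)
  have s: "fst (Q (a + a')) c = fst (Q a) c + fst (Q a') c" for c
    by (rule lf_separates) (simp add: Q_fst lf_add lf_add[OF EL_lf(2)])
  show "mu c (fst (Q (a + a')) b) = mu (snd (Q (a + a')) c) b" for c b by (rule Q_multiplier)
  show "mu c (fst (Q a + Q a') b) = mu (snd (Q a + Q a') c) b" for c b
    by (simp add: Q_multiplier mu_add_left mu_add_right)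
  show "fst (Q (a + a')) b = fst (Q a + Q a') b" for b by (simp add: s)
qed

lemma Q_scale: "Q (sc r a) = scM sc r (Q a)"
proof (rule multiplier_eqI)
  have s: "fst (Q (sc r a)) c = sc r (fst (Q a) c)" for c
    by (rule lf_separates) (simp add: Q_fst lf_scale lf_scale[OF EL_lf(2)])
  show "mu c (fst (Q (sc r a)) b) = mu (snd (Q (sc r a)) c) b" for c b by (rule Q_multiplier)
  show "mu c (fst (scM sc r (Q a)) b) = mu (snd (scM sc r (Q a)) c) b" for c b
    by (simp add: scM_def Q_multiplier mu_scale_left mu_scale_right)
  show "fst (Q (sc r a)) b = fst (scM sc r (Q a)) b" for b by (simp add: s scM_def)
qed

text \<open>\<open>E_T1\<close> concerns the right action of \<open>E\<close> and
  \<open>E_T3\<close> the left one; the two halves meet through the multiplier law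
  \<open>mlt_adjoint_ten\<close>.\<close>

lemma P_slice_T1:
  assumes h: "lf sc h"
  shows "P (slice_r sc (t1 p q) h) = Q (slice_r sc (t3 q p) h)"
proof (rule multiplier_eqI)
  let ?y = "slice_r sc (t1 p q) h" and ?c = "slice_r sc (t3 q p) h"
  show "mu c (fst (P ?y) b) = mu (snd (P ?y) c) b" "mu c (fst (Q ?c) b) = mu (snd (Q ?c) c) b" for c b
    by (rule P_multiplier Q_multiplier)+
  have "mu c (fst (P ?y) b) = mu c (fst (Q ?c) b)" for b c
  proof (rule lf_separates)
    fix f assume f: "lf sc f"
    have "f (mu (snd (P ?y) c) b) = ER c ?y (\<lambda>x. f (mu x b)) eps"
      using P_snd[of "\<lambda>x. f (mu x b)" ?y c] f by simp
    also have "\<dots> = t1 p q (\<lambda>x. ER c x (\<lambda>x. f (mu x b)) eps) h"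
      by (rule slice_r_apply) (simp_all add: h ER_lf)
    also have "\<dots> = ER c p (\<lambda>x. f (mu x b)) (\<lambda>y. h (mu y q))"
      using E_T1[of "\<lambda>x. f (mu x b)" h] f h by simp
    also have "\<dots> = EL b q (\<lambda>x. f (mu c x)) (\<lambda>y. h (mu p y))"
      using mlt_adjoint_ten[OF E_mlt f h] by simp
    also have "\<dots> = t3 q p (\<lambda>x. EL b x (\<lambda>x. f (mu c x)) eps) h"
      using E_T3[of "\<lambda>x. f (mu c x)" h] f h by simp
    also have "\<dots> = EL b ?c (\<lambda>x. f (mu c x)) eps"
      by (rule slice_r_apply[symmetric]) (simp_all add: h EL_lf)
    also have "\<dots> = f (mu c (fst (Q ?c) b))"
      using Q_fst[of "\<lambda>x. f (mu c x)" ?c b] f by simp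
    finally show "f (mu c (fst (P ?y) b)) = f (mu c (fst (Q ?c) b))" by (simp add: P_multiplier)
  qed
  then show "fst (P ?y) b = fst (Q ?c) b" for b
    by (intro cancel_left) simp
qed

text \<open>\<open>E_T2_left\<close> with \<open>eps\<close> on the third leg: slicing E(b \<otimes>
  z) there by \<open>eps\<close> gives Q(z)b.\<close>

lemma T2_Q: assumes "lf sc f" "lf sc g" shows "t2 c (fst (Q z) b) f g = t2 c b f (\<lambda>y. g (fst (Q z) y))"
proof -
  have "slice_r sc (EL b z) eps = fst (Q z) b" by (simp add: PibarR_def)
  then show ?thesis using E_T2_left[OF assms eps_lf, of c b z] assms by (simp add: Q_fst)
qed

lemma T2_P: assumes "lf sc f" "lf sc g" shows "t2 d (snd (P z) a) f g = t2 d a f (\<lambda>y. g (snd (P z) y))"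
proof -
  have "slice_r sc (ER a z) eps = snd (P z) a" by (simp add: PiR_def)
  then show ?thesis using E_T2_right[OF assms eps_lf, of d a z] assms by (simp add: P_snd)
qed

text \<open>P(w Q(z)) = P(w) Q(z). In \<open>P_T2\<close> the functional eps(w Q(z) y) lets Q(z) act
  on the second leg of T2, and \<open>T2_Q\<close> moves it into the argument.\<close>

lemma P_Q_fst: "fst (P (snd (Q z) w)) b = fst (P w) (fst (Q z) b)"
proof (rule cancel_left)
  fix c f assume f: "lf sc f"
  have "f (mu c (fst (P (snd (Q z) w)) b)) = t2 c b f (\<lambda>y. eps (mu w (fst (Q z) y)))"
    using f by (simp add: P_T2 Q_multiplier)
  also have "\<dots> = t2 c (fst (Q z) b) f (\<lambda>y. eps (mu w y))"
    using T2_Q[OF f, of "\<lambda>y. eps (mu w y)" c z b] by simp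
  also have "\<dots> = f (mu c (fst (P w) (fst (Q z) b)))" using f by (simp add: P_T2)
  finally show "f (mu c (fst (P (snd (Q z) w)) b)) = f (mu c (fst (P w) (fst (Q z) b)))" .
qed

lemma P_Q_snd: "snd (P (snd (Q z) w)) c = snd (Q z) (snd (P w) c)"
proof (rule cancel_right)
  fix b f
  show "f (mu (snd (P (snd (Q z) w)) c) b) = f (mu (snd (Q z) (snd (P w) c)) b)"
    by (simp add: P_multiplier[symmetric] Q_multiplier[symmetric] P_Q_fst)
qed

text \<open>Testing the second leg of T2 with y \<mapsto> eps(y z) amounts to right multiplication
  by Q(z), which \<open>P\<close> respects by \<open>P_Q_snd\<close>.\<close>

lemma T2_eps_right:
  assumes f: "lf sc f"
  shows "t2 c w f (\<lambda>y. eps (mu y z)) = f (mu c (snd (Q z) w))"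
  using T1_T2[OF f eps_lf, of w z c] Q_snd[of "\<lambda>x. f (mu c x)" z w] f by simp

text \<open>(1 \<otimes> c)T2(a \<otimes> b) = (a \<otimes> c)\<Delta>(b) absorbs \<open>E\<close>
  from the right, and \<open>c\<close> cancels.\<close>

lemma E_mult_T2: "snd E (t2 a b) = t2 a b"
proof -
  have tm: "snd E (tmap2 sc id (mu c) t) = tmap2 sc id (mu c) (snd E t)" if t: "t \<in> T2s sc" for t c
  proof -
    obtain xs where xs: "t = ten2 sc xs" using t by (auto elim: T2s_E)
    have "snd E (tmap2 sc id (mu c) (ten2 sc xs)) = tmap2 sc id (mu c) (snd E (ten2 sc xs))"
    proof (induction xs)
      case Nil
      then show ?case by (simp add: ten2_Nil tmap2_zero mlt_zero[OF E_mlt])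
    next
      case (Cons z xs)
      obtain x y where z: "z = (x,y)" by (cases z)
      have *: "snd E (tmap2 sc id (mu c) (ten sc x y)) = tmap2 sc id (mu c) (snd E (ten sc x y))"
        using mlt_snd_tmap2[OF E_mlt lop_id(1) lop_mu(1)[of c], of x y]
        by (simp add: tmap2_ten lop_id lop_mu assoc)
      have "snd E (tmap2 sc id (mu c) (ten sc x y) + tmap2 sc id (mu c) (ten2 sc xs)) =
          snd E (tmap2 sc id (mu c) (ten sc x y)) + snd E (tmap2 sc id (mu c) (ten2 sc xs))"
        by (rule mlt_add[OF E_mlt]) (intro tmap2_in_T2s lop_id lop_mu ten_in_T2s ten2_in_T2s)+
      moreover have "snd E (ten sc x y + ten2 sc xs) = ER x y + snd E (ten2 sc xs)"
        by (rule mlt_add[OF E_mlt]) simp_all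
      ultimately show ?case unfolding z ten2_Cons by (simp only: tmap2_add * Cons.IH)
    qed
    then show ?thesis by (simp add: xs)
  qed
  have *: "tmap2 sc id (mu c) (t2 a b) = snd (D b) (ten sc a c)" for c
    by (rule T2s_eqI[of _ sc]) (simp_all add: tmap2_in_T2s lop_id lop_mu tmap2_apply DR_T2)
  have "tmap2 sc id (mu c) (snd E (t2 a b)) = tmap2 sc id (mu c) (t2 a b)" for c
    using tm[of "t2 a b" c] by (simp add: * E_DR)
  note ** = this
  have ***: "snd E (t2 a b) f (\<lambda>y. g (mu c y)) = t2 a b f (\<lambda>y. g (mu c y))"
    if "lf sc f" "lf sc g" for f g c
    using that fun_cong[OF fun_cong[OF **[of c]], of f g] by (simp add: tmap2_apply)
  show ?thesis
  proof (rule T2s_eqI[of _ sc])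
    show "snd E (t2 a b) f g = t2 a b f g" if f: "lf sc f" "lf sc g" for f g
      by (rule cancel_mu_left2[of "snd E (t2 a b)" "t2 a b" f, OF _ _ f(1) ***])
         (simp_all add: f mlt_closed[OF E_mlt])
  qed (simp_all add: mlt_closed[OF E_mlt])
qed

end

locale full_rwmb = rwmb +
  assumes full: "right_full_comult sc mu D"
begin

lemma P_in_range_Q: "\<exists>c. P y = Q c"
proof -
  have "y \<in> span {slice_r sc (t1 a b) \<omega> | a b \<omega>. lf sc \<omega>}"
    using full unfolding right_full_comult_def by simp
  then show ?thesis
  proof (induction rule: span_induct_alt)
    case base
    have "P 0 = 0" "Q 0 = 0" using P_add[of 0 0] Q_add[of 0 0] by simp_all
    then show ?case by metis
  next
    case (step c x y)
    then obtain a b \<omega> c' where "x = slice_r sc (t1 a b) \<omega>" "lf sc \<omega>" "P y = Q c'" by blast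
    then have "P (sc c x + y) = Q (sc c (slice_r sc (t3 b a) \<omega>) + c')"
      by (simp add: P_add P_scale Q_add Q_scale P_slice_T1)
    then show ?case by blast
  qed
qed

lemma P_P_snd: "snd (P (snd (P z) w)) c = snd (P z) (snd (P w) c)"
  using P_in_range_Q[of z] P_Q_snd by metis

text \<open>Writing P(y) = Q(c), the value is eps(x c), and this depends on \<open>x\<close> only
  through P(x).\<close>

lemma eps_snd_P_cong:
  assumes "P x = P x'" shows "eps (snd (P y) x) = eps (snd (P y) x')"
proof -
  obtain c where "P y = Q c" using P_in_range_Q by blast
  then show ?thesis using P_eqD[OF assms] by (simp add: eps_Q)
qed

end

section \<open>The base coalgebra\<close>

locale rwmb_F = full_rwmb sc mu E D eps
  for sc :: "'k::field \<Rightarrow> 'a::ab_group_add \<Rightarrow> 'a" and mu and E and D and eps +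
  fixes F :: "('k,'a) form2 mltp"
  assumes is_F: "is_F sc mu E D eps F"
begin

abbreviation R where "R \<equiv> range P"

text \<open>Tensors over R are forms on functionals of the whole space of pairs of maps, so this
  larger space has to carry the vector space structure.\<close>

sublocale M: vector_space "scM sc"
  by (rule vector_space_scM) (rule vector_space_axioms)

lemma F_mlt: "mlt F"
  using is_F unfolding is_F_def by blast

lemma F_snd: "snd F (ten sc (mu a b) c) = tmap2 sc id (\<lambda>y. snd (P y) c) (t2 a b)"
  using is_F unfolding is_F_def by blast

lemma P_arg_lf: "lf (scM sc) f \<Longrightarrow> lf sc (\<lambda>a. f (P a))"
  by (subst lf_def) (simp add: P_add P_scale lf_add lf_scale)

lemma P_arg_lop: "lop sc (\<lambda>y. snd (P y) c)"
  by (simp add: lop_def P_add P_scale) (simp add: scM_def)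

lemma lf_P_arg: "lf sc f \<Longrightarrow> lf sc (\<lambda>y. f (snd (P y) c))"
  by (rule lf_lop[OF _ P_arg_lop])

lemma lf_P: "lf sc f \<Longrightarrow> lf sc (\<lambda>y. f (snd (P c) y))" "lf sc f \<Longrightarrow> lf sc (\<lambda>y. f (fst (P c) y))"
  by (rule lf_lop[OF _ P_lop(2)], assumption) (rule lf_lop[OF _ P_lop(1)])

text \<open>With the first leg frozen, the second is an element. Elements that agree under all y
  \<mapsto> eps(y z) have the same image under \<open>P\<close> by \<open>P_eqI\<close>.\<close>

lemma form_P_cong:
  assumes "s \<in> T2s sc" "t \<in> T2s sc" "lf sc f" "lf sc f'"
    and eq: "\<And>z. s f (\<lambda>y. eps (mu y z)) = t f' (\<lambda>y. eps (mu y z))"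
    and g: "lf sc g"
  shows "s f (\<lambda>v. g (snd (P v) c)) = t f' (\<lambda>v. g (snd (P v) c))"
proof -
  have "P (slice_l sc f s) = P (slice_l sc f' t)"
  proof (rule P_eqI)
    fix z show "eps (mu (slice_l sc f s) z) = eps (mu (slice_l sc f' t) z)"
      using slice_l_apply[of s f "\<lambda>y. eps (mu y z)"] slice_l_apply[of t f' "\<lambda>y. eps (mu y z)"] assms
      by simp
  qed
  then show ?thesis
    using slice_l_apply[of s f "\<lambda>v. g (snd (P v) c)"] slice_l_apply[of t f' "\<lambda>v. g (snd (P v) c)"] assms
    by (simp add: lf_P_arg)
qed

text \<open>The argument is a product because \<open>F\<close> is known only there. Its value
  carries \<open>P\<close> on the second leg, so \<open>form_P_cong\<close> applies, and the tested
  identity is P(a b Q(z)) = P(a b) Q(z).\<close>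

lemma F_P_left_product:
  assumes f: "lf sc f" and g: "lf sc g"
  shows "snd F (ten sc (snd (P (mu a b)) (mu x y)) c) f g =
    t2 a b (\<lambda>u. f (snd (P u) (mu x y))) (\<lambda>v. g (snd (P v) c))"
proof -
  have "snd F (ten sc (snd (P (mu a b)) (mu x y)) c) f g =
      t2 x (snd (P (mu a b)) y) f (\<lambda>v. g (snd (P v) c))"
    using f g by (simp add: P_mod F_snd tmap2_apply)
  also have "\<dots> = t2 a b (\<lambda>u. f (snd (P u) (mu x y))) (\<lambda>v. g (snd (P v) c))"
  proof (rule form_P_cong[of _ "t2 a b" f "\<lambda>u. f (snd (P u) (mu x y))"])
    fix z
    have "t2 a b (\<lambda>u. f (snd (P u) (mu x y))) (\<lambda>y. eps (mu y z)) =
        f (snd (P (snd (Q z) (mu a b))) (mu x y))"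
      using T2_eps_right[OF lf_P_arg[OF f, of "mu x y"], of a b z] by (simp add: Q_mod)
    also have "\<dots> = f (mu x (snd (Q z) (snd (P (mu a b)) y)))"
      unfolding P_Q_snd by (simp only: P_mod Q_mod)
    also have "\<dots> = t2 x (snd (P (mu a b)) y) f (\<lambda>y. eps (mu y z))"
      using T2_eps_right[OF f] by simp
    finally show "t2 x (snd (P (mu a b)) y) f (\<lambda>y. eps (mu y z)) =
        t2 a b (\<lambda>u. f (snd (P u) (mu x y))) (\<lambda>y. eps (mu y z))" by simp
  qed (use f g in \<open>simp_all add: lf_P_arg\<close>)
  finally show ?thesis .
qed

lemma F_P_left:
  assumes f: "lf sc f" and g: "lf sc g"
  shows "snd F (ten sc (snd (P (mu a b)) x) c) f g =
    t2 a b (\<lambda>u. f (snd (P u) x)) (\<lambda>v. g (snd (P v) c))"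
proof (rule lf_eq_on_products[of "\<lambda>x. snd F (ten sc (snd (P (mu a b)) x) c) f g"
      "\<lambda>x. t2 a b (\<lambda>u. f (snd (P u) x)) (\<lambda>v. g (snd (P v) c))" x])
  show "lf sc (\<lambda>x. snd F (ten sc (snd (P (mu a b)) x) c) f g)"
    by (rule lf_P(1)[OF lf_mlt_left(2)[OF F_mlt]])
  \<comment> \<open>Linearity in \<open>x\<close> becomes visible once the second leg is frozen:
    what remains is a single multiplier \<open>P\<close> of a slice acting on
    \<open>x\<close>.\<close>
  have "t2 a b (\<lambda>u. f (snd (P u) x)) (\<lambda>v. g (snd (P v) c)) =
      f (snd (P (slice_r sc (t2 a b) (\<lambda>v. g (snd (P v) c)))) x)" for x
    using slice_r_apply[of "t2 a b" "\<lambda>v. g (snd (P v) c)" "\<lambda>u. f (snd (P u) x)"] f g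
    by (simp add: lf_P_arg)
  then show "lf sc (\<lambda>x. t2 a b (\<lambda>u. f (snd (P u) x)) (\<lambda>v. g (snd (P v) c)))"
    using f by (simp add: lf_P)
qed (rule F_P_left_product[OF f g])

text \<open>On a product x y the right action of \<open>F\<close> is T2 followed by \<open>P\<close>
  on the second leg. \<open>T2_P\<close> transports P(w) from \<open>y\<close> to that leg, and
  \<open>P_P_snd\<close> pulls it out of the outer \<open>P\<close>.\<close>

lemma F_P_comm:
  assumes f: "lf sc f" and g: "lf sc g"
  shows "snd F (ten sc (snd (P w) x) c) f g = snd F (ten sc x c) f (\<lambda>v. g (snd (P w) v))"
proof (rule lf_eq_on_products[of "\<lambda>x. snd F (ten sc (snd (P w) x) c) f g"
      "\<lambda>x. snd F (ten sc x c) f (\<lambda>v. g (snd (P w) v))" x])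
  show "lf sc (\<lambda>x. snd F (ten sc (snd (P w) x) c) f g)"
    by (rule lf_P(1)[OF lf_mlt_left(2)[OF F_mlt]])
  show "lf sc (\<lambda>x. snd F (ten sc x c) f (\<lambda>v. g (snd (P w) v)))"
    by (rule lf_mlt_left[OF F_mlt])
  show "snd F (ten sc (snd (P w) (mu x y)) c) f g = snd F (ten sc (mu x y) c) f (\<lambda>v. g (snd (P w) v))" for x y
    using T2_P[OF f, of "\<lambda>v. g (snd (P v) c)" x w y] f g
    by (simp add: P_mod F_snd tmap2_apply lf_P_arg lf_P P_P_snd)
qed

text \<open>For \<open>w = \<Sum> a b\<close>, the tensor \<open>\<Sum> (a \<otimes> 1) \<Delta>(b)\<close> is a preimage of \<open>\<delta> (P w)\<close> under \<open>P \<otimes> P\<close>.\<close>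

definition lifts :: "'a \<Rightarrow> ('k,'a) form2 \<Rightarrow> bool" where
  "lifts w t \<longleftrightarrow> t \<in> T2s sc \<and> snd E t = t \<and> (\<forall>f. lf sc f \<longrightarrow> t f eps = f w) \<and>
    (\<forall>z. t eps (\<lambda>y. eps (mu y z)) = eps (mu w z)) \<and>
    (\<forall>x c f g. lf sc f \<longrightarrow> lf sc g \<longrightarrow>
      snd F (ten sc (snd (P w) x) c) f g = t (\<lambda>u. f (snd (P u) x)) (\<lambda>v. g (snd (P v) c)))"

lemma lifts_mu: "lifts (mu a b) (t2 a b)"
  unfolding lifts_def
proof (intro conjI allI impI)
  show "t2 a b eps (\<lambda>y. eps (mu y z)) = eps (mu (mu a b) z)" for z
    using T2_eps_right[OF eps_lf, of a b z] by (simp add: Q_mod[symmetric] eps_Q)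
qed (simp_all add: E_mult_T2 counit2 F_P_left)

lemma lifts_add: assumes "lifts w s" "lifts w' t" shows "lifts (w + w') (s + t)"
proof -
  have st: "s \<in> T2s sc" "t \<in> T2s sc" using assms by (auto simp: lifts_def)
  have "snd E (s + t) = s + t"
    using assms by (simp add: mlt_add(2)[OF E_mlt st] lifts_def)
  moreover have "snd F (ten sc (snd (P (w + w')) x) c) f g =
      (s + t) (\<lambda>u. f (snd (P u) x)) (\<lambda>v. g (snd (P v) c))" if "lf sc f" "lf sc g" for x c f g
    using assms that by (simp add: P_add ten_add_left mlt_add[OF F_mlt] lifts_def)
  ultimately show ?thesis
    using assms unfolding lifts_def by (auto simp: lf_add[OF eps_lf] lf_add mu_add_left)
qed

lemma lifts_zero: "lifts 0 0"
proof -
  have "P 0 = 0" using P_add[of 0 0] by simp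
  moreover have "ten sc 0 c = 0" for c using ten_add_left[of 0 0 c] by simp
  moreover have "mu 0 z = 0" for z using mu_add_left[of 0 0 z] by simp
  moreover have "snd E 0 = 0" by (rule mlt_zero[OF E_mlt])
  moreover have "snd F 0 = 0" by (rule mlt_zero[OF F_mlt])
  ultimately show ?thesis
    unfolding lifts_def by (intro conjI allI impI T2s_zero) (simp_all add: lf_zero lf_zero[OF eps_lf])
qed

text \<open>A general \<open>w\<close> is only a sum of products. All properties demanded of a lift
  are additive in the pair (w, t), so lifts of the products add up.\<close>

lemma lifts_exists: "\<exists>zs. lifts w (ten2 sc zs)"
proof -
  obtain xs where xs: "w = (\<Sum>(x,y)\<leftarrow>xs. mu x y)" using idem by blast
  have "\<exists>t. lifts (\<Sum>(x,y)\<leftarrow>xs. mu x y) t"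
  proof (induction xs)
    case Nil
    show ?case using lifts_zero by auto
  next
    case (Cons z xs)
    then show ?case using lifts_add[OF lifts_mu] by (cases z) (simp, blast)
  qed
  then obtain t where t: "lifts w t" unfolding xs by blast
  then obtain zs where "t = ten2 sc zs" unfolding lifts_def by (auto elim: T2s_E)
  with t show ?thesis by blast
qed

section \<open>The subspace R and tensors over it\<close>

lemma R_multiplier: "r \<in> R \<Longrightarrow> mu x (fst r y) = mu (snd r x) y"
  and R_lop: "r \<in> R \<Longrightarrow> lop sc (fst r)" "r \<in> R \<Longrightarrow> lop sc (snd r)"
  using P_multiplier P_lop by blast+

lemma R_zero: "0 \<in> R"
proof -
  have "P 0 = 0" using P_add[of 0 0] by simp
  then show ?thesis by (metis rangeI)
qed

lemma R_add: "r \<in> R \<Longrightarrow> s \<in> R \<Longrightarrow> r + s \<in> R"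
  by (auto simp: P_add[symmetric])

lemma R_scale: "r \<in> R \<Longrightarrow> scM sc c r \<in> R"
  by (auto simp: P_scale[symmetric])

lemma R_sum_list: "(\<And>x. x \<in> set xs \<Longrightarrow> h x \<in> R) \<Longrightarrow> (\<Sum>x\<leftarrow>xs. h x) \<in> R"
  by (induction xs) (simp_all add: R_zero R_add)

lemma R_eqI:
  assumes "r \<in> R" "s \<in> R" "\<And>b. fst r b = fst s b" shows "r = s"
  using multiplier_eqI[of r s] R_multiplier assms by blast

text \<open>Elements of \<open>R\<close> are determined by their left action, so identities between linear functionals
  on \<open>R\<close> may be tested on the functionals \<open>r \<mapsto> \<phi> (r a)\<close>.\<close>

lemma R_functional_eq:
  assumes R: "\<And>x. x \<in> set xs \<Longrightarrow> u x \<in> R" "\<And>x. x \<in> set ys \<Longrightarrow> v x \<in> R"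
    and eq: "\<And>\<phi> a. lf sc \<phi> \<Longrightarrow> (\<Sum>x\<leftarrow>xs. s x * \<phi> (fst (u x) a)) = (\<Sum>x\<leftarrow>ys. t x * \<phi> (fst (v x) a))"
    and f: "lf (scM sc) f"
  shows "(\<Sum>x\<leftarrow>xs. s x * f (u x)) = (\<Sum>x\<leftarrow>ys. t x * f (v x))"
proof -
  have ev: "g (\<Sum>x\<leftarrow>zs. scM sc (k x) (w x)) = (\<Sum>x\<leftarrow>zs. k x * g (w x))" if "lf (scM sc) g" for g zs k w
    using that by (simp add: lf_sum_list lf_scale)
  have "(\<Sum>x\<leftarrow>xs. scM sc (s x) (u x)) = (\<Sum>x\<leftarrow>ys. scM sc (t x) (v x))"
  proof (rule R_eqI)
    fix a show "fst (\<Sum>x\<leftarrow>xs. scM sc (s x) (u x)) a = fst (\<Sum>x\<leftarrow>ys. scM sc (t x) (v x)) a"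
    proof (rule lf_separates)
      fix \<phi> assume \<phi>: "lf sc \<phi>"
      show "\<phi> (fst (\<Sum>x\<leftarrow>xs. scM sc (s x) (u x)) a) = \<phi> (fst (\<Sum>x\<leftarrow>ys. scM sc (t x) (v x)) a)"
        unfolding ev[OF lf_fst[OF \<phi>]] by (rule eq[OF \<phi>])
    qed
  qed (auto intro!: R_sum_list R_scale R)
  then have "f (\<Sum>x\<leftarrow>xs. scM sc (s x) (u x)) = f (\<Sum>x\<leftarrow>ys. scM sc (t x) (v x))" by simp
  then show ?thesis unfolding ev[OF f] .
qed

text \<open>This is the injectivity of R \<otimes> R into the multipliers of A \<otimes> A;
  evaluations are upgraded to arbitrary functionals one leg at a time.\<close>

lemma ten2_R_eqI:
  assumes xs: "set xs \<subseteq> R \<times> R" and ys: "set ys \<subseteq> R \<times> R"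
    and eq: "\<And>\<phi> \<psi> a b. lf sc \<phi> \<Longrightarrow> lf sc \<psi> \<Longrightarrow>
      ten2 (scM sc) xs (\<lambda>p. \<phi> (fst p a)) (\<lambda>q. \<psi> (fst q b)) =
      ten2 (scM sc) ys (\<lambda>p. \<phi> (fst p a)) (\<lambda>q. \<psi> (fst q b))"
  shows "ten2 (scM sc) xs = ten2 (scM sc) ys"
proof (rule T2s_eqI[of _ "scM sc"])
  fix f g assume f: "lf (scM sc) f" and g: "lf (scM sc) g"
  have 1: "(\<Sum>z\<leftarrow>xs. \<phi> (fst (fst z) a) * g (snd z)) = (\<Sum>z\<leftarrow>ys. \<phi> (fst (fst z) a) * g (snd z))"
    if \<phi>: "lf sc \<phi>" for \<phi> a
  proof (rule R_functional_eq[OF _ _ _ g])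
    fix \<psi> b assume \<psi>: "lf sc \<psi>"
    show "(\<Sum>z\<leftarrow>xs. \<phi> (fst (fst z) a) * \<psi> (fst (snd z) b)) = (\<Sum>z\<leftarrow>ys. \<phi> (fst (fst z) a) * \<psi> (fst (snd z) b))"
      using eq[OF \<phi> \<psi>, of a b] by (simp add: ten2_apply lf_fst \<phi> \<psi> case_prod_unfold)
  qed (use xs ys in auto)
  have "(\<Sum>z\<leftarrow>xs. g (snd z) * f (fst z)) = (\<Sum>z\<leftarrow>ys. g (snd z) * f (fst z))"
    by (rule R_functional_eq[OF _ _ _ f]) (use xs ys 1 in \<open>auto simp: mult.commute\<close>)
  then show "ten2 (scM sc) xs f g = ten2 (scM sc) ys f g"
    by (simp add: ten2_apply f g case_prod_unfold mult.commute)
qed simp_all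

lemma embedM_mlt: "set xs \<subseteq> R \<times> R \<Longrightarrow> mlt (embedM sc xs)"
proof (induction xs)
  case Nil
  show ?case by (simp add: embedM_def mlt_null)
next
  case (Cons z xs)
  obtain p q where z: "z = (p,q)" by (cases z)
  have "mlt (mten sc p q)" using Cons.prems z by (auto intro!: mlt_mten R_lop R_multiplier)
  moreover have "mlt (embedM sc xs)" using Cons by simp
  ultimately show ?case by (simp add: embedM_def z mlt_plus)
qed

lemma embedM_ten:
  assumes "set xs \<subseteq> R \<times> R" "lf sc f" "lf sc g"
  shows "fst (embedM sc xs) (ten sc a b) f g = (\<Sum>(p,q)\<leftarrow>xs. f (fst p a) * g (fst q b))"
    and "snd (embedM sc xs) (ten sc a b) f g = (\<Sum>(p,q)\<leftarrow>xs. f (snd p a) * g (snd q b))"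
proof -
  have "tmap2 sc (fst p) (fst q) (ten sc a b) f g = f (fst p a) * g (fst q b) \<and>
      tmap2 sc (snd p) (snd q) (ten sc a b) f g = f (snd p a) * g (snd q b)" if "(p,q) \<in> set xs" for p q
  proof -
    have "p \<in> R" "q \<in> R" using that assms(1) by auto
    then show ?thesis using assms(2,3) by (simp only: tmap2_ten R_lop ten_apply)
  qed
  then show "fst (embedM sc xs) (ten sc a b) f g = (\<Sum>(p,q)\<leftarrow>xs. f (fst p a) * g (fst q b))"
    "snd (embedM sc xs) (ten sc a b) f g = (\<Sum>(p,q)\<leftarrow>xs. f (snd p a) * g (snd q b))"
    by (auto simp: embedM_def fst_sum_list snd_sum_list sum_list_fun1 case_prod_unfold mten_def
        intro!: arg_cong[of _ _ sum_list] map_cong)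
qed

lemma lift_image:
  assumes t: "lifts w (ten2 sc zs)" and xs: "xs = map (\<lambda>(u,v). (P u, P v)) zs"
  shows "set xs \<subseteq> R \<times> R"
    and "meq (T2s sc) (embedM sc xs) (mprod (mten sc (P w) (id,id)) F)"
    and "meq (T2s sc) (embedM sc xs) (mprod F (mten sc (id,id) (P w)))"
    and "lf (scM sc) f \<Longrightarrow> lf (scM sc) g \<Longrightarrow> ten2 (scM sc) xs f g = ten2 sc zs (\<lambda>u. f (P u)) (\<lambda>v. g (P v))"
proof -
  show sub: "set xs \<subseteq> R \<times> R" by (auto simp: xs)
  have em: "snd (embedM sc xs) (ten sc x c) f g = snd F (ten sc (snd (P w) x) c) f g"
    if "lf sc f" "lf sc g" for x c f g
  proof -
    have "snd (embedM sc xs) (ten sc x c) f g = ten2 sc zs (\<lambda>u. f (snd (P u) x)) (\<lambda>v. g (snd (P v) c))"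
      using embedM_ten(2)[OF sub that, of x c] that
      by (simp add: xs ten2_apply lf_P_arg comp_def case_prod_unfold)
    then show ?thesis using t that by (simp add: lifts_def)
  qed
  show "meq (T2s sc) (embedM sc xs) (mprod (mten sc (P w) (id,id)) F)"
  proof (rule mlt_eqI)
    show "mlt (mprod (mten sc (P w) (id, id)) F)"
      by (intro mlt_prod mlt_mten F_mlt) (simp_all add: P_lop lop_id P_multiplier)
  qed (simp_all add: embedM_mlt sub em mprod_def mten_def tmap2_ten P_lop lop_id)
  show "meq (T2s sc) (embedM sc xs) (mprod F (mten sc (id,id) (P w)))"
  proof (rule mlt_eqI)
    show "mlt (mprod F (mten sc (id, id) (P w)))"
      by (intro mlt_prod mlt_mten F_mlt) (simp_all add: P_lop lop_id P_multiplier)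
  qed (simp_all add: embedM_mlt sub em mprod_def mten_def tmap2_apply F_P_comm)
  show "ten2 (scM sc) xs f g = ten2 sc zs (\<lambda>u. f (P u)) (\<lambda>v. g (P v))"
    if "lf (scM sc) f" "lf (scM sc) g" for f g
    using that by (simp add: xs ten2_apply P_arg_lf comp_def case_prod_unfold)
qed

text \<open>\<open>\<Sum> p \<otimes> q\<close> represents \<open>(r \<otimes> 1)F\<close>, expressed through left actions only.\<close>

definition is_delta :: "'a mltp \<Rightarrow> ('a mltp \<times> 'a mltp) list \<Rightarrow> bool" where
  "is_delta r xs \<longleftrightarrow> set xs \<subseteq> R \<times> R \<and> (\<forall>\<phi> \<psi> a b. lf sc \<phi> \<longrightarrow> lf sc \<psi> \<longrightarrow>
     ten2 (scM sc) xs (\<lambda>p. \<phi> (fst p a)) (\<lambda>q. \<psi> (fst q b)) = fst F (ten sc a b) (\<lambda>x. \<phi> (fst r x)) \<psi>)"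

text \<open>On R the chosen list does not matter, by \<open>is_delta_delta\<close>. Off R the choice
  may be arbitrary, but its value is still a tensor.\<close>

definition delta :: "'a mltp \<Rightarrow> ('k, 'a mltp) form2" where
  "delta r = ten2 (scM sc) (SOME xs. is_delta r xs)"

lemma is_delta_embedM:
  assumes sub: "set xs \<subseteq> R \<times> R"
    and m: "meq (T2s sc) (embedM sc xs) (mprod (mten sc r (id,id)) F)"
  shows "is_delta r xs"
  unfolding is_delta_def
proof (intro conjI allI impI sub)
  fix \<phi> \<psi> :: "'a \<Rightarrow> 'k" and a b assume l: "lf sc \<phi>" "lf sc \<psi>"
  have "fst (embedM sc xs) (ten sc a b) \<phi> \<psi> = fst F (ten sc a b) (\<lambda>x. \<phi> (fst r x)) \<psi>"
    using m l by (simp add: meq_def mprod_def mten_def tmap2_apply)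
  then show "ten2 (scM sc) xs (\<lambda>p. \<phi> (fst p a)) (\<lambda>q. \<psi> (fst q b)) = fst F (ten sc a b) (\<lambda>x. \<phi> (fst r x)) \<psi>"
    using embedM_ten(1)[OF sub l, of a b] l by (simp add: ten2_apply lf_fst)
qed

lemma is_delta_exists: "r \<in> R \<Longrightarrow> \<exists>xs. is_delta r xs"
proof (elim rangeE)
  fix w assume r: "r = P w"
  obtain zs where "lifts w (ten2 sc zs)" using lifts_exists by blast
  from lift_image(1,2)[OF this refl] show ?thesis unfolding r by (blast intro: is_delta_embedM)
qed

lemma is_delta_delta: "is_delta r xs \<Longrightarrow> delta r = ten2 (scM sc) xs"
proof -
  assume a: "is_delta r xs"
  define ys where "ys = (SOME xs. is_delta r xs)"
  have b: "is_delta r ys" unfolding ys_def using a by (rule someI)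
  have "ten2 (scM sc) ys = ten2 (scM sc) xs"
    by (rule ten2_R_eqI) (use a b in \<open>simp_all add: is_delta_def\<close>)
  then show ?thesis by (simp add: delta_def ys_def)
qed

lemma lifts_delta:
  assumes "lifts w (ten2 sc zs)"
  shows "delta (P w) = ten2 (scM sc) (map (\<lambda>(u,v). (P u, P v)) zs)"
  by (rule is_delta_delta[OF is_delta_embedM[OF lift_image(1,2)[OF assms refl]]])

lemma delta_in: "delta r \<in> T2s (scM sc)"
  by (simp add: delta_def)

lemma delta_eval_left:
  assumes "r \<in> R" "lf sc \<phi>" "lf sc \<psi>"
  shows "delta r (\<lambda>p. \<phi> (fst p a)) (\<lambda>q. \<psi> (fst q b)) = fst F (ten sc a b) (\<lambda>x. \<phi> (fst r x)) \<psi>"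
  using is_delta_exists[OF assms(1)] assms(2,3) by (auto simp: is_delta_delta is_delta_def)

lemma delta_eval_right:
  assumes "r \<in> R" and l: "lf sc \<phi>" "lf sc \<psi>"
  shows "delta r (\<lambda>p. \<phi> (fst p a)) (\<lambda>q. \<psi> (fst q b)) = fst F (ten sc a (fst r b)) \<phi> \<psi>"
proof -
  obtain w where r: "r = P w" using assms by blast
  obtain zs where z: "lifts w (ten2 sc zs)" using lifts_exists by blast
  define xs where "xs = map (\<lambda>(u,v). (P u, P v)) zs"
  note i = lift_image[OF z xs_def]
  have "delta r = ten2 (scM sc) xs" unfolding r xs_def by (rule lifts_delta[OF z])
  then have "delta r (\<lambda>p. \<phi> (fst p a)) (\<lambda>q. \<psi> (fst q b)) = fst (embedM sc xs) (ten sc a b) \<phi> \<psi>"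
    using embedM_ten(1)[OF i(1) l, of a b] l by (simp add: ten2_apply lf_fst)
  also have "\<dots> = fst F (ten sc a (fst r b)) \<phi> \<psi>"
    using i(3) by (simp add: meq_def mprod_def mten_def tmap2_ten P_lop lop_id r)
  finally show ?thesis .
qed

lemma delta_add: assumes "r \<in> R" "s \<in> R" shows "delta (r + s) = delta r + delta s"
proof -
  obtain xs ys where d: "is_delta r xs" "is_delta s ys" using is_delta_exists assms by blast
  have "is_delta (r + s) (xs @ ys)"
    unfolding is_delta_def
  proof (intro conjI allI impI)
    show "set (xs @ ys) \<subseteq> R \<times> R" using d by (simp add: is_delta_def)
    fix \<phi> \<psi> :: "'a \<Rightarrow> 'k" and a b assume l: "lf sc \<phi>" "lf sc \<psi>"
    let ?t = "fst F (ten sc a b)"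
    have t: "?t \<in> T2s sc" by (simp add: mlt_closed F_mlt)
    have lr: "lf sc (\<lambda>x. \<phi> (fst r x))" "lf sc (\<lambda>x. \<phi> (fst s x))" 
      using lf_lop[OF l(1) R_lop(1)[OF assms(1)]] lf_lop[OF l(1) R_lop(1)[OF assms(2)]] .
    have "?t (\<lambda>x. \<phi> (fst r x)) \<psi> + ?t (\<lambda>x. \<phi> (fst s x)) \<psi> = ?t (\<lambda>x. \<phi> (fst (r + s) x)) \<psi>"
      using slice_r_apply[OF t l(2) lr(1)] slice_r_apply[OF t l(2) lr(2)]
        slice_r_apply[OF t l(2), of "\<lambda>x. \<phi> (fst (r + s) x)"] lf_combination[OF lr]
      by (simp add: lf_add[OF l(1)])
    then show "ten2 (scM sc) (xs @ ys) (\<lambda>p. \<phi> (fst p a)) (\<lambda>q. \<psi> (fst q b)) = ?t (\<lambda>x. \<phi> (fst (r + s) x)) \<psi>"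
      using d l by (simp add: ten2_append is_delta_def)
  qed
  then show ?thesis using d by (simp add: is_delta_delta ten2_append)
qed

lemma delta_scale: assumes "r \<in> R" shows "delta (scM sc c r) = fsc2 c (delta r)"
proof -
  obtain xs where d: "is_delta r xs" using is_delta_exists assms by blast
  define ys where "ys = map (\<lambda>z. (scM sc c (fst z), snd z)) xs"
  have ys: "ten2 (scM sc) ys = fsc2 c (ten2 (scM sc) xs)"
    by (auto simp: ys_def ten2_def fsc2_def fun_eq_iff comp_def case_prod_unfold lf_scale
        sum_list_const_mult mult.assoc)
  have "is_delta (scM sc c r) ys"
    unfolding is_delta_def ys
  proof (intro conjI allI impI)
    show "set ys \<subseteq> R \<times> R"
    proof
      fix z assume "z \<in> set ys"
      then obtain y where y: "y \<in> set xs" "z = (scM sc c (fst y), snd y)" by (auto simp: ys_def)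
      then have "y \<in> R \<times> R" using d by (auto simp: is_delta_def)
      then show "z \<in> R \<times> R" by (simp add: y mem_Times_iff R_scale)
    qed
    fix \<phi> \<psi> :: "'a \<Rightarrow> 'k" and a b assume l: "lf sc \<phi>" "lf sc \<psi>"
    let ?t = "fst F (ten sc a b)"
    have t: "?t \<in> T2s sc" by (simp add: mlt_closed F_mlt)
    have lr: "lf sc (\<lambda>x. \<phi> (fst r x))" "lf sc (\<lambda>x. \<phi> (fst (scM sc c r) x))"
      using lf_lop[OF l(1) R_lop(1)[OF assms]] lf_lop[OF l(1) R_lop(1)[OF R_scale[OF assms]]] .
    have "c * ?t (\<lambda>x. \<phi> (fst r x)) \<psi> = ?t (\<lambda>x. \<phi> (fst (scM sc c r) x)) \<psi>"
      using slice_r_apply[OF t l(2) lr(1)] slice_r_apply[OF t l(2) lr(2)]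
      by (simp add: scM_def lf_scale[OF l(1)])
    then show "fsc2 c (ten2 (scM sc) xs) (\<lambda>p. \<phi> (fst p a)) (\<lambda>q. \<psi> (fst q b)) = ?t (\<lambda>x. \<phi> (fst (scM sc c r) x)) \<psi>"
      using d l by (simp add: fsc2_def is_delta_def)
  qed
  then show ?thesis using d by (simp add: is_delta_delta ys)
qed

text \<open>Slices are formed in the whole space of pairs of maps; lying in R admits them to
  \<open>R_functional_eq\<close>.\<close>

lemma delta_slices:
  assumes "r \<in> R" "lf (scM sc) g"
  shows "slice_r (scM sc) (delta r) g \<in> R" "slice_l (scM sc) g (delta r) \<in> R"
proof -
  obtain xs where d: "is_delta r xs" using is_delta_exists assms by blast
  then have xs: "set xs \<subseteq> R \<times> R" by (simp add: is_delta_def)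
  have "slice_r (scM sc) (delta r) g = (\<Sum>z\<leftarrow>xs. scM sc (g (snd z)) (fst z))"
    by (rule M.slice_r_eqI)
       (use assms(2) in \<open>simp_all add: is_delta_delta[OF d] ten2_apply lf_sum_list lf_scale case_prod_unfold mult.commute\<close>)
  then show "slice_r (scM sc) (delta r) g \<in> R" using xs by (auto intro!: R_sum_list R_scale)
  have "slice_l (scM sc) g (delta r) = (\<Sum>z\<leftarrow>xs. scM sc (g (fst z)) (snd z))"
    by (rule M.slice_l_eqI)
       (use assms(2) in \<open>simp_all add: is_delta_delta[OF d] ten2_apply lf_sum_list lf_scale case_prod_unfold mult.commute\<close>)
  then show "slice_l (scM sc) g (delta r) \<in> R" using xs by (auto intro!: R_sum_list R_scale)
qed

section \<open>Coassociativity\<close>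

lemma coassoc_eval:
  assumes r: "r \<in> R" and sub: "set xs \<subseteq> R \<times> R" and xs: "ten2 (scM sc) xs = delta r"
    and l: "lf sc \<phi>" "lf sc \<chi>" "lf sc \<psi>"
  shows "(\<Sum>z\<leftarrow>xs. delta (fst z) (\<lambda>p. \<phi> (fst p a)) (\<lambda>p. \<chi> (fst p b)) * \<psi> (fst (snd z) c)) =
    (\<Sum>z\<leftarrow>xs. \<phi> (fst (fst z) a) * delta (snd z) (\<lambda>p. \<chi> (fst p b)) (\<lambda>p. \<psi> (fst p c)))"
proof -
  \<comment> \<open>The common value of both sides is \<open>\<theta> (fst r m)\<close>:
    \<open>\<theta>\<close> records F on the first two legs under \<phi> and \<chi>, and
    \<open>m\<close> is what F leaves of b \<otimes> c once \<psi> is evaluated. The two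
    descriptions of \<open>delta r\<close> meet at this value.\<close>
  define \<theta> where "\<theta> = (\<lambda>x. fst F (ten sc a x) \<phi> \<chi>)"
  define m where "m = slice_r sc (fst F (ten sc b c)) \<psi>"
  have R: "fst z \<in> R" "snd z \<in> R" if "z \<in> set xs" for z using sub that by auto
  have \<theta>: "lf sc \<theta>" unfolding \<theta>_def by (rule lf_mlt_right[OF F_mlt])
  have m: "k m = fst F (ten sc b c) k \<psi>" if "lf sc k" for k
    unfolding m_def by (rule slice_r_apply) (simp_all add: mlt_closed F_mlt l that)
  have "(\<Sum>z\<leftarrow>xs. delta (fst z) (\<lambda>p. \<phi> (fst p a)) (\<lambda>p. \<chi> (fst p b)) * \<psi> (fst (snd z) c)) =
      (\<Sum>z\<leftarrow>xs. \<theta> (fst (fst z) b) * \<psi> (fst (snd z) c))"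
    using R by (intro arg_cong[of _ _ sum_list] map_cong refl) (simp add: delta_eval_right l \<theta>_def)
  also have "\<dots> = delta r (\<lambda>p. \<theta> (fst p b)) (\<lambda>p. \<psi> (fst p c))"
    using \<theta> l by (simp add: xs[symmetric] ten2_apply lf_fst case_prod_unfold)
  also have "\<dots> = \<theta> (fst r m)"
    using m[of "\<lambda>x. \<theta> (fst r x)"] lf_lop[OF \<theta> R_lop(1)[OF r]] by (simp add: delta_eval_left r \<theta> l)
  also have "\<dots> = delta r (\<lambda>p. \<phi> (fst p a)) (\<lambda>p. \<chi> (fst p m))"
    by (simp add: delta_eval_right r l \<theta>_def)
  also have "\<dots> = (\<Sum>z\<leftarrow>xs. \<phi> (fst (fst z) a) * \<chi> (fst (snd z) m))"
    using l by (simp add: xs[symmetric] ten2_apply lf_fst case_prod_unfold)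
  also have "\<dots> = (\<Sum>z\<leftarrow>xs. \<phi> (fst (fst z) a) * delta (snd z) (\<lambda>p. \<chi> (fst p b)) (\<lambda>p. \<psi> (fst p c)))"
  proof (intro arg_cong[of _ _ sum_list] map_cong refl)
    fix z assume "z \<in> set xs"
    then have z: "snd z \<in> R" by (rule R)
    show "\<phi> (fst (fst z) a) * \<chi> (fst (snd z) m) =
        \<phi> (fst (fst z) a) * delta (snd z) (\<lambda>p. \<chi> (fst p b)) (\<lambda>p. \<psi> (fst p c))"
      using m[OF lf_lop[OF l(2) R_lop(1)[OF z]]] by (simp add: delta_eval_left[OF z] l)
  qed
  finally show ?thesis .
qed

text \<open>The evaluations in \<open>coassoc_eval\<close> are replaced by arbitrary functionals,
  one leg per round; slices of \<open>delta\<close> present each sum as a functional applied to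
  elements of R in the current leg.\<close>

lemma coassoc:
  assumes r: "r \<in> R" and sub: "set xs \<subseteq> R \<times> R" and xs: "ten2 (scM sc) xs = delta r"
    and f: "lf (scM sc) f" and g: "lf (scM sc) g" and h: "lf (scM sc) h"
  shows "(\<Sum>z\<leftarrow>xs. delta (fst z) f g * h (snd z)) = (\<Sum>z\<leftarrow>xs. f (fst z) * delta (snd z) g h)"
proof -
  have R: "fst z \<in> R" "snd z \<in> R" if "z \<in> set xs" for z using sub that by auto
  have 1: "(\<Sum>z\<leftarrow>xs. delta (fst z) f (\<lambda>p. \<chi> (fst p b)) * \<psi> (fst (snd z) c)) =
      (\<Sum>z\<leftarrow>xs. f (fst z) * delta (snd z) (\<lambda>p. \<chi> (fst p b)) (\<lambda>p. \<psi> (fst p c)))"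
    if l: "lf sc \<chi>" "lf sc \<psi>" for \<chi> \<psi> b c
  proof -
    have s: "k (slice_r (scM sc) (delta p) (\<lambda>p. \<chi> (fst p b))) = delta p k (\<lambda>p. \<chi> (fst p b))"
      if "lf (scM sc) k" for k p
      by (rule M.slice_r_apply) (simp_all add: delta_in lf_fst l that)
    have "(\<Sum>z\<leftarrow>xs. \<psi> (fst (snd z) c) * f (slice_r (scM sc) (delta (fst z)) (\<lambda>p. \<chi> (fst p b)))) =
        (\<Sum>z\<leftarrow>xs. delta (snd z) (\<lambda>p. \<chi> (fst p b)) (\<lambda>p. \<psi> (fst p c)) * f (fst z))"
    proof (rule R_functional_eq[OF _ _ _ f])
      fix \<phi> a assume \<phi>: "lf sc \<phi>"
      show "(\<Sum>z\<leftarrow>xs. \<psi> (fst (snd z) c) * \<phi> (fst (slice_r (scM sc) (delta (fst z)) (\<lambda>p. \<chi> (fst p b))) a)) =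
          (\<Sum>z\<leftarrow>xs. delta (snd z) (\<lambda>p. \<chi> (fst p b)) (\<lambda>p. \<psi> (fst p c)) * \<phi> (fst (fst z) a))"
        using coassoc_eval[OF r sub xs \<phi> l] s[OF lf_fst[OF \<phi>]] by (simp add: mult.commute)
    qed (use R in \<open>simp_all add: delta_slices lf_fst l\<close>)
    then show ?thesis using s[OF f] by (simp add: mult.commute)
  qed
  have 2: "(\<Sum>z\<leftarrow>xs. delta (fst z) f g * \<psi> (fst (snd z) c)) =
      (\<Sum>z\<leftarrow>xs. f (fst z) * delta (snd z) g (\<lambda>p. \<psi> (fst p c)))"
    if l: "lf sc \<psi>" for \<psi> c
  proof -
    have s: "k (slice_l (scM sc) f (delta p)) = delta p f k"
      "k (slice_r (scM sc) (delta p) (\<lambda>p. \<psi> (fst p c))) = delta p k (\<lambda>p. \<psi> (fst p c))"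
      if "lf (scM sc) k" for k p
      by (rule M.slice_l_apply M.slice_r_apply; simp add: delta_in lf_fst l f that)+
    have "(\<Sum>z\<leftarrow>xs. \<psi> (fst (snd z) c) * g (slice_l (scM sc) f (delta (fst z)))) =
        (\<Sum>z\<leftarrow>xs. f (fst z) * g (slice_r (scM sc) (delta (snd z)) (\<lambda>p. \<psi> (fst p c))))"
    proof (rule R_functional_eq[OF _ _ _ g])
      fix \<chi> b assume \<chi>: "lf sc \<chi>"
      show "(\<Sum>z\<leftarrow>xs. \<psi> (fst (snd z) c) * \<chi> (fst (slice_l (scM sc) f (delta (fst z))) b)) =
          (\<Sum>z\<leftarrow>xs. f (fst z) * \<chi> (fst (slice_r (scM sc) (delta (snd z)) (\<lambda>p. \<psi> (fst p c))) b))"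
        using 1[OF \<chi> l] s[OF lf_fst[OF \<chi>]] by (simp add: mult.commute)
    qed (use R in \<open>simp_all add: delta_slices lf_fst l f\<close>)
    then show ?thesis using s[OF g] by (simp add: mult.commute)
  qed
  have s: "k (slice_l (scM sc) g (delta p)) = delta p g k" if "lf (scM sc) k" for k p
    by (rule M.slice_l_apply) (simp_all add: delta_in g that)
  have "(\<Sum>z\<leftarrow>xs. delta (fst z) f g * h (snd z)) =
      (\<Sum>z\<leftarrow>xs. f (fst z) * h (slice_l (scM sc) g (delta (snd z))))"
  proof (rule R_functional_eq[OF _ _ _ h])
    fix \<psi> c assume \<psi>: "lf sc \<psi>"
    show "(\<Sum>z\<leftarrow>xs. delta (fst z) f g * \<psi> (fst (snd z) c)) =
        (\<Sum>z\<leftarrow>xs. f (fst z) * \<psi> (fst (slice_l (scM sc) g (delta (snd z))) c))"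
      using 2[OF \<psi>] s[OF lf_fst[OF \<psi>]] by simp
  qed (use R in \<open>simp_all add: delta_slices g\<close>)
  then show ?thesis using s[OF h] by simp
qed

text \<open>A linear right inverse of \<open>P\<close> on R. It is linear on all pairs of maps, so
  functionals built from it are linear in the sense of \<open>lf\<close>.\<close>

lemma P_section: "\<exists>\<sigma>. (\<forall>r s. \<sigma> (r + s) = \<sigma> r + \<sigma> s) \<and> (\<forall>c r. \<sigma> (scM sc c r) = sc c (\<sigma> r)) \<and>
    (\<forall>a. P (\<sigma> (P a)) = P a)"
proof -
  interpret vector_space_pair sc "scM sc" by unfold_locales
  have "Vector_Spaces.linear sc (scM sc) P"
    by (simp add: linear_iff P_add P_scale vector_space_axioms M.vector_space_axioms)
  from linear_exists_right_inverse_on[OF this subspace_UNIV]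
  obtain \<sigma> where "Vector_Spaces.linear (scM sc) sc \<sigma>" "\<forall>v\<in>range P. P (\<sigma> v) = v" by blast
  then show ?thesis by (intro exI[of _ \<sigma>]) (auto simp: linear_iff)
qed

lemma lift_eps:
  assumes t: "lifts w (ten2 sc zs)"
  shows "eps w = (\<Sum>(u,v)\<leftarrow>zs. eps (snd (P v) u))"
proof -
  have "snd E (ten2 sc zs) f g = (\<Sum>(u,v)\<leftarrow>zs. ER u v f g)" for zs f g
  proof (induction zs)
    case Nil
    show ?case unfolding ten2_Nil by (simp add: mlt_zero[OF E_mlt])
  next
    case (Cons z zs)
    obtain u v where z: "z = (u,v)" by (cases z)
    show ?case unfolding z ten2_Cons mlt_add(2)[OF E_mlt ten_in_T2s ten2_in_T2s]
      by (simp add: Cons)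
  qed
  then have "ten2 sc zs eps eps = (\<Sum>(u,v)\<leftarrow>zs. ER u v eps eps)"
    using t unfolding lifts_def by metis
  then show ?thesis using t by (simp add: lifts_def P_snd)
qed

lemma eps_cong:
  assumes "P w = P w'" shows "eps w = eps w'"
proof -
  obtain \<sigma> where \<sigma>: "\<And>r s. \<sigma> (r + s) = \<sigma> r + \<sigma> s" "\<And>c r. \<sigma> (scM sc c r) = sc c (\<sigma> r)"
    "\<And>a. P (\<sigma> (P a)) = P a"
    using P_section by blast
  obtain zs zs' where z: "lifts w (ten2 sc zs)" "lifts w' (ten2 sc zs')" using lifts_exists by blast
  \<comment> \<open>\<open>B\<close> extends (P u, P v) \<mapsto> eps(u P(v)) to a bilinear map on
    all pairs of maps; that \<open>\<sigma>\<close> may pick another preimage of \<open>P u\<close>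
    is harmless by \<open>eps_snd_P_cong\<close>.\<close>
  define B where "B = (\<lambda>p q. eps (snd (P (\<sigma> q)) (\<sigma> p)))"
  have B: "B (P u) (P v) = eps (snd (P v) u)" for u v
    unfolding B_def \<sigma>(3) by (rule eps_snd_P_cong) (rule \<sigma>(3))
  have B1: "lf (scM sc) (\<lambda>p. B p q)" for q
    using P_lop(2)[of "\<sigma> q"] by (simp add: B_def lf_def[of "scM sc"] \<sigma> lop_def lf_add[OF eps_lf] lf_scale[OF eps_lf])
  have B2: "lf (scM sc) (B p)" for p
    by (simp add: B_def lf_def[of "scM sc"] \<sigma> P_add P_scale lf_add[OF eps_lf])
       (simp add: scM_def lf_scale[OF eps_lf])
  let ?m = "map (\<lambda>(u,v). (P u, P v))"
  have "ten2 (scM sc) (?m zs) = delta (P w)" "ten2 (scM sc) (?m zs') = delta (P w')"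
    using z by (simp_all add: lifts_delta)
  \<comment> \<open>\<open>delta\<close> depends on \<open>P w\<close> alone, so the lifts of
    \<open>w\<close> and \<open>w'\<close> have the same image in R \<otimes> R, and the bilinear
    \<open>B\<close> cannot tell them apart.\<close>
  then have "ten2 (scM sc) (?m zs) = ten2 (scM sc) (?m zs')" using assms by simp
  from M.ten2_universal[OF this B1 B2] show ?thesis
    using lift_eps[OF z(1)] lift_eps[OF z(2)] by (simp add: comp_def case_prod_unfold B)
qed

lemma coalgebra: "coalg_R sc mu E D eps F"
proof -
  obtain \<sigma> where \<sigma>: "\<And>r s. \<sigma> (r + s) = \<sigma> r + \<sigma> s" "\<And>c r. \<sigma> (scM sc c r) = sc c (\<sigma> r)"
    "\<And>a. P (\<sigma> (P a)) = P a"
    using P_section by blast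
  define epsR where "epsR = (\<lambda>r. eps (\<sigma> r))"
  have epsR: "epsR (P a) = eps a" for a
    unfolding epsR_def by (rule eps_cong) (rule \<sigma>(3))
  have epsR_lf: "lf (scM sc) epsR"
    by (simp add: epsR_def lf_def[of "scM sc"] \<sigma> lf_add[OF eps_lf] lf_scale[OF eps_lf])
  have ex: "\<exists>xs. set xs \<subseteq> R \<times> R \<and> delta (P a) = ten2 (scM sc) xs \<and>
      meq (T2s sc) (embedM sc xs) (mprod (mten sc (P a) (id, id)) F) \<and>
      meq (T2s sc) (embedM sc xs) (mprod F (mten sc (id, id) (P a)))" for a
  proof -
    obtain zs where z: "lifts a (ten2 sc zs)" using lifts_exists by blast
    show ?thesis
      by (intro exI[of _ "map (\<lambda>(u,v). (P u, P v)) zs"] conjI lift_image[OF z refl] lifts_delta[OF z])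
  qed
  have counit: "(\<Sum>(p,q)\<leftarrow>xs. scM sc (epsR p) q) = r" "(\<Sum>(p,q)\<leftarrow>xs. scM sc (epsR q) p) = r"
    if r: "r \<in> R" and xs: "ten2 (scM sc) xs = delta r" for r xs
  proof -
    obtain w where w: "r = P w" using r by blast
    obtain zs where z: "lifts w (ten2 sc zs)" using lifts_exists by blast
    let ?t = "ten2 sc zs"
    have d: "delta r f g = ?t (\<lambda>u. f (P u)) (\<lambda>v. g (P v))" if "lf (scM sc) f" "lf (scM sc) g" for f g
      unfolding w lifts_delta[OF z] by (rule lift_image(4)[OF z refl that])
    \<comment> \<open>For \<open>eps\<close> on the second leg, \<open>lifts\<close> returns
      \<open>w\<close> itself; for \<open>eps\<close> on the first it gives only agreement under y
      \<mapsto> eps(y b), which suffices for the images under \<open>P\<close>.\<close>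
    have l: "P (slice_l sc eps ?t) = P w"
    proof (rule P_eqI)
      fix b show "eps (mu (slice_l sc eps ?t) b) = eps (mu w b)"
        using slice_l_apply[of ?t eps "\<lambda>y. eps (mu y b)"] z by (simp add: lifts_def)
    qed
    show "(\<Sum>(p,q)\<leftarrow>xs. scM sc (epsR p) q) = r"
    proof (rule M.lf_separates)
      fix f assume f: "lf (scM sc) f"
      have "f (\<Sum>(p,q)\<leftarrow>xs. scM sc (epsR p) q) = delta r epsR f"
        using f by (simp add: xs[symmetric] ten2_apply epsR_lf lf_sum_list lf_scale case_prod_unfold)
      also have "\<dots> = ?t eps (\<lambda>v. f (P v))" using d[OF epsR_lf f] by (simp add: epsR)
      also have "\<dots> = f (P (slice_l sc eps ?t))"
        by (rule slice_l_apply[symmetric]) (simp_all add: P_arg_lf f)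
      finally show "f (\<Sum>(p,q)\<leftarrow>xs. scM sc (epsR p) q) = f r" by (simp add: l w)
    qed
    show "(\<Sum>(p,q)\<leftarrow>xs. scM sc (epsR q) p) = r"
    proof (rule M.lf_separates)
      fix f assume f: "lf (scM sc) f"
      have "f (\<Sum>(p,q)\<leftarrow>xs. scM sc (epsR q) p) = delta r f epsR"
        using f by (simp add: xs[symmetric] ten2_apply epsR_lf lf_sum_list lf_scale case_prod_unfold mult.commute)
      also have "\<dots> = f (P w)" using d[OF f epsR_lf] z P_arg_lf[OF f] by (simp add: epsR lifts_def)
      finally show "f (\<Sum>(p,q)\<leftarrow>xs. scM sc (epsR q) p) = f r" by (simp add: w)
    qed
  qed
  show ?thesis
    unfolding coalg_R_def Let_def
  proof (intro conjI exI[of _ epsR] exI[of _ delta])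
    show "\<forall>r\<in>R. \<forall>s\<in>R. r + s \<in> R" "\<forall>c. \<forall>r\<in>R. scM sc c r \<in> R" using R_add R_scale by blast+
    show "\<forall>a. \<exists>xs. set xs \<subseteq> R \<times> R \<and> delta (P a) = ten2 (scM sc) xs \<and>
      meq (T2s sc) (embedM sc xs) (mprod (mten sc (P a) (id, id)) F) \<and>
      meq (T2s sc) (embedM sc xs) (mprod F (mten sc (id, id) (P a)))" using ex by blast
    show "\<forall>r\<in>R. \<forall>s\<in>R. epsR (r + s) = epsR r + epsR s \<and> delta (r + s) = delta r + delta s"
      using delta_add lf_add[OF epsR_lf] by blast
    show "\<forall>c. \<forall>r\<in>R. epsR (scM sc c r) = c * epsR r \<and> delta (scM sc c r) = fsc2 c (delta r)"
      using delta_scale lf_scale[OF epsR_lf] by blast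
    show "\<forall>r\<in>R. \<forall>xs. set xs \<subseteq> R \<times> R \<and> ten2 (scM sc) xs = delta r \<longrightarrow>
        (\<lambda>f g h. if lf (scM sc) f \<and> lf (scM sc) g \<and> lf (scM sc) h
                  then (\<Sum>(p,q)\<leftarrow>xs. delta p f g * h q) else 0) =
        (\<lambda>f g h. if lf (scM sc) f \<and> lf (scM sc) g \<and> lf (scM sc) h
                  then (\<Sum>(p,q)\<leftarrow>xs. f p * delta q g h) else 0)"
    proof (intro ballI allI impI ext)
      fix r xs and f g h :: "'a mltp \<Rightarrow> 'k"
      assume "r \<in> R" and "set xs \<subseteq> R \<times> R \<and> ten2 (scM sc) xs = delta r"
      then show "(if lf (scM sc) f \<and> lf (scM sc) g \<and> lf (scM sc) h
            then \<Sum>(p,q)\<leftarrow>xs. delta p f g * h q else 0) =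
          (if lf (scM sc) f \<and> lf (scM sc) g \<and> lf (scM sc) h
            then \<Sum>(p,q)\<leftarrow>xs. f p * delta q g h else 0)"
        using coassoc[of r xs f g h] by (simp add: case_prod_unfold)
    qed
    show "\<forall>r\<in>R. \<forall>xs. set xs \<subseteq> R \<times> R \<and> ten2 (scM sc) xs = delta r \<longrightarrow>
        (\<Sum>(p,q)\<leftarrow>xs. scM sc (epsR p) q) = r \<and> (\<Sum>(p,q)\<leftarrow>xs. scM sc (epsR q) p) = r"
      using counit by blast
  qed (simp_all add: R_zero epsR)
qed

end

theorem theorem4p4:
  fixes sc :: "'k::field \<Rightarrow> 'a::ab_group_add \<Rightarrow> 'a"
    and mu :: "'a \<Rightarrow> 'a \<Rightarrow> 'a"
    and E :: "('k,'a) form2 mltp"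
    and D :: "'a \<Rightarrow> ('k,'a) form2 mltp"
    and eps :: "'a \<Rightarrow> 'k"
    and F :: "('k,'a) form2 mltp"
  assumes "regular_wmb sc mu E D eps"
    and "right_full_comult sc mu D"
    and "is_F sc mu E D eps F"
  shows "coalg_R sc mu E D eps F"
proof -
  interpret rwmb_F sc mu E D eps F
    by unfold_locales (use assms in auto)
  show ?thesis by (rule coalgebra)
qed

end
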